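(* Suppose the regularity conditions (a)–(e) stated in the context hold for all $P\in\mathcal P$. Then the DML1 and DML2 estimators $\tilde\theta_0$ constructed using either score (A) or score (B) are first-order equivalent and obey $$\sigma^{-1}\sqrt N(\tilde\theta_0-\theta_0)\leadsto N(0,1)$$ uniformly over $P\in\mathcal P$, where $\sigma^2=[\mathrm E_PDV]^{-1}\mathrm E_P[V^2U^2][\mathrm E_PDV]^{-1}$. Moreover, the result continues to hold if $\sigma^2$ is replaced by the variance estimator $\hat\sigma^2$ defined in the context. Consequently, $$\lim_{N\to\infty}\sup_{P\in\mathcal P}\Big|\Pr_P\big(\theta_0\in[\tilde\theta_0\pm\Phi^{-1}(1-\alpha/2)\hat\sigma/\sqrt N]\big)-(1-\alpha)\Big|=0.$$
   Context: Partially linear IV model: $W=(Y,D,X,Z)$ with $Y=D\theta_0+g_0(X)+U$, $\mathrm E_P[U\mid X,Z]=0$, and $Z=m_0(X)+V$, $\mathrm E_P[V\mid X]=0$; $D,Z$ scalar. Scores: (A) $\psi(W;\theta,\eta)=(Y-D\theta-g(X))(Z-m(X))$, $\eta=(g,m)$, true value $(g_0,m_0)$; (B) $\psi(W;\theta,\eta)=(Y-\ell(X)-\theta(D-r(X)))(Z-m(X))$, $\eta=(\ell,m,r)$, true value $(\ell_0,m_0,r_0)$ with $\ell_0(X)=\mathrm E_P[Y\mid X]$, $r_0(X)=\mathrm E_P[D\mid X]$; all these are $P$-square-integrable real functions on the support of $X$. Both scores are linear: $\psi=\psi^a(W;\eta)\theta+\psi^b(W;\eta)$. DML estimators: $K\ge2$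 fixed, $n=N/K$ integer; random partition $(I_k)$ of $[N]$ into folds of size $n$; $\hat\eta_{0,k}$ an estimator of $\eta_0$ computed only from $(W_i)_{i\notin I_k}$; $\mathbb E_{n,k}f=n^{-1}\sum_{i\in I_k}f(W_i)$. DML1: $\check\theta_{0,k}$ solves $\mathbb E_{n,k}\psi(W;\theta,\hat\eta_{0,k})=0$ (up to $\epsilon_N=o(\delta_NN^{-1/2})$ in norm) and $\tilde\theta_0=K^{-1}\sum_k\check\theta_{0,k}$; DML2: $\tilde\theta_0$ solves $K^{-1}\sum_k\mathbb E_{n,k}\psi(W;\theta,\hat\eta_{0,k})=0$ (up to $\epsilon_N$). Variance estimator: $\hat\sigma^2=\hat J_0^{-2}K^{-1}\sum_k\mathbb E_{n,k}[\psi(W;\tilde\theta_0,\hat\eta_{0,k})^2]$, $\hat J_0=K^{-1}\sum_k\mathbb E_{n,k}\psi^a(W;\hat\eta_{0,k})$. Conditions. $(\delta_N),(\Delta_N)$ positive sequences converging to $0$; $c,C>0$, $q>4$ fixed. $\|f\|_{P,q}=(\mathrm E_P|f(X)|^q)^{1/q}$, and for $\eta=(\ell_j)_{j=1}^l$, $\|\eta\|_{P,q}=\max_j\|\ell_j\|_{P,q}$. For all $P\in\mathcal P$: (a) the model equations hold; (b) $\|Y\|_{P,q}+\|D\|_{P,q}+\|Z\|_{P,q}\le C$; (c) $\|UV\|_{P,2}\ge c^2$ and $|\mathrm E_P[DV]|\ge c$; (d) $\|\mathrm E_P[U^2\mid X]\|_{P,\infty}\le C$ and $\|\mathrm E_P[V^2\mid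 X]\|_{P,\infty}\le C$; (e) given a random subset $I$ of $[N]$ of size $n$, $\hat\eta_0=\hat\eta_0((W_i)_{i\in I^c})$ satisfies with $P$-probability at least $1-\Delta_N$: $\|\hat\eta_0-\eta_0\|_{P,q}\le C$, $\|\hat\eta_0-\eta_0\|_{P,2}\le\delta_N$, and (i) for score (A), $\|\hat m_0-m_0\|_{P,2}\|\hat g_0-g_0\|_{P,2}\le\delta_NN^{-1/2}$; (ii) for score (B), $\|\hat m_0-m_0\|_{P,2}(\|\hat r_0-r_0\|_{P,2}+\|\hat\ell_0-\ell_0\|_{P,2})\le\delta_NN^{-1/2}$. "Uniformly over $P\in\mathcal P$": convergence holds under every sequence $P_N\in\mathcal P$. "First-order equivalent": the estimators differ by $o_P(N^{-1/2})$. $\Phi$ is the standard normal cdf, $\alpha\in(0,1)$. *)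

theory Defs
  imports "HOL-Probability.Probability"
begin

type_synonym 'x obs = "real \<times> real \<times> 'x \<times> real"

definition Yv :: "'x obs \<Rightarrow> real" where "Yv w = fst w"
definition Dv :: "'x obs \<Rightarrow> real" where "Dv w = fst (snd w)"
definition Xv :: "'x obs \<Rightarrow> 'x" where "Xv w = fst (snd (snd w))"
definition Zv :: "'x obs \<Rightarrow> real" where "Zv w = snd (snd (snd w))"

definition obs_space :: "'x measure \<Rightarrow> 'x obs measure" where
  "obs_space SX = borel \<Otimes>\<^sub>M (borel \<Otimes>\<^sub>M (SX \<Otimes>\<^sub>M borel))"

definition sigma_X :: "'x measure \<Rightarrow> 'x obs measure \<Rightarrow> 'x obs measure" where
  "sigma_X SX P = vimage_algebra (space P) Xv SX"
definition sigma_XZ :: "'x measure \<Rightarrow> 'x obs measure \<Rightarrow> 'x obs measure" where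
  "sigma_XZ SX P = vimage_algebra (space P) (\<lambda>w. (Xv w, Zv w)) (SX \<Otimes>\<^sub>M borel)"

definition Lnorm :: "'a measure \<Rightarrow> real \<Rightarrow> ('a \<Rightarrow> real) \<Rightarrow> ennreal" where
  "Lnorm M p f = (let I = (\<integral>\<^sup>+ x. ennreal (\<bar>f x\<bar> powr p) \<partial>M)
                   in if I = \<top> then \<top> else ennreal (enn2real I powr (1 / p)))"

definition fnorm :: "'x obs measure \<Rightarrow> real \<Rightarrow> ('x \<Rightarrow> real) \<Rightarrow> ennreal" where
  "fnorm P p f = Lnorm P p (\<lambda>w. f (Xv w))"

definition Uerr :: "real \<Rightarrow> ('x \<Rightarrow> real) \<Rightarrow> 'x obs \<Rightarrow> real" where
  "Uerr \<theta> g w = Yv w - Dv w * \<theta> - g (Xv w)"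
definition Verr :: "('x \<Rightarrow> real) \<Rightarrow> 'x obs \<Rightarrow> real" where
  "Verr m w = Zv w - m (Xv w)"

definition pliv_model ::
  "'x measure \<Rightarrow> 'x obs measure \<Rightarrow> real \<Rightarrow> ('x \<Rightarrow> real) \<Rightarrow> ('x \<Rightarrow> real)
     \<Rightarrow> ('x \<Rightarrow> real) \<Rightarrow> ('x \<Rightarrow> real) \<Rightarrow> bool" where
  "pliv_model SX P \<theta>0 g0 m0 l0 r0 \<longleftrightarrow>
     prob_space P \<and> sets P = sets (obs_space SX) \<and>
     (\<forall>h\<in>{g0, m0, l0, r0}. h \<in> borel_measurable SX \<and> integrable P (\<lambda>w. (h (Xv w))\<^sup>2)) \<and>
     integrable P (Uerr \<theta>0 g0) \<and> integrable P (Verr m0) \<and>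
     (AE w in P. real_cond_exp P (sigma_XZ SX P) (Uerr \<theta>0 g0) w = 0) \<and>
     (AE w in P. real_cond_exp P (sigma_X SX P) (Verr m0) w = 0) \<and>
     (AE w in P. l0 (Xv w) = real_cond_exp P (sigma_X SX P) Yv w) \<and>
     (AE w in P. r0 (Xv w) = real_cond_exp P (sigma_X SX P) Dv w)"

datatype score = ScoreA | ScoreB

text \<open>Nuisance parameter eta = (f, m, r): for score (A), f = g and the r-slot is unused;
  for score (B), f = l.\<close>
type_synonym 'x nuis = "('x \<Rightarrow> real) \<times> ('x \<Rightarrow> real) \<times> ('x \<Rightarrow> real)"

definition nf :: "'x nuis \<Rightarrow> 'x \<Rightarrow> real" where "nf \<eta> = fst \<eta>"
definition nm :: "'x nuis \<Rightarrow> 'x \<Rightarrow> real" where "nm \<eta> = fst (snd \<eta>)"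
definition nr :: "'x nuis \<Rightarrow> 'x \<Rightarrow> real" where "nr \<eta> = snd (snd \<eta>)"

text \<open>psi = psi_a * theta + psi_b.
  (A): psi = (Y - D theta - g(X))(Z - m(X));
  (B): psi = (Y - l(X) - theta (D - r(X)))(Z - m(X)).\<close>
definition psi_a :: "score \<Rightarrow> 'x nuis \<Rightarrow> 'x obs \<Rightarrow> real" where
  "psi_a sc \<eta> w = (case sc of
       ScoreA \<Rightarrow> - Dv w * (Zv w - nm \<eta> (Xv w))
     | ScoreB \<Rightarrow> - (Dv w - nr \<eta> (Xv w)) * (Zv w - nm \<eta> (Xv w)))"
definition psi_b :: "score \<Rightarrow> 'x nuis \<Rightarrow> 'x obs \<Rightarrow> real" where
  "psi_b sc \<eta> w = (Yv w - nf \<eta> (Xv w)) * (Zv w - nm \<eta> (Xv w))"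
definition psi :: "score \<Rightarrow> real \<Rightarrow> 'x nuis \<Rightarrow> 'x obs \<Rightarrow> real" where
  "psi sc \<theta> \<eta> w = psi_a sc \<eta> w * \<theta> + psi_b sc \<eta> w"

definition eta0 :: "score \<Rightarrow> ('x \<Rightarrow> real) \<Rightarrow> ('x \<Rightarrow> real) \<Rightarrow> ('x \<Rightarrow> real) \<Rightarrow> ('x \<Rightarrow> real) \<Rightarrow> 'x nuis" where
  "eta0 sc g0 m0 l0 r0 = (case sc of ScoreA \<Rightarrow> (g0, m0, r0) | ScoreB \<Rightarrow> (l0, m0, r0))"

definition nuis_dist :: "score \<Rightarrow> 'x obs measure \<Rightarrow> real \<Rightarrow> 'x nuis \<Rightarrow> 'x nuis \<Rightarrow> ennreal" where
  "nuis_dist sc P p \<eta> \<eta>' = (case sc of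
       ScoreA \<Rightarrow> max (fnorm P p (\<lambda>x. nf \<eta> x - nf \<eta>' x)) (fnorm P p (\<lambda>x. nm \<eta> x - nm \<eta>' x))
     | ScoreB \<Rightarrow> max (fnorm P p (\<lambda>x. nf \<eta> x - nf \<eta>' x))
                  (max (fnorm P p (\<lambda>x. nm \<eta> x - nm \<eta>' x)) (fnorm P p (\<lambda>x. nr \<eta> x - nr \<eta>' x))))"

definition rate_cond :: "score \<Rightarrow> 'x obs measure \<Rightarrow> real \<Rightarrow> 'x nuis \<Rightarrow> 'x nuis \<Rightarrow> bool" where
  "rate_cond sc P b \<eta> \<eta>0 = (case sc of
       ScoreA \<Rightarrow> fnorm P 2 (\<lambda>x. nm \<eta> x - nm \<eta>0 x) * fnorm P 2 (\<lambda>x. nf \<eta> x - nf \<eta>0 x) \<le> ennreal b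
     | ScoreB \<Rightarrow> fnorm P 2 (\<lambda>x. nm \<eta> x - nm \<eta>0 x) *
                 (fnorm P 2 (\<lambda>x. nr \<eta> x - nr \<eta>0 x) + fnorm P 2 (\<lambda>x. nf \<eta> x - nf \<eta>0 x)) \<le> ennreal b)"

text \<open>Partitions of [N] = {0..<K*n} into K folds of size n, encoded by fold labels in {0..<K}.\<close>
definition partitions :: "nat \<Rightarrow> nat \<Rightarrow> (nat \<Rightarrow> nat) set" where
  "partitions K n = {f \<in> {..<K*n} \<rightarrow>\<^sub>E {..<K}. \<forall>k<K. card {i\<in>{..<K*n}. f i = k} = n}"

definition fold :: "nat \<Rightarrow> nat \<Rightarrow> (nat \<Rightarrow> nat) \<Rightarrow> nat \<Rightarrow> nat set" where
  "fold K n f k = {i\<in>{..<K*n}. f i = k}"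

definition dml_space :: "'x obs measure \<Rightarrow> nat \<Rightarrow> nat \<Rightarrow> ((nat \<Rightarrow> 'x obs) \<times> (nat \<Rightarrow> nat)) measure" where
  "dml_space P K n = PiM {..<K*n} (\<lambda>_. P) \<Otimes>\<^sub>M uniform_count_measure (partitions K n)"

definition En :: "nat \<Rightarrow> nat set \<Rightarrow> ('a \<Rightarrow> real) \<Rightarrow> (nat \<Rightarrow> 'a) \<Rightarrow> real" where
  "En n I h \<omega> = (\<Sum>i\<in>I. h (\<omega> i)) / real n"

text \<open>eta-hat_{0,k}: nuisance estimate trained on the complement of fold k.\<close>
definition eta_hat_k :: "(nat \<Rightarrow> nat set \<Rightarrow> (nat \<Rightarrow> 'x obs) \<Rightarrow> 'x nuis) \<Rightarrow> nat \<Rightarrow> nat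
     \<Rightarrow> (nat \<Rightarrow> 'x obs) \<Rightarrow> (nat \<Rightarrow> nat) \<Rightarrow> nat \<Rightarrow> 'x nuis" where
  "eta_hat_k etahat K n \<omega> f k = etahat (K*n) (fold K n f k) \<omega>"

definition fold_score :: "score \<Rightarrow> (nat \<Rightarrow> nat set \<Rightarrow> (nat \<Rightarrow> 'x obs) \<Rightarrow> 'x nuis) \<Rightarrow> nat \<Rightarrow> nat
     \<Rightarrow> real \<Rightarrow> (nat \<Rightarrow> 'x obs) \<Rightarrow> (nat \<Rightarrow> nat) \<Rightarrow> nat \<Rightarrow> real" where
  "fold_score sc etahat K n \<theta> \<omega> f k =
     En n (fold K n f k) (psi sc \<theta> (eta_hat_k etahat K n \<omega> f k)) \<omega>"

definition is_DML1 :: "score \<Rightarrow> (nat \<Rightarrow> nat set \<Rightarrow> (nat \<Rightarrow> 'x obs) \<Rightarrow> 'x nuis) \<Rightarrow> (nat \<Rightarrow> real)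
     \<Rightarrow> nat \<Rightarrow> (nat \<Rightarrow> nat \<Rightarrow> (nat \<Rightarrow> 'x obs) \<times> (nat \<Rightarrow> nat) \<Rightarrow> real) \<Rightarrow> bool" where
  "is_DML1 sc etahat eps K thk \<longleftrightarrow>
     (\<forall>n \<omega> f k. f \<in> partitions K n \<and> k < K \<longrightarrow>
        \<bar>fold_score sc etahat K n (thk n k (\<omega>, f)) \<omega> f k\<bar>
          \<le> (INF \<theta>. \<bar>fold_score sc etahat K n \<theta> \<omega> f k\<bar>) + eps (K*n))"

definition dml1_est :: "nat \<Rightarrow> (nat \<Rightarrow> nat \<Rightarrow> 'a \<Rightarrow> real) \<Rightarrow> nat \<Rightarrow> 'a \<Rightarrow> real" where
  "dml1_est K thk n z = (\<Sum>k<K. thk n k z) / real K"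

definition is_DML2 :: "score \<Rightarrow> (nat \<Rightarrow> nat set \<Rightarrow> (nat \<Rightarrow> 'x obs) \<Rightarrow> 'x nuis) \<Rightarrow> (nat \<Rightarrow> real)
     \<Rightarrow> nat \<Rightarrow> (nat \<Rightarrow> (nat \<Rightarrow> 'x obs) \<times> (nat \<Rightarrow> nat) \<Rightarrow> real) \<Rightarrow> bool" where
  "is_DML2 sc etahat eps K th \<longleftrightarrow>
     (\<forall>n \<omega> f. f \<in> partitions K n \<longrightarrow>
        \<bar>(\<Sum>k<K. fold_score sc etahat K n (th n (\<omega>, f)) \<omega> f k) / real K\<bar>
          \<le> (INF \<theta>. \<bar>(\<Sum>k<K. fold_score sc etahat K n \<theta> \<omega> f k) / real K\<bar>) + eps (K*n))"

definition sigma2_hat :: "score \<Rightarrow> (nat \<Rightarrow> nat set \<Rightarrow> (nat \<Rightarrow> 'x obs) \<Rightarrow> 'x nuis) \<Rightarrow> nat \<Rightarrow> nat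
     \<Rightarrow> real \<Rightarrow> (nat \<Rightarrow> 'x obs) \<Rightarrow> (nat \<Rightarrow> nat) \<Rightarrow> real" where
  "sigma2_hat sc etahat K n \<theta> \<omega> f =
     (let J = (\<Sum>k<K. En n (fold K n f k) (psi_a sc (eta_hat_k etahat K n \<omega> f k)) \<omega>) / real K
      in inverse (J\<^sup>2) *
         ((\<Sum>k<K. En n (fold K n f k) (\<lambda>w. (psi sc \<theta> (eta_hat_k etahat K n \<omega> f k) w)\<^sup>2) \<omega>) / real K))"

definition sigma2 :: "'x obs measure \<Rightarrow> real \<Rightarrow> ('x \<Rightarrow> real) \<Rightarrow> ('x \<Rightarrow> real) \<Rightarrow> real" where
  "sigma2 P \<theta>0 g0 m0 =
     inverse (\<integral>w. Dv w * Verr m0 w \<partial>P) *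
     (\<integral>w. (Verr m0 w)\<^sup>2 * (Uerr \<theta>0 g0 w)\<^sup>2 \<partial>P) *
     inverse (\<integral>w. Dv w * Verr m0 w \<partial>P)"

definition N01 :: "real measure" where
  "N01 = density lborel std_normal_density"

definition Phi :: "real \<Rightarrow> real" where
  "Phi x = cdf N01 x"

definition Phi_inv :: "real \<Rightarrow> real" where
  "Phi_inv p = (THE z. Phi z = p)"

end

theory Submission
  imports Defs "HOL-Real_Asymp.Real_Asymp"
begin

text \<open>
  Both scores have the shape \<open>\<psi>(\<theta>\<^sub>0, \<eta>) = (U - h)(V - m)\<close> and \<open>\<psi>\<^sup>a(\<eta>) = -(D - s)(V - m)\<close>, where
  \<open>h\<close>, \<open>m\<close>, \<open>s\<close> are estimation errors depending on \<open>X\<close> only. Expanding the product,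
  \<open>(U - h)(V - m) - U V = - U m - V h + h m\<close>. Given the training data, the first two terms have mean
  zero because \<open>E[U | X] = E[V | X] = 0\<close> and, by the bounds on the conditional variances, second
  moments of order \<open>\<delta>\<^sup>2\<close>; the last term has absolute mean at most a multiple of \<open>\<delta> / \<surd>N\<close> by
  Cauchy--Schwarz and the product rate. Hence \<open>\<surd>N\<close> times the fold average of \<open>\<psi>(\<theta>\<^sub>0, \<eta>)\<close> is that of
  \<open>U V\<close> up to \<open>o_P(1)\<close>, and since the slope converges to \<open>-E[D V]\<close>, both estimators have the same
  linear expansion. A Lyapunov central limit theorem for triangular arrays, proved with
  characteristic functions, and a truncated law of large numbers for \<open>(U V)\<^sup>2\<close> (which has only
  \<open>q/4 > 1\<close> moments) finish the argument; uniformity over \<open>P\<close> follows by passing to sequences.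
\<close>

section \<open>Convergence in outer probability\<close>

text \<open>Three obstacles shape the proof. The nuisance estimates are random functions fitted
  outside the fold, and conditioning on them is replaced by Fubini: an integrand that does not
  change when the held-out coordinates are overwritten can be integrated over those coordinates
  first. The error bounds hold only on an event that is itself decided by the training data, so its
  indicator can be multiplied into such integrands. Uniformity over P requires every constant to
  depend on c, C and q alone, although neither \<theta>0 nor the q-th moment of g0(X) is bounded by
  assumption: the moment equation and |E[DV]| \<ge> c bound \<theta>0, conditional Jensen bounds the
  regressions of Y, D, Z on X, and g0(X) = l0(X) - \<theta>0 r0(X) almost surely carries the moments
  over to U. The same identity makes the ideal residuals of the two scores agree almost surely. The
  condition q > 4 is spent three times: UV has q/2 > 2 moments for the central limit theorem, (UV)
  squared has q/4 > 1 moments for the law of large numbers, and the second moment of h m vanishes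
  only by interpolating L2 rates with q-th moments.\<close>

definition likely :: "(nat \<Rightarrow> 'b measure) \<Rightarrow> real \<Rightarrow> (nat \<times> 'b \<Rightarrow> bool) \<Rightarrow> bool" where
  "likely M e Q \<longleftrightarrow> (\<exists>A. (\<forall>n. A n \<in> sets (M n)) \<and>
     (\<forall>\<^sub>F n in sequentially. measure (M n) (A n) \<le> e \<and> (\<forall>z\<in>space (M n) - A n. Q (n, z))))"

text \<open>Since the exceptional sets are measurable but \<^term>\<open>Q\<close> need not be, convergence along this
  filter is convergence in outer probability; an \<open>o_P(1)\<close> term is one that tends to \<open>0\<close>.\<close>

definition whp :: "(nat \<Rightarrow> 'b measure) \<Rightarrow> (nat \<times> 'b) filter" where
  "whp M = Abs_filter (\<lambda>Q. \<forall>e>0. likely M e Q)"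

lemma likely_mono: "likely M e P \<Longrightarrow> (\<And>x. P x \<Longrightarrow> Q x) \<Longrightarrow> likely M e Q"
  unfolding likely_def by (elim exE conjE, rule exI, erule conjI, erule eventually_mono) auto

locale prob_space_seq =
  fixes M :: "nat \<Rightarrow> 'b measure"
  assumes prob_space_M: "prob_space (M n)"
begin

lemma likelyE:
  assumes "likely M e Q"
  obtains A where "\<And>n. A n \<in> sets (M n)"
    "\<forall>\<^sub>F n in sequentially. measure (M n) (A n) \<le> e \<and> (\<forall>z\<in>space (M n) - A n. Q (n, z))"
  using assms unfolding likely_def by blast

lemma likely_conj:
  assumes "likely M e P" "likely M d Q"
  shows "likely M (e + d) (\<lambda>x. P x \<and> Q x)"
proof -
  from assms(1) obtain A where A: "\<And>n. A n \<in> sets (M n)"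
    "\<forall>\<^sub>F n in sequentially. measure (M n) (A n) \<le> e \<and> (\<forall>z\<in>space (M n) - A n. P (n, z))" by (rule likelyE) blast
  from assms(2) obtain B where B: "\<And>n. B n \<in> sets (M n)"
    "\<forall>\<^sub>F n in sequentially. measure (M n) (B n) \<le> d \<and> (\<forall>z\<in>space (M n) - B n. Q (n, z))" by (rule likelyE) blast
  have "\<forall>\<^sub>F n in sequentially. measure (M n) (A n \<union> B n) \<le> e + d \<and>
      (\<forall>z\<in>space (M n) - (A n \<union> B n). P (n, z) \<and> Q (n, z))"
    using A(2) B(2)
  proof eventually_elim
    case (elim n)
    interpret prob_space "M n" by (rule prob_space_M)
    have "measure (M n) (A n \<union> B n) \<le> measure (M n) (A n) + measure (M n) (B n)"
      using A(1) B(1) by (intro measure_subadditive) auto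
    with elim show ?case by auto
  qed
  then show ?thesis unfolding likely_def using A(1) B(1) by (intro exI[of _ "\<lambda>n. A n \<union> B n"]) auto
qed

lemma likely_True: "e \<ge> 0 \<Longrightarrow> \<forall>\<^sub>F n in sequentially. \<forall>z\<in>space (M n). Q (n, z) \<Longrightarrow> likely M e Q"
  unfolding likely_def by (intro exI[of _ "\<lambda>_. {}"]) (auto elim: eventually_mono)

lemma eventually_whp: "eventually Q (whp M) \<longleftrightarrow> (\<forall>e>0. likely M e Q)"
  unfolding whp_def
proof (rule eventually_Abs_filter, rule is_filter.intro)
  show "\<forall>e>0. likely M e (\<lambda>x. True)" by (auto intro: likely_True)
  show "\<forall>e>0. likely M e (\<lambda>x. P x \<and> Q x)" if "\<forall>e>0. likely M e P" "\<forall>e>0. likely M e Q" for P Q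
  proof (intro allI impI)
    fix e :: real assume "e > 0"
    then show "likely M e (\<lambda>x. P x \<and> Q x)" using likely_conj[of "e / 2" P "e / 2" Q] that by simp
  qed
  show "\<forall>e>0. likely M e Q" if "\<forall>x. P x \<longrightarrow> Q x" "\<forall>e>0. likely M e P" for P Q
    using that by (blast intro: likely_mono)
qed

lemma eventually_whp_space: "eventually (\<lambda>(n, z). z \<in> space (M n)) (whp M)"
  unfolding eventually_whp by (auto intro: likely_True)

lemma eventually_whp_fst: "eventually Q sequentially \<Longrightarrow> eventually (\<lambda>(n, z). Q n) (whp M)"
  unfolding eventually_whp by (auto intro!: likely_True elim: eventually_mono)

lemma tendsto_whp_fst:
  assumes "(a \<longlongrightarrow> l) sequentially"
  shows "((\<lambda>(n, z). a n) \<longlongrightarrow> l) (whp M)"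
proof (rule topological_tendstoI)
  fix S assume "open S" "l \<in> S"
  with assms have "eventually (\<lambda>n. a n \<in> S) sequentially" by (rule topological_tendstoD)
  from eventually_whp_fst[OF this] show "eventually (\<lambda>x. (case x of (n, z) \<Rightarrow> a n) \<in> S) (whp M)"
    by (simp add: case_prod_unfold)
qed

text \<open>The way back from the filter to genuine probabilities: a measurable failure event is
  dominated by the measurable cover supplied by \<open>likely\<close>.\<close>

lemma whp_imp_prob_tendsto_0:
  assumes ev: "eventually Q (whp M)"
    and meas: "\<And>n. {z\<in>space (M n). \<not> Q (n, z)} \<in> sets (M n)"
  shows "(\<lambda>n. measure (M n) {z\<in>space (M n). \<not> Q (n, z)}) \<longlonglongrightarrow> 0"
proof (rule tendstoI)
  fix e :: real assume "e > 0"
  hence e2: "e / 2 > 0" by simp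
  from ev[unfolded eventually_whp, rule_format, OF e2] obtain A where A: "\<And>n. A n \<in> sets (M n)"
      "\<forall>\<^sub>F n in sequentially. measure (M n) (A n) \<le> e / 2 \<and> (\<forall>z\<in>space (M n) - A n. Q (n, z))"
    by (rule likelyE) blast
  from A(2) show "\<forall>\<^sub>F n in sequentially. dist (measure (M n) {z\<in>space (M n). \<not> Q (n, z)}) 0 < e"
  proof eventually_elim
    case (elim n)
    interpret prob_space "M n" by (rule prob_space_M)
    have "measure (M n) {z\<in>space (M n). \<not> Q (n, z)} \<le> measure (M n) (A n)"
      by (rule finite_measure_mono) (use elim A(1) in auto)
    with elim \<open>e > 0\<close> show ?case by auto
  qed
qed

text \<open>\<open>O_P(1)\<close>, characterised by multiplying \<open>o_P(1)\<close> terms into \<open>o_P(1)\<close> terms; this makes its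
  calculus immediate.\<close>

definition Op :: "(nat \<times> 'b \<Rightarrow> real) \<Rightarrow> bool" where
  "Op X \<longleftrightarrow> (\<forall>Y. (Y \<longlongrightarrow> 0) (whp M) \<longrightarrow> ((\<lambda>x. X x * Y x) \<longlongrightarrow> 0) (whp M))"

lemma Op_mult_tendsto:
  "Op X \<Longrightarrow> (Y \<longlongrightarrow> 0) (whp M) \<Longrightarrow> ((\<lambda>x. X x * Y x) \<longlongrightarrow> 0) (whp M)"
  by (simp add: Op_def)

lemma Op_mult_tendsto':
  "Op X \<Longrightarrow> (Y \<longlongrightarrow> 0) (whp M) \<Longrightarrow> ((\<lambda>x. Y x * X x) \<longlongrightarrow> 0) (whp M)"
  using Op_mult_tendsto[of X Y] by (simp add: mult.commute)

lemma Op_add: "Op X \<Longrightarrow> Op Y \<Longrightarrow> Op (\<lambda>x. X x + Y x)"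
  unfolding Op_def by (auto simp: distrib_right intro!: tendsto_add_zero)

lemma Op_mult: "Op X \<Longrightarrow> Op Y \<Longrightarrow> Op (\<lambda>x. X x * Y x)"
  unfolding Op_def by (auto simp: mult.assoc)

lemma Op_tendsto: "(X \<longlongrightarrow> l) (whp M) \<Longrightarrow> Op X"
  unfolding Op_def by (auto intro!: tendsto_eq_intros)

lemma Op_const: "Op (\<lambda>_. a)"
  by (rule Op_tendsto) (rule tendsto_const)

lemma Op_sum: "(\<And>i. i \<in> S \<Longrightarrow> Op (X i)) \<Longrightarrow> Op (\<lambda>x. \<Sum>i\<in>S. X i x)"
  by (induction S rule: infinite_finite_induct) (auto intro: Op_add Op_const)

lemma tendsto_0_abs_bound:
  fixes X Y :: "nat \<times> 'b \<Rightarrow> real"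
  assumes "(Y \<longlongrightarrow> 0) (whp M)" "\<And>n z. z \<in> space (M n) \<Longrightarrow> \<bar>X (n, z)\<bar> \<le> \<bar>Y (n, z)\<bar>"
  shows "(X \<longlongrightarrow> 0) (whp M)"
proof (rule Lim_null_comparison)
  show "((\<lambda>x. \<bar>Y x\<bar>) \<longlongrightarrow> 0) (whp M)" using assms(1) by (rule tendsto_rabs_zero)
  show "eventually (\<lambda>x. norm (X x) \<le> \<bar>Y x\<bar>) (whp M)"
    using eventually_whp_space by eventually_elim (use assms(2) in auto)
qed

lemma Op_abs_bound:
  assumes "Op Y" "\<And>n z. z \<in> space (M n) \<Longrightarrow> \<bar>X (n, z)\<bar> \<le> \<bar>Y (n, z)\<bar>"
  shows "Op X"
  unfolding Op_def
proof (intro allI impI)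
  fix R :: "nat \<times> 'b \<Rightarrow> real" assume "(R \<longlongrightarrow> 0) (whp M)"
  with assms(1) have "((\<lambda>x. Y x * R x) \<longlongrightarrow> 0) (whp M)" by (rule Op_mult_tendsto)
  then show "((\<lambda>x. X x * R x) \<longlongrightarrow> 0) (whp M)"
    by (rule tendsto_0_abs_bound) (use assms(2) in \<open>auto simp: abs_mult intro!: mult_right_mono\<close>)
qed

lemma Op_bounded_seq:
  assumes "\<And>n. \<bar>a n\<bar> \<le> B"
  shows "Op (\<lambda>(n, z). a n)"
  by (rule Op_abs_bound[OF Op_const[of B]]) (use assms abs_ge_self[of B] in \<open>auto intro: order_trans\<close>)

lemma tendsto_0_square:
  fixes X :: "nat \<times> 'b \<Rightarrow> real"
  assumes "((\<lambda>x. (X x)\<^sup>2) \<longlongrightarrow> 0) (whp M)"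
  shows "(X \<longlongrightarrow> 0) (whp M)"
proof -
  from assms have "((\<lambda>x. sqrt ((X x)\<^sup>2)) \<longlongrightarrow> sqrt 0) (whp M)" by (rule tendsto_real_sqrt)
  then show ?thesis by (simp add: tendsto_rabs_zero_iff)
qed

lemma tendsto_0_whp_prob:
  fixes X :: "nat \<times> 'b \<Rightarrow> real"
  assumes "(X \<longlongrightarrow> 0) (whp M)" and [measurable]: "\<And>n. (\<lambda>z. X (n, z)) \<in> borel_measurable (M n)" and "e > 0"
  shows "(\<lambda>n. measure (M n) {z\<in>space (M n). \<bar>X (n, z)\<bar> > e}) \<longlonglongrightarrow> 0"
proof -
  have "eventually (\<lambda>x. \<bar>X x\<bar> \<le> e) (whp M)"
    using tendstoD[OF assms(1) \<open>e > 0\<close>] by (auto elim: eventually_mono)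
  from whp_imp_prob_tendsto_0[OF this] show ?thesis by (simp add: not_le)
qed

text \<open>Tightness in the usual tail form implies the multiplier form of \<open>Op\<close>. This
  is how Markov bounds enter the calculus; the budget e is split between the tail of X and the
  smallness of Y.\<close>

lemma Op_tail:
  assumes "\<And>e. e > 0 \<Longrightarrow> \<exists>B. likely M e (\<lambda>x. \<bar>X x\<bar> \<le> B)"
  shows "Op X"
  unfolding Op_def
proof (intro allI impI tendstoI)
  fix Y :: "nat \<times> 'b \<Rightarrow> real" and r :: real assume Y: "(Y \<longlongrightarrow> 0) (whp M)" and r: "r > 0"
  show "\<forall>\<^sub>F x in whp M. dist (X x * Y x) 0 < r"
    unfolding eventually_whp
  proof (intro allI impI)
    fix e :: real assume "e > 0"
    hence e: "e / 2 > 0" by simp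
    from assms[OF e] obtain B where B: "likely M (e / 2) (\<lambda>x. \<bar>X x\<bar> \<le> B)" by auto
    \<comment> \<open>The added 1 keeps b positive when B = 0 and makes the final inequality
      strict.\<close>
    define b where "b = r / (\<bar>B\<bar> + 1)"
    have b: "b > 0" using r by (simp add: b_def)
    have "likely M (e / 2) (\<lambda>x. dist (Y x) 0 < b)"
      using tendstoD[OF Y b] e unfolding eventually_whp by blast
    from likely_conj[OF B this] have "likely M e (\<lambda>x. \<bar>X x\<bar> \<le> B \<and> dist (Y x) 0 < b)" by simp
    then show "likely M e (\<lambda>x. dist (X x * Y x) 0 < r)"
    proof (rule likely_mono)
      fix x assume 1: "\<bar>X x\<bar> \<le> B \<and> dist (Y x) 0 < b"
      then have "\<bar>X x\<bar> * \<bar>Y x\<bar> \<le> \<bar>B\<bar> * b" by (intro mult_mono) auto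
      also have "\<dots> < (\<bar>B\<bar> + 1) * b" using b by (simp add: algebra_simps)
      also have "\<dots> = r" by (simp add: b_def)
      finally show "dist (X x * Y x) 0 < r" by (simp add: abs_mult)
    qed
  qed
qed

text \<open>Slutsky's lemma at the level of characteristic functions: the exponentials differ by at
  most |t| times the distance of the two variables, and by at most 2 where that distance is not
  small.\<close>

lemma char_diff_tendsto_0:
  fixes X Y :: "nat \<Rightarrow> 'b \<Rightarrow> real"
  assumes lim: "((\<lambda>(n, z). X n z - Y n z) \<longlongrightarrow> 0) (whp M)"
    and [measurable]: "\<And>n. X n \<in> borel_measurable (M n)" "\<And>n. Y n \<in> borel_measurable (M n)"
  shows "(\<lambda>n. char (distr (M n) borel (X n)) t - char (distr (M n) borel (Y n)) t) \<longlonglongrightarrow> 0"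
proof (rule tendstoI)
  fix e :: real assume e: "e > 0"
  \<comment> \<open>Then |t| d is at most e/4, also for t = 0, and the exceptional set contributes
    at most 2 (e/4); the total stays below e.\<close>
  define d where "d = e / (4 * (\<bar>t\<bar> + 1))"
  have d: "d > 0" using e by (simp add: d_def)
  have "\<bar>t\<bar> * d \<le> (\<bar>t\<bar> + 1) * d" using d by (simp add: algebra_simps)
  also have "\<dots> = e / 4" using e by (simp add: d_def divide_simps)
  finally have td: "\<bar>t\<bar> * d \<le> e / 4" .
  define R where "R n = {z\<in>space (M n). \<bar>X n z - Y n z\<bar> > d}" for n
  have R[measurable]: "R n \<in> sets (M n)" for n unfolding R_def by measurable
  have "(\<lambda>n. measure (M n) (R n)) \<longlonglongrightarrow> 0"
    using tendsto_0_whp_prob[OF lim _ d] by (simp add: R_def)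
  hence "\<forall>\<^sub>F n in sequentially. measure (M n) (R n) < e / 4"
    by (rule order_tendstoD(2)) (use e in simp)
  then show "\<forall>\<^sub>F n in sequentially. dist (char (distr (M n) borel (X n)) t - char (distr (M n) borel (Y n)) t) 0 < e"
  proof eventually_elim
    case (elim n)
    interpret prob_space "M n" by (rule prob_space_M)
    have int: "integrable (M n) (\<lambda>z. iexp (t * X n z))" "integrable (M n) (\<lambda>z. iexp (t * Y n z))"
      by (auto intro!: integrable_const_bound[where B=1])
    have pt: "norm (iexp (t * X n z) - iexp (t * Y n z)) \<le> \<bar>t\<bar> * d + 2 * indicator (R n) z"
      if z: "z \<in> space (M n)" for z
    proof (cases "z \<in> R n")
      case True
      have "norm (iexp (t * X n z) - iexp (t * Y n z)) \<le> 1 + 1"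
        by (rule order_trans[OF norm_triangle_ineq4]) simp
      moreover have "0 \<le> \<bar>t\<bar> * d" using d by simp
      ultimately show ?thesis using True by simp
    next
      case False
      have eq: "iexp (t * X n z) - iexp (t * Y n z) = iexp (t * Y n z) * (iexp (t * (X n z - Y n z)) - 1)"
        by (simp add: algebra_simps exp_add[symmetric])
      have "norm (iexp (t * X n z) - iexp (t * Y n z)) = norm (iexp (t * (X n z - Y n z)) - 1)"
        unfolding eq by (simp add: norm_mult)
      also have "\<dots> \<le> \<bar>t * (X n z - Y n z)\<bar>"
        using iexp_approx1[of "t * (X n z - Y n z)" 0] by simp
      also have "\<dots> \<le> \<bar>t\<bar> * d" using False z by (auto simp: abs_mult R_def intro!: mult_left_mono)
      finally show ?thesis using False by simp
    qed
    have "norm (char (distr (M n) borel (X n)) t - char (distr (M n) borel (Y n)) t)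
      = norm (\<integral>z. iexp (t * X n z) - iexp (t * Y n z) \<partial>M n)"
      using int by (simp add: char_def integral_distr)
    also have "\<dots> \<le> (\<integral>z. norm (iexp (t * X n z) - iexp (t * Y n z)) \<partial>M n)"
      by (rule integral_norm_bound)
    also have "\<dots> \<le> (\<integral>z. \<bar>t\<bar> * d + 2 * indicator (R n) z \<partial>M n)"
      using int pt by (intro integral_mono) (auto simp: integrable_indicator_iff emeasure_eq_measure)
    also have "\<dots> = \<bar>t\<bar> * d + 2 * measure (M n) (R n)"
      by (subst Bochner_Integration.integral_add)
         (auto simp: integrable_indicator_iff emeasure_eq_measure prob_space)
    also have "\<dots> < e" using td elim e by auto
    finally show ?case by simp
  qed
qed

end

section \<open>Cross-fitted sums on the sample space\<close>

lemma abs_mult_le_squares: "\<bar>x * y\<bar> \<le> x\<^sup>2 + y\<^sup>2" for x y :: real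
proof -
  have "0 \<le> \<bar>x\<bar> * \<bar>y\<bar>" "2 * (\<bar>x\<bar> * \<bar>y\<bar>) \<le> x\<^sup>2 + y\<^sup>2"
    using sum_squares_bound[of "\<bar>x\<bar>" "\<bar>y\<bar>"] by (simp_all add: mult.assoc)
  then show ?thesis unfolding abs_mult by linarith
qed

lemma abs_le_1_plus_square: "\<bar>x\<bar> \<le> 1 + x\<^sup>2" for x :: real
  using abs_mult_le_squares[of 1 x] by simp

text \<open>The substitute for conditioning on the training data: when F does not read coordinate i,
  the value plugged in at that coordinate is an independent fresh draw, so it may be integrated out
  with F held fixed.\<close>

lemma nn_integral_PiM_coordinate:
  assumes P: "prob_space P" and J: "finite J" "i \<in> J"
    and F[measurable]: "(\<lambda>(\<omega>, w). F \<omega> w) \<in> borel_measurable (PiM J (\<lambda>_. P) \<Otimes>\<^sub>M P)"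
    and loc: "\<And>\<omega> x w. \<omega> \<in> space (PiM J (\<lambda>_. P)) \<Longrightarrow> x \<in> space P \<Longrightarrow> w \<in> space P \<Longrightarrow> F (fun_upd \<omega> i x) w = F \<omega> w"
  shows "(\<integral>\<^sup>+\<omega>. F \<omega> (\<omega> i) \<partial>PiM J (\<lambda>_. P)) = (\<integral>\<^sup>+\<omega>. (\<integral>\<^sup>+w. F \<omega> w \<partial>P) \<partial>PiM J (\<lambda>_. P))"
proof -
  interpret prob_space P by fact
  interpret product_sigma_finite "\<lambda>_. P" by unfold_locales
  define L where "L = J - {i}"
  have L: "finite L" "i \<notin> L" "J = insert i L" using J by (auto simp: L_def)
  have i: "i \<in> insert i L" by simp
  have meas1: "(\<lambda>\<omega>. F \<omega> (\<omega> i)) \<in> borel_measurable (PiM (insert i L) (\<lambda>_. P))"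
    using measurable_compose[OF measurable_Pair[OF measurable_ident measurable_component_singleton[OF i]] F[unfolded L(3)]]
    by (simp add: id_def)
  have meas2: "(\<lambda>\<omega>. \<integral>\<^sup>+w. F \<omega> w \<partial>P) \<in> borel_measurable (PiM (insert i L) (\<lambda>_. P))"
    using F[unfolded L(3)] by measurable
  have sp: "fun_upd \<omega> i x \<in> space (PiM J (\<lambda>_. P))" if "\<omega> \<in> space (PiM L (\<lambda>_. P))" "x \<in> space P" for \<omega> x
    using that by (auto simp: space_PiM L(3) PiE_def extensional_def)
  \<comment> \<open>An arbitrary value pins the coordinate that F ignores, so that F becomes a
    function on the smaller product.\<close>
  obtain x0 where x0: "x0 \<in> space P" using not_empty by auto
  have eq: "F (fun_upd \<omega> i x) w = F (fun_upd \<omega> i x0) w" if "\<omega> \<in> space (PiM L (\<lambda>_. P))" "x \<in> space P" "w \<in> space P" for \<omega> x w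
    using loc[OF sp[OF that(1) x0] that(2,3)] by simp
  have "(\<integral>\<^sup>+\<omega>. F \<omega> (\<omega> i) \<partial>PiM J (\<lambda>_. P)) = (\<integral>\<^sup>+\<omega>. \<integral>\<^sup>+x. F (fun_upd \<omega> i x) x \<partial>P \<partial>PiM L (\<lambda>_. P))"
    unfolding L(3) by (subst product_nn_integral_insert[OF L(1,2) meas1]) simp
  also have "\<dots> = (\<integral>\<^sup>+\<omega>. \<integral>\<^sup>+x. F (fun_upd \<omega> i x0) x \<partial>P \<partial>PiM L (\<lambda>_. P))"
    by (intro nn_integral_cong eq) auto
  also have "\<dots> = (\<integral>\<^sup>+\<omega>. \<integral>\<^sup>+x. \<integral>\<^sup>+w. F (fun_upd \<omega> i x0) w \<partial>P \<partial>P \<partial>PiM L (\<lambda>_. P))"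
    by (simp add: emeasure_space_1)
  also have "\<dots> = (\<integral>\<^sup>+\<omega>. \<integral>\<^sup>+x. \<integral>\<^sup>+w. F (fun_upd \<omega> i x) w \<partial>P \<partial>P \<partial>PiM L (\<lambda>_. P))"
    by (intro nn_integral_cong eq[symmetric]) auto
  also have "\<dots> = (\<integral>\<^sup>+\<omega>. (\<integral>\<^sup>+w. F \<omega> w \<partial>P) \<partial>PiM J (\<lambda>_. P))"
    unfolding L(3) by (subst product_nn_integral_insert[OF L(1,2) meas2]) simp
  finally show ?thesis .
qed

text \<open>Integrating over coordinate i first leaves only the factor evaluated there to vary, and
  its mean given everything else is zero.\<close>

lemma integral_PiM_cross_term_eq_0:
  fixes F :: "('i \<Rightarrow> 'a) \<Rightarrow> 'a \<Rightarrow> real"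
  assumes P: "prob_space P" and J: "finite J" "i \<in> J" "j \<in> J" "i \<noteq> j"
    and F[measurable]: "(\<lambda>(\<omega>, w). F \<omega> w) \<in> borel_measurable (PiM J (\<lambda>_. P) \<Otimes>\<^sub>M P)"
    and loc: "\<And>\<omega> x w. \<omega> \<in> space (PiM J (\<lambda>_. P)) \<Longrightarrow> x \<in> space P \<Longrightarrow> w \<in> space P \<Longrightarrow> F (fun_upd \<omega> i x) w = F \<omega> w"
    and zero: "\<And>\<omega>. \<omega> \<in> space (PiM J (\<lambda>_. P)) \<Longrightarrow> (\<integral>w. F \<omega> w \<partial>P) = 0"
    and int: "integrable (PiM J (\<lambda>_. P)) (\<lambda>\<omega>. F \<omega> (\<omega> i) * F \<omega> (\<omega> j))"
  shows "(\<integral>\<omega>. F \<omega> (\<omega> i) * F \<omega> (\<omega> j) \<partial>PiM J (\<lambda>_. P)) = 0"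
proof -
  interpret prob_space P by fact
  interpret product_sigma_finite "\<lambda>_. P" by unfold_locales
  define L where "L = J - {i}"
  have L: "finite L" "i \<notin> L" "J = insert i L" "j \<in> L" using J by (auto simp: L_def)
  have sp: "fun_upd \<omega> i x \<in> space (PiM J (\<lambda>_. P))" if "\<omega> \<in> space (PiM L (\<lambda>_. P))" "x \<in> space P" for \<omega> x
    using that by (auto simp: space_PiM L(3) PiE_def extensional_def)
  obtain x0 where x0: "x0 \<in> space P" using not_empty by auto
  have eq: "F (fun_upd \<omega> i x) w = F (fun_upd \<omega> i x0) w" if "\<omega> \<in> space (PiM L (\<lambda>_. P))" "x \<in> space P" "w \<in> space P" for \<omega> x w
    using loc[OF sp[OF that(1) x0] that(2,3)] by simp
  have "(\<integral>\<omega>. F \<omega> (\<omega> i) * F \<omega> (\<omega> j) \<partial>PiM J (\<lambda>_. P)) =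
    (\<integral>\<omega>. (\<integral>x. F (fun_upd \<omega> i x) x * F (fun_upd \<omega> i x) (\<omega> j) \<partial>P) \<partial>PiM L (\<lambda>_. P))"
    unfolding L(3) using \<open>i \<noteq> j\<close> by (subst product_integral_insert[OF L(1,2) int[unfolded L(3)]]) simp
  also have "\<dots> = (\<integral>\<omega>. (\<integral>x. F (fun_upd \<omega> i x0) x * F (fun_upd \<omega> i x0) (\<omega> j) \<partial>P) \<partial>PiM L (\<lambda>_. P))"
  proof (intro Bochner_Integration.integral_cong refl)
    fix \<omega> x assume 1: "\<omega> \<in> space (PiM L (\<lambda>_. P))" "x \<in> space P"
    then have "\<omega> j \<in> space P" using L by (auto simp: space_PiM)
    with 1 show "F (fun_upd \<omega> i x) x * F (fun_upd \<omega> i x) (\<omega> j) = F (fun_upd \<omega> i x0) x * F (fun_upd \<omega> i x0) (\<omega> j)"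
      using eq by simp
  qed
  also have "\<dots> = (\<integral>\<omega>. 0 \<partial>PiM L (\<lambda>_. P))"
    using zero[OF sp[OF _ x0]] by (intro Bochner_Integration.integral_cong refl) simp
  finally show ?thesis by simp
qed

text \<open>Conditionally centred summands are orthogonal, so the second moment grows linearly in
  the fold size instead of quadratically. This is what survives multiplication by the root of the
  sample size.\<close>

lemma nn_integral_PiM_sum_orthogonal:
  fixes F :: "('i \<Rightarrow> 'a) \<Rightarrow> 'a \<Rightarrow> real"
  assumes P: "prob_space P" and J: "finite J" "I \<subseteq> J" and b: "b \<ge> 0"
    and F[measurable]: "(\<lambda>(\<omega>, w). F \<omega> w) \<in> borel_measurable (PiM J (\<lambda>_. P) \<Otimes>\<^sub>M P)"
    and loc: "\<And>\<omega> i x w. \<omega> \<in> space (PiM J (\<lambda>_. P)) \<Longrightarrow> i \<in> I \<Longrightarrow> x \<in> space P \<Longrightarrow> w \<in> space P \<Longrightarrow> F (fun_upd \<omega> i x) w = F \<omega> w"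
    and zero: "\<And>\<omega>. \<omega> \<in> space (PiM J (\<lambda>_. P)) \<Longrightarrow> (\<integral>w. F \<omega> w \<partial>P) = 0"
    and bound: "\<And>\<omega>. \<omega> \<in> space (PiM J (\<lambda>_. P)) \<Longrightarrow> (\<integral>\<^sup>+w. ennreal ((F \<omega> w)\<^sup>2) \<partial>P) \<le> ennreal b"
  shows "(\<integral>\<^sup>+\<omega>. ennreal ((\<Sum>i\<in>I. F \<omega> (\<omega> i))\<^sup>2) \<partial>PiM J (\<lambda>_. P)) \<le> ennreal (real (card I) * b)"
proof -
  interpret prob_space P by fact
  let ?Q = "PiM J (\<lambda>_. P)"
  interpret Q: prob_space ?Q by (rule prob_space_PiM) (rule P)
  have finI: "finite I" using J finite_subset by auto
  have meas[measurable]: "(\<lambda>\<omega>. F \<omega> (\<omega> i)) \<in> borel_measurable ?Q" if "i \<in> J" for i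
    using measurable_compose[OF measurable_Pair[OF measurable_ident measurable_component_singleton[OF that]] F]
    by (simp add: id_def)
  have sq: "(\<integral>\<^sup>+\<omega>. ennreal ((F \<omega> (\<omega> i))\<^sup>2) \<partial>?Q) \<le> ennreal b" if i: "i \<in> I" for i
  proof -
    have "(\<integral>\<^sup>+\<omega>. ennreal ((F \<omega> (\<omega> i))\<^sup>2) \<partial>?Q) = (\<integral>\<^sup>+\<omega>. \<integral>\<^sup>+w. ennreal ((F \<omega> w)\<^sup>2) \<partial>P \<partial>?Q)"
      by (rule nn_integral_PiM_coordinate) (use P J i loc in auto)
    also have "\<dots> \<le> (\<integral>\<^sup>+\<omega>. ennreal b \<partial>?Q)"
      by (intro nn_integral_mono bound)
    also have "\<dots> = ennreal b" by (simp add: Q.emeasure_space_1)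
    finally show ?thesis .
  qed
  have int2: "integrable ?Q (\<lambda>\<omega>. (F \<omega> (\<omega> i))\<^sup>2)" if i: "i \<in> I" for i
  proof (rule integrableI_nonneg)
    show "(\<lambda>\<omega>. (F \<omega> (\<omega> i))\<^sup>2) \<in> borel_measurable ?Q" using meas[of i] i J by auto
    show "(\<integral>\<^sup>+\<omega>. ennreal ((F \<omega> (\<omega> i))\<^sup>2) \<partial>?Q) < \<infinity>"
      using sq[OF i] by (auto intro: le_less_trans)
  qed auto
  have intm: "integrable ?Q (\<lambda>\<omega>. F \<omega> (\<omega> i) * F \<omega> (\<omega> j))" if i: "i \<in> I" and j: "j \<in> I" for i j
  proof (rule Bochner_Integration.integrable_bound)
    show "integrable ?Q (\<lambda>\<omega>. (F \<omega> (\<omega> i))\<^sup>2 + (F \<omega> (\<omega> j))\<^sup>2)" using int2 i j by auto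
    show "(\<lambda>\<omega>. F \<omega> (\<omega> i) * F \<omega> (\<omega> j)) \<in> borel_measurable ?Q" using borel_measurable_times[OF meas[of i] meas[of j]] i j J by blast
    show "AE \<omega> in ?Q. norm (F \<omega> (\<omega> i) * F \<omega> (\<omega> j)) \<le> norm ((F \<omega> (\<omega> i))\<^sup>2 + (F \<omega> (\<omega> j))\<^sup>2)"
      by (simp add: abs_mult_le_squares)
  qed
  have eq: "(\<Sum>i\<in>I. F \<omega> (\<omega> i))\<^sup>2 = (\<Sum>i\<in>I. \<Sum>j\<in>I. F \<omega> (\<omega> i) * F \<omega> (\<omega> j))" for \<omega>
    by (simp add: power2_eq_square sum_product)
  have intS: "integrable ?Q (\<lambda>\<omega>. (\<Sum>i\<in>I. F \<omega> (\<omega> i))\<^sup>2)"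
    unfolding eq using intm by auto
  have "(\<integral>\<omega>. (\<Sum>i\<in>I. F \<omega> (\<omega> i))\<^sup>2 \<partial>?Q) = (\<Sum>i\<in>I. \<Sum>j\<in>I. (\<integral>\<omega>. F \<omega> (\<omega> i) * F \<omega> (\<omega> j) \<partial>?Q))"
    unfolding eq using intm by (simp add: Bochner_Integration.integral_sum Bochner_Integration.integrable_sum)
  also have "\<dots> = (\<Sum>i\<in>I. \<Sum>j\<in>I. if j = i then (\<integral>\<omega>. (F \<omega> (\<omega> i))\<^sup>2 \<partial>?Q) else 0)"
  proof (intro sum.cong refl)
    fix i j assume ij: "i \<in> I" "j \<in> I"
    show "(\<integral>\<omega>. F \<omega> (\<omega> i) * F \<omega> (\<omega> j) \<partial>?Q) = (if j = i then (\<integral>\<omega>. (F \<omega> (\<omega> i))\<^sup>2 \<partial>?Q) else 0)"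
    proof (cases "i = j")
      case False
      have "(\<integral>\<omega>. F \<omega> (\<omega> i) * F \<omega> (\<omega> j) \<partial>?Q) = 0"
      proof (rule integral_PiM_cross_term_eq_0[OF P J(1) _ _ False F])
        show "i \<in> J" "j \<in> J" using ij J by auto
        show "F (fun_upd \<omega> i x) w = F \<omega> w"
          if "\<omega> \<in> space ?Q" "x \<in> space P" "w \<in> space P" for \<omega> x w
          by (rule loc[OF that(1) ij(1) that(2,3)])
      qed (auto intro: zero intm ij)
      with False show ?thesis by auto
    qed (simp add: power2_eq_square)
  qed
  also have "\<dots> = (\<Sum>i\<in>I. (\<integral>\<omega>. (F \<omega> (\<omega> i))\<^sup>2 \<partial>?Q))" using finI by simp
  also have "\<dots> \<le> (\<Sum>i\<in>I. b)"
  proof (rule sum_mono)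
    fix i assume i: "i \<in> I"
    have "ennreal (\<integral>\<omega>. (F \<omega> (\<omega> i))\<^sup>2 \<partial>?Q) \<le> ennreal b"
      using sq[OF i] nn_integral_eq_integral[OF int2[OF i]] by simp
    then show "(\<integral>\<omega>. (F \<omega> (\<omega> i))\<^sup>2 \<partial>?Q) \<le> b" using b by simp
  qed
  finally have "(\<integral>\<omega>. (\<Sum>i\<in>I. F \<omega> (\<omega> i))\<^sup>2 \<partial>?Q) \<le> real (card I) * b" by simp
  with nn_integral_eq_integral[OF intS] show ?thesis by (simp add: ennreal_leI)
qed

section \<open>Random partitions and the joint space of sample and partition\<close>

lemma finite_partitions: "finite (partitions K n)"
  unfolding partitions_def by (auto intro: finite_subset[OF _ finite_PiE[of "{..<K*n}" "\<lambda>_. {..<K}"]])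

text \<open>Without a partition the uniform distribution would have no mass. The witness cuts the
  sample into consecutive blocks; for n = 0 the index set is empty and every fold has size 0 as
  required.\<close>

lemma partitions_nonempty: "partitions K n \<noteq> {}"
proof -
  define f where "f = (\<lambda>i\<in>{..<K*n}. i div n)"
  have "f \<in> partitions K n"
    unfolding partitions_def
  proof (intro CollectI conjI allI impI)
    show "f \<in> {..<K*n} \<rightarrow>\<^sub>E {..<K}"
      by (auto simp: f_def less_mult_imp_div_less intro!: PiE_I)
    fix k assume k: "k < K"
    have "{i \<in> {..<K*n}. f i = k} = {k*n..<k*n+n}"
    proof (cases "n = 0")
      case False
      have "k * n + n \<le> K * n" using mult_le_mono1[of "Suc k" K n] k by simp
      moreover have "i div n = k" if "k * n \<le> i" "i < k * n + n" for i
        by (rule div_nat_eqI) (use that in \<open>simp_all add: mult.commute\<close>)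
      moreover have "(i div n) * n \<le> i" "i < (i div n) * n + n" for i
        using False dividend_less_div_times[of n i] div_times_less_eq_dividend[of i n] by simp_all
      ultimately have div: "i div n = k \<and> i < K * n \<longleftrightarrow> k * n \<le> i \<and> i < k * n + n" for i
        by (metis order_less_le_trans)
      have "{i \<in> {..<K*n}. f i = k} = {i. i div n = k \<and> i < K * n}"
        by (auto simp: f_def)
      also have "\<dots> = {k*n..<k*n+n}" unfolding div by auto
      finally show ?thesis .
    qed auto
    then show "card {i \<in> {..<K*n}. f i = k} = n" by simp
  qed
  then show ?thesis by auto
qed

lemma prob_space_partitions: "prob_space (uniform_count_measure (partitions K n))"
  by (rule prob_space_uniform_count_measure) (rule finite_partitions partitions_nonempty)+

lemma prob_space_dml_space: "prob_space P \<Longrightarrow> prob_space (dml_space P K n)"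
  unfolding dml_space_def
  by (intro prob_space_pair prob_space_PiM prob_space_partitions)

lemma space_dml_space: "space (dml_space P K n) = space (PiM {..<K*n} (\<lambda>_. P)) \<times> partitions K n"
  by (simp add: dml_space_def space_pair_measure space_uniform_count_measure)

text \<open>A bound that holds for every fixed partition holds for the random one: the event is a
  finite union of rectangles over the partitions, and its probability is an average of section
  probabilities.\<close>

lemma dml_space_sections:
  assumes P: "prob_space P"
    and A: "\<And>f. f \<in> partitions K n \<Longrightarrow> A f \<in> sets (PiM {..<K*n} (\<lambda>_. P))"
    and b: "\<And>f. f \<in> partitions K n \<Longrightarrow> measure (PiM {..<K*n} (\<lambda>_. P)) (A f) \<le> b" "b \<ge> 0"
  shows "{z \<in> space (dml_space P K n). fst z \<in> A (snd z)} \<in> sets (dml_space P K n)"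
    and "measure (dml_space P K n) {z \<in> space (dml_space P K n). fst z \<in> A (snd z)} \<le> b"
proof -
  let ?Q = "PiM {..<K*n} (\<lambda>_. P)" and ?R = "uniform_count_measure (partitions K n)"
  interpret Q: prob_space ?Q by (rule prob_space_PiM) (rule P)
  interpret R: prob_space ?R by (rule prob_space_partitions)
  interpret QR: pair_prob_space ?Q ?R ..
  let ?B = "{z \<in> space (dml_space P K n). fst z \<in> A (snd z)}"
  have eq: "?B = (\<Union>f\<in>partitions K n. A f \<times> {f})"
    using A[THEN sets.sets_into_space] by (auto simp: space_dml_space)
  show 1: "?B \<in> sets (dml_space P K n)"
    by (subst eq, unfold dml_space_def, intro sets.finite_UN finite_partitions)
       (use A in \<open>auto simp: sets_uniform_count_measure\<close>)
  have "emeasure (dml_space P K n) ?B = (\<integral>\<^sup>+f. emeasure ?Q ((\<lambda>\<omega>. (\<omega>, f)) -` ?B) \<partial>?R)"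
    using 1 unfolding dml_space_def by (rule QR.emeasure_pair_measure_alt2)
  also have "\<dots> \<le> (\<integral>\<^sup>+f. ennreal b \<partial>?R)"
  proof (rule nn_integral_mono)
    fix f assume "f \<in> space ?R"
    then have f: "f \<in> partitions K n" by (simp add: space_uniform_count_measure)
    have "(\<lambda>\<omega>. (\<omega>, f)) -` ?B = A f" using f A[OF f, THEN sets.sets_into_space] by (auto simp: space_dml_space)
    then show "emeasure ?Q ((\<lambda>\<omega>. (\<omega>, f)) -` ?B) \<le> ennreal b"
      using b(1)[OF f] by (simp add: Q.emeasure_eq_measure ennreal_leI)
  qed
  also have "\<dots> = ennreal b" by (simp add: R.emeasure_space_1)
  finally show "measure (dml_space P K n) ?B \<le> b"
    using b(2) by (simp add: measure_def enn2real_leI)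
qed

lemma borel_measurable_dml_space:
  assumes "\<And>f. f \<in> partitions K n \<Longrightarrow> (\<lambda>\<omega>. X (\<omega>, f)) \<in> borel_measurable (PiM {..<K*n} (\<lambda>_. P))"
  shows "X \<in> borel_measurable (dml_space P K n)"
  unfolding dml_space_def
proof -
  have "(\<lambda>z. X (fst z, snd z)) \<in> borel_measurable (PiM {..<K*n} (\<lambda>_. P) \<Otimes>\<^sub>M uniform_count_measure (partitions K n))"
  proof (rule measurable_compose_countable'[where f="\<lambda>f z. X (fst z, f)" and g=snd and I="partitions K n"])
    show "snd \<in> measurable (PiM {..<K*n} (\<lambda>_. P) \<Otimes>\<^sub>M uniform_count_measure (partitions K n)) (count_space (partitions K n))"
      by (subst measurable_cong_sets[OF refl sets_uniform_count_measure_count_space[symmetric]]) simp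
  qed (use assms in \<open>auto intro!: countable_finite finite_partitions intro: measurable_compose[OF measurable_fst]\<close>)
  then show "X \<in> borel_measurable (PiM {..<K*n} (\<lambda>_. P) \<Otimes>\<^sub>M uniform_count_measure (partitions K n))" by simp
qed

section \<open>Markov bounds along a sequence of distributions\<close>

locale dml_seq =
  fixes P :: "nat \<Rightarrow> 'x obs measure" and K :: nat
  assumes prob_space_P: "prob_space (P n)"
begin

abbreviation "\<Omega> n \<equiv> PiM {..<K*n} (\<lambda>_. P n)"
abbreviation "\<D> n \<equiv> dml_space (P n) K n"

sublocale prob_space_seq \<D>
  by (rule prob_space_seq.intro) (rule prob_space_dml_space[OF prob_space_P])

abbreviation "W \<equiv> whp \<D>"

text \<open>The moment bound is available only on G, so Markov's inequality is applied there and the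
  complement of G is charged separately.\<close>

lemma markov_event:
  assumes r: "r > 0" and G[measurable]: "G \<in> sets (\<Omega> n)"
    and m: "measure (\<Omega> n) (space (\<Omega> n) - G) \<le> d"
    and X[measurable]: "X \<in> borel_measurable (\<Omega> n)"
    and b: "(\<integral>\<^sup>+\<omega>. ennreal \<bar>X \<omega>\<bar> * indicator G \<omega> \<partial>\<Omega> n) \<le> ennreal b" "b \<ge> 0"
  shows "{\<omega> \<in> space (\<Omega> n). \<omega> \<notin> G \<or> \<bar>X \<omega>\<bar> > r} \<in> sets (\<Omega> n)"
    "measure (\<Omega> n) {\<omega> \<in> space (\<Omega> n). \<omega> \<notin> G \<or> \<bar>X \<omega>\<bar> > r} \<le> d + b / r"
proof -
  interpret Q: prob_space "\<Omega> n" by (rule prob_space_PiM) (rule prob_space_P)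
  show "{\<omega> \<in> space (\<Omega> n). \<omega> \<notin> G \<or> \<bar>X \<omega>\<bar> > r} \<in> sets (\<Omega> n)" by measurable
  let ?E = "{\<omega> \<in> G. 1 \<le> ennreal (1 / r) * ennreal \<bar>X \<omega>\<bar>}"
  have Gs: "G \<subseteq> space (\<Omega> n)" using sets.sets_into_space[OF G] .
  have Eeq: "?E = {\<omega> \<in> space (\<Omega> n). \<omega> \<in> G \<and> 1 \<le> ennreal (1 / r) * ennreal \<bar>X \<omega>\<bar>}" using Gs by auto
  have E[measurable]: "?E \<in> sets (\<Omega> n)" unfolding Eeq by measurable
  have "emeasure (\<Omega> n) ?E \<le> ennreal (1 / r) * (\<integral>\<^sup>+\<omega>. ennreal \<bar>X \<omega>\<bar> * indicator G \<omega> \<partial>\<Omega> n)"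
    by (rule nn_integral_Markov_inequality) measurable
  also have "\<dots> \<le> ennreal (1 / r) * ennreal b" by (intro mult_left_mono b) auto
  also have "\<dots> = ennreal (b / r)" using r b by (simp add: ennreal_mult[symmetric])
  finally have 1: "measure (\<Omega> n) ?E \<le> b / r" using r b by (simp add: Q.emeasure_eq_measure)
  have sub: "{\<omega> \<in> space (\<Omega> n). \<omega> \<notin> G \<or> \<bar>X \<omega>\<bar> > r} \<subseteq> (space (\<Omega> n) - G) \<union> ?E"
  proof
    fix \<omega> assume w: "\<omega> \<in> {\<omega> \<in> space (\<Omega> n). \<omega> \<notin> G \<or> \<bar>X \<omega>\<bar> > r}"
    show "\<omega> \<in> (space (\<Omega> n) - G) \<union> ?E"
    proof (cases "\<omega> \<in> G")
      case True
      with w have "\<bar>X \<omega>\<bar> > r" by auto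
      then have "1 \<le> 1 / r * \<bar>X \<omega>\<bar>" using r by (simp add: field_simps)
      then have "ennreal 1 \<le> ennreal (1 / r * \<bar>X \<omega>\<bar>)" by (rule ennreal_leI)
      also have "\<dots> = ennreal (1 / r) * ennreal \<bar>X \<omega>\<bar>" using r by (intro ennreal_mult) auto
      finally show ?thesis using True by simp
    qed (use w in auto)
  qed
  have "measure (\<Omega> n) {\<omega> \<in> space (\<Omega> n). \<omega> \<notin> G \<or> \<bar>X \<omega>\<bar> > r} \<le> measure (\<Omega> n) ((space (\<Omega> n) - G) \<union> ?E)"
    by (rule Q.finite_measure_mono[OF sub]) measurable
  also have "\<dots> \<le> measure (\<Omega> n) (space (\<Omega> n) - G) + measure (\<Omega> n) ?E"
    by (rule measure_subadditive) (use G E in auto)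
  finally show "measure (\<Omega> n) {\<omega> \<in> space (\<Omega> n). \<omega> \<notin> G \<or> \<bar>X \<omega>\<bar> > r} \<le> d + b / r" using 1 m by simp
qed

lemma markov_whp_event:
  fixes X :: "nat \<times> ((nat \<Rightarrow> 'x obs) \<times> (nat \<Rightarrow> nat)) \<Rightarrow> real"
  assumes r: "r > 0" and G: "\<And>f. f \<in> partitions K n \<Longrightarrow> G f \<in> sets (\<Omega> n)"
    and m: "\<And>f. f \<in> partitions K n \<Longrightarrow> measure (\<Omega> n) (space (\<Omega> n) - G f) \<le> d" "d \<ge> 0"
    and X: "\<And>f. f \<in> partitions K n \<Longrightarrow> (\<lambda>\<omega>. X (n, (\<omega>, f))) \<in> borel_measurable (\<Omega> n)"
    and b: "\<And>f. f \<in> partitions K n \<Longrightarrow> (\<integral>\<^sup>+\<omega>. ennreal \<bar>X (n, (\<omega>, f))\<bar> * indicator (G f) \<omega> \<partial>\<Omega> n) \<le> ennreal b" "b \<ge> 0"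
  shows "\<exists>A\<in>sets (\<D> n). measure (\<D> n) A \<le> d + b / r \<and>
    (\<forall>z\<in>space (\<D> n) - A. \<bar>X (n, z)\<bar> \<le> r)"
proof -
  define A where "A f = {\<omega> \<in> space (\<Omega> n). \<omega> \<notin> G f \<or> \<bar>X (n, (\<omega>, f))\<bar> > r}" for f
  note * = markov_event[OF r G m(1) X b, folded A_def]
  have "d + b / r \<ge> 0" using m b r by simp
  note ** = dml_space_sections[OF prob_space_P, of K n A, OF *(1) *(2) this]
  show ?thesis
    by (intro bexI[OF _ **(1)] conjI **(2)) (auto simp: A_def space_dml_space not_less)
qed

text \<open>The summand \<open>1 / (n + 1)\<close> keeps the scale positive when \<^term>\<open>b n\<close> vanishes.\<close>

lemma markov_scaled:
  fixes X :: "nat \<times> ((nat \<Rightarrow> 'x obs) \<times> (nat \<Rightarrow> nat)) \<Rightarrow> real"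
  assumes G: "\<And>n f. f \<in> partitions K n \<Longrightarrow> G n f \<in> sets (\<Omega> n)"
    and m: "\<And>n f. f \<in> partitions K n \<Longrightarrow> measure (\<Omega> n) (space (\<Omega> n) - G n f) \<le> d n"
    and X: "\<And>n f. f \<in> partitions K n \<Longrightarrow> (\<lambda>\<omega>. X (n, (\<omega>, f))) \<in> borel_measurable (\<Omega> n)"
    and b: "\<And>n f. n > 0 \<Longrightarrow> f \<in> partitions K n \<Longrightarrow> (\<integral>\<^sup>+\<omega>. ennreal \<bar>X (n, (\<omega>, f))\<bar> * indicator (G n f) \<omega> \<partial>\<Omega> n) \<le> ennreal (b n)"
    and d0: "\<And>n. d n \<ge> 0" "d \<longlonglongrightarrow> 0" and b0: "\<And>n. b n \<ge> 0"
  shows "Op (\<lambda>x. X x / (b (fst x) + inverse (real (Suc (fst x)))))"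
proof (rule Op_tail)
  fix e :: real assume e: "e > 0"
  define c where "c n = b n + inverse (real (Suc n))" for n
  have c: "c n > 0" "b n \<le> c n" for n using b0[of n] by (simp_all add: c_def add_nonneg_pos)
  \<comment> \<open>The threshold 2/e times c n makes the Markov term at most e/2, leaving e/2 for d
    n, which is eventually small. The index n = 0 carries no moment bound and is dropped by passing
    to large n.\<close>
  have "\<exists>A. A \<in> sets (\<D> n) \<and> (n > 0 \<longrightarrow> measure (\<D> n) A \<le> d n + e / 2 \<and>
      (\<forall>z\<in>space (\<D> n) - A. \<bar>X (n, z) / c n\<bar> \<le> 2 / e))" for n
  proof (cases "n > 0")
    case True
    from c[of n] e have r: "2 / e * c n > 0" by simp
    obtain A where A: "A \<in> sets (\<D> n)" "measure (\<D> n) A \<le> d n + b n / (2 / e * c n)"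
      "\<forall>z\<in>space (\<D> n) - A. \<bar>X (n, z)\<bar> \<le> 2 / e * c n"
      using markov_whp_event[OF r G m d0(1) X b[OF True] b0] by blast
    have "b n / (2 / e * c n) \<le> e / 2" using c[of n] e by (simp add: field_simps)
    with A(2) have "measure (\<D> n) A \<le> d n + e / 2" by linarith
    moreover have "\<forall>z\<in>space (\<D> n) - A. \<bar>X (n, z) / c n\<bar> \<le> 2 / e"
    proof
      fix z assume "z \<in> space (\<D> n) - A"
      then have "\<bar>X (n, z)\<bar> \<le> 2 / e * c n" by (rule A(3)[rule_format])
      then show "\<bar>X (n, z) / c n\<bar> \<le> 2 / e" using c(1)[of n] by (simp only: abs_divide abs_of_pos pos_divide_le_eq)
    qed
    ultimately show ?thesis using A(1) by (intro exI[of _ A] conjI impI)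
  qed auto
  then obtain A where A: "\<And>n. A n \<in> sets (\<D> n)"
    "\<And>n. n > 0 \<Longrightarrow> measure (\<D> n) (A n) \<le> d n + e / 2 \<and>
      (\<forall>z\<in>space (\<D> n) - A n. \<bar>X (n, z) / c n\<bar> \<le> 2 / e)"
    by metis
  have "\<forall>\<^sub>F n in sequentially. d n < e / 2" using d0(2) by (rule order_tendstoD(2)) (use e in simp)
  then have "\<forall>\<^sub>F n in sequentially. measure (\<D> n) (A n) \<le> e \<and>
      (\<forall>z\<in>space (\<D> n) - A n. \<bar>X (n, z) / c n\<bar> \<le> 2 / e)"
    using eventually_gt_at_top[of 0]
  proof eventually_elim
    case (elim n)
    with A(2)[of n] show ?case by linarith
  qed
  with A(1) show "\<exists>B. likely \<D> e (\<lambda>x. \<bar>X x / (b (fst x) + inverse (real (Suc (fst x))))\<bar> \<le> B)"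
    unfolding likely_def by (intro exI[of _ "2 / e"]) (auto simp: c_def)
qed

lemma eventually_W_pos: "eventually (\<lambda>x. fst x > 0) W"
  using eventually_whp_fst[OF eventually_gt_at_top[of 0]] by (simp add: case_prod_unfold)

lemma eventually_W_pos_space: "eventually (\<lambda>(n, \<omega>, f). n > 0 \<and> \<omega> \<in> space (\<Omega> n) \<and> f \<in> partitions K n) W"
  using eventually_W_pos eventually_whp_space
  by eventually_elim (auto simp: space_dml_space)

lemma tendsto_W_cong:
  fixes X Y :: "nat \<times> (nat \<Rightarrow> 'x obs) \<times> (nat \<Rightarrow> nat) \<Rightarrow> real"
  assumes "(Y \<longlongrightarrow> l) W"
    and "\<And>n \<omega> f. n > 0 \<Longrightarrow> \<omega> \<in> space (\<Omega> n) \<Longrightarrow> f \<in> partitions K n \<Longrightarrow> X (n, \<omega>, f) = Y (n, \<omega>, f)"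
  shows "(X \<longlongrightarrow> l) W"
proof (rule Lim_transform_eventually[OF assms(1)])
  show "eventually (\<lambda>x. Y x = X x) W"
    using eventually_W_pos_space by eventually_elim (auto simp: assms(2))
qed

text \<open>One scaled estimate serves two purposes: vanishing bounds make the scale tend to zero
  and give an o_P(1) term, while a constant bound gives an O_P(1) term in
  \<open>scaled_Op\<close>.\<close>

lemma scaled_tendsto_0:
  assumes X: "Op (\<lambda>x. X x / (b (fst x) + inverse (real (Suc (fst x)))))" and b: "\<And>n. b n \<ge> 0" "b \<longlonglongrightarrow> 0"
  shows "(X \<longlongrightarrow> 0) W"
proof -
  have "(\<lambda>n. b n + inverse (real (Suc n))) \<longlonglongrightarrow> 0 + 0" by (intro tendsto_add b LIMSEQ_inverse_real_of_nat)
  from tendsto_whp_fst[OF this] have "((\<lambda>x. b (fst x) + inverse (real (Suc (fst x)))) \<longlongrightarrow> 0) W"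
    by (simp add: case_prod_unfold)
  moreover have "b n + inverse (real (Suc n)) \<noteq> 0" for n
    using b(1)[of n] by (simp add: add_nonneg_eq_0_iff del: of_nat_Suc)
  ultimately show ?thesis using Op_mult_tendsto[OF X] by force
qed

lemma scaled_Op:
  assumes X: "Op (\<lambda>x. X x / (b + inverse (real (Suc (fst x)))))" and b: "b \<ge> 0"
  shows "Op X"
proof -
  have "\<bar>b + inverse (real (Suc n))\<bar> \<le> b + 1" for n using b by (simp add: inverse_le_1_iff)
  from Op_bounded_seq[of "\<lambda>n. b + inverse (real (Suc n))", OF this]
  have "Op (\<lambda>x. b + inverse (real (Suc (fst x))))" by (simp add: case_prod_unfold)
  moreover have "b + inverse (real (Suc n)) \<noteq> 0" for n
    using b by (simp add: add_nonneg_eq_0_iff del: of_nat_Suc)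
  ultimately show ?thesis using Op_mult[OF X] by force
qed

end

section \<open>A central limit theorem for row-wise i.i.d. arrays\<close>

text \<open>Lyapunov's splitting of the Taylor remainder: below the level L one factor |x| of the
  cube is replaced by L, above it the square is raised to the power p. A moment of order p > 2 thus
  replaces the third moment.\<close>

lemma min_cube_bound:
  fixes x s L p :: real
  assumes "L > 0" "p > 2"
  shows "min (6 * x\<^sup>2) (\<bar>s\<bar> * \<bar>x\<bar> ^ 3) \<le> \<bar>s\<bar> * L * x\<^sup>2 + 6 * L powr (2 - p) * \<bar>x\<bar> powr p"
proof (cases "\<bar>x\<bar> \<le> L")
  case True
  have "\<bar>s\<bar> * \<bar>x\<bar> ^ 3 = \<bar>s\<bar> * \<bar>x\<bar> * x\<^sup>2" by (simp add: power3_eq_cube power2_eq_square)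
  also have "\<dots> \<le> \<bar>s\<bar> * L * x\<^sup>2" using True by (intro mult_right_mono mult_left_mono) auto
  finally show ?thesis by (simp add: min.coboundedI2 add_increasing2)
next
  case False
  then have x: "\<bar>x\<bar> > 0" using assms by auto
  have "x\<^sup>2 = \<bar>x\<bar> powr (2 - p) * \<bar>x\<bar> powr p"
    using x by (simp add: powr_add[symmetric])
  also have "\<dots> \<le> L powr (2 - p) * \<bar>x\<bar> powr p"
    using False assms by (intro mult_right_mono powr_mono2') auto
  finally have "6 * x\<^sup>2 \<le> 6 * L powr (2 - p) * \<bar>x\<bar> powr p" by simp
  moreover have "0 \<le> \<bar>s\<bar> * L * x\<^sup>2" using assms by auto
  ultimately show ?thesis by linarith
qed

context dml_seq
begin

text \<open>The law of the summands changes with n, so uniform Lyapunov moments take the place of a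
  fixed distribution. Independence turns the characteristic function into a power, which is compared
  with the power of the Gaussian second-order approximation.\<close>

theorem clt_char:
  assumes K: "K > 0" and p: "p > 2"
    and meas[measurable]: "\<And>n. \<xi> n \<in> borel_measurable (P n)"
    and int2: "\<And>n. integrable (P n) (\<lambda>w. (\<xi> n w)\<^sup>2)"
    and mean: "\<And>n. (\<integral>w. \<xi> n w \<partial>P n) = 0"
    and var: "\<And>n. (\<integral>w. (\<xi> n w)\<^sup>2 \<partial>P n) = 1"
    and intp: "\<And>n. integrable (P n) (\<lambda>w. \<bar>\<xi> n w\<bar> powr p)" "\<And>n. (\<integral>w. \<bar>\<xi> n w\<bar> powr p \<partial>P n) \<le> B"
  shows "(\<lambda>n. char (distr (\<Omega> n) borel (\<lambda>\<omega>. (\<Sum>i<K*n. \<xi> n (\<omega> i)) / sqrt (real (K*n)))) t)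
     \<longlonglongrightarrow> exp (- (t\<^sup>2) / 2)"
proof -
  define \<phi> where "\<phi> n = char (distr (P n) borel (\<xi> n)) (t / sqrt (real (K*n)))" for n
  \<comment> \<open>With N = K n this is N times the one-summand error at s = t / sqrt N, cut off at
    L = N to the 1/4: the factor |s| L gives the exponent -1/4 and \<open>L powr (2 - p)\<close> the
    exponent (2 - p)/4.\<close>
  define b where "b n = t\<^sup>2 / 6 * (\<bar>t\<bar> * real (K*n) powr (-1/4) + 6 * B * real (K*n) powr ((2-p)/4))" for n
  have filt: "filterlim (\<lambda>n. real (K*n)) at_top sequentially"
    using K by (intro filterlim_compose[OF filterlim_real_sequentially])
       (auto simp: filterlim_at_top eventually_sequentially intro!: exI order_trans[OF _ mult_le_mono1[of 1 K]])
  have power: "char (distr (\<Omega> n) borel (\<lambda>\<omega>. (\<Sum>i<K*n. \<xi> n (\<omega> i)) / sqrt (real (K*n)))) t = \<phi> n ^ (K*n)" for n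
  proof -
    interpret prob_space "P n" by (rule prob_space_P)
    interpret product_sigma_finite "\<lambda>_. P n" by unfold_locales
    have "char (distr (\<Omega> n) borel (\<lambda>\<omega>. (\<Sum>i<K*n. \<xi> n (\<omega> i)) / sqrt (real (K*n)))) t =
      (\<integral>\<omega>. iexp (t * ((\<Sum>i<K*n. \<xi> n (\<omega> i)) / sqrt (real (K*n)))) \<partial>\<Omega> n)"
      unfolding char_def by (subst integral_distr) auto
    also have "\<dots> = (\<integral>\<omega>. (\<Prod>i<K*n. iexp (t / sqrt (real (K*n)) * \<xi> n (\<omega> i))) \<partial>\<Omega> n)"
      by (intro Bochner_Integration.integral_cong refl)
         (simp add: exp_sum[symmetric] sum_distrib_left sum_divide_distrib)
    also have "\<dots> = (\<Prod>i<K*n. (\<integral>w. iexp (t / sqrt (real (K*n)) * \<xi> n w) \<partial>P n))"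
      by (rule product_integral_prod) (auto intro!: integrable_const_bound[where B=1])
    also have "\<dots> = \<phi> n ^ (K*n)"
      unfolding \<phi>_def char_def by (subst integral_distr) auto
    finally show ?thesis .
  qed
  have main: "\<forall>\<^sub>F n in sequentially. cmod (\<phi> n ^ (K*n) - (1 + (-(t\<^sup>2) / 2) / real (K*n)) ^ (K*n)) \<le> b n"
    \<comment> \<open>The threshold t^2/4 keeps 1 - t^2/(2N) in [-1, 1], as the comparison of powers
      requires of both bases; the threshold 1 excludes N = 0.\<close>
    using filterlim_at_top[THEN iffD1, OF filt, rule_format, of "max 1 (t\<^sup>2 / 4)"]
  proof eventually_elim
    case (elim n)
    interpret prob_space "P n" by (rule prob_space_P)
    define N where "N = K * n"
    have N: "real N \<ge> 1" "real N \<ge> t\<^sup>2 / 4" using elim by (auto simp: N_def)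
    define L where "L = real N powr (1/4)"
    have L: "L > 0" using N by (simp add: L_def)
    let ?s = "t / sqrt (real N)"
    have int1: "integrable (P n) (\<xi> n)"
      by (rule square_integrable_imp_integrable[OF _ int2]) simp
    have s2: "?s\<^sup>2 = t\<^sup>2 / real N" using N by (simp add: power_divide)
    have "cmod (\<phi> n - (1 - ?s\<^sup>2 * 1 / 2)) \<le> (?s\<^sup>2 / 6) * expectation (\<lambda>x. min (6 * (\<xi> n x)^2) (\<bar>?s\<bar> * \<bar>\<xi> n x\<bar>^3))"
      unfolding \<phi>_def N_def[symmetric]
      by (rule char_approx3'[OF _ int1 int2 mean]) (use mean var in auto)
    also have "\<dots> \<le> (?s\<^sup>2 / 6) * expectation (\<lambda>x. \<bar>?s\<bar> * L * (\<xi> n x)\<^sup>2 + 6 * L powr (2 - p) * \<bar>\<xi> n x\<bar> powr p)"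
    proof (intro mult_left_mono integral_mono)
      show "integrable (P n) (\<lambda>x. min (6 * (\<xi> n x)^2) (\<bar>?s\<bar> * \<bar>\<xi> n x\<bar>^3))"
        by (rule Bochner_Integration.integrable_bound[of _ "\<lambda>x. 6 * (\<xi> n x)^2"]) (use int2 in auto)
      show "min (6 * (\<xi> n x)\<^sup>2) (\<bar>?s\<bar> * \<bar>\<xi> n x\<bar> ^ 3) \<le> \<bar>?s\<bar> * L * (\<xi> n x)\<^sup>2 + 6 * L powr (2 - p) * \<bar>\<xi> n x\<bar> powr p" for x
        by (rule min_cube_bound[OF L p])
    qed (use int2 intp in auto)
    also have "expectation (\<lambda>x. \<bar>?s\<bar> * L * (\<xi> n x)\<^sup>2 + 6 * L powr (2 - p) * \<bar>\<xi> n x\<bar> powr p)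
       = \<bar>?s\<bar> * L + 6 * L powr (2 - p) * expectation (\<lambda>x. \<bar>\<xi> n x\<bar> powr p)"
      using int2 intp var by simp
    also have "\<dots> \<le> \<bar>?s\<bar> * L + 6 * L powr (2 - p) * B"
      using intp by (intro add_left_mono mult_left_mono) auto
    also have "\<bar>?s\<bar> * L = \<bar>t\<bar> * real N powr (-1/4)"
      using N by (simp add: L_def powr_half_sqrt[symmetric] powr_minus powr_add[symmetric] divide_simps)
    also have "L powr (2 - p) = real N powr ((2-p)/4)"
      by (simp add: L_def powr_powr)
    finally have 1: "cmod (\<phi> n - (1 - ?s\<^sup>2 * 1 / 2)) \<le> (?s\<^sup>2 / 6) * (\<bar>t\<bar> * real N powr (-1/4) + 6 * real N powr ((2-p)/4) * B)"
      by (simp add: mult_left_mono)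
    have eq: "(1 - complex_of_real (?s\<^sup>2) * 1 / 2) = complex_of_real (1 + (-(t\<^sup>2) / 2) / real N)"
      unfolding s2 by simp
    have "cmod (\<phi> n ^ N - complex_of_real (1 + (-(t\<^sup>2) / 2) / real N) ^ N)
       \<le> real N * cmod (\<phi> n - complex_of_real (1 + (-(t\<^sup>2) / 2) / real N))"
    proof (rule norm_power_diff)
      show "cmod (\<phi> n) \<le> 1" unfolding \<phi>_def
        by (rule real_distribution.cmod_char_le_1) (simp add: real_distribution_distr)
      have "\<bar>1 + (-(t\<^sup>2) / 2) / real N\<bar> \<le> 1"
        using N by (auto intro!: abs_leI simp: field_simps)
      then show "cmod (complex_of_real (1 + (-(t\<^sup>2) / 2) / real N)) \<le> 1" by (simp only: norm_of_real)
    qed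
    also have "\<dots> \<le> real N * ((?s\<^sup>2 / 6) * (\<bar>t\<bar> * real N powr (-1/4) + 6 * real N powr ((2-p)/4) * B))"
      using 1 eq by (intro mult_left_mono) (simp_all only: of_real_1 of_real_diff of_real_mult of_real_divide of_real_numeral)
    also have "\<dots> = b n" unfolding s2 b_def N_def[symmetric] using N by (simp add: field_simps)
    finally show ?case by (simp add: N_def)
  qed
  have "b \<longlonglongrightarrow> t\<^sup>2 / 6 * (\<bar>t\<bar> * 0 + 6 * B * 0)"
    unfolding b_def using p by (intro tendsto_intros tendsto_neg_powr filt) auto
  then have b0: "b \<longlonglongrightarrow> 0" by simp
  have "(\<lambda>n. (1 + (-(t\<^sup>2) / 2) / real (K*n)) ^ (K*n)) \<longlonglongrightarrow> exp (-(t\<^sup>2) / 2)"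
    using filterlim_compose[OF tendsto_exp_limit_sequentially[of "-(t\<^sup>2) / 2"], of "\<lambda>n. K * n"] K
    by (simp add: filterlim_subseq strict_mono_def)
  then have "(\<lambda>n. complex_of_real ((1 + (-(t\<^sup>2) / 2) / real (K*n)) ^ (K*n))) \<longlonglongrightarrow> complex_of_real (exp (-(t\<^sup>2) / 2))"
    by (rule tendsto_of_real)
  then have "(\<lambda>n. \<phi> n ^ (K*n)) \<longlonglongrightarrow> complex_of_real (exp (-(t\<^sup>2) / 2))"
    by (rule Lim_transform) (use Lim_null_comparison[OF main b0] in simp)
  then show ?thesis unfolding power .
qed

lemma char_dml_space_fst:
  assumes [measurable]: "g \<in> borel_measurable (\<Omega> n)"
  shows "char (distr (\<D> n) borel (\<lambda>z. g (fst z))) = char (distr (\<Omega> n) borel g)"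
proof -
  interpret R: prob_space "uniform_count_measure (partitions K n)" by (rule prob_space_partitions)
  have "distr (\<D> n) borel (g \<circ> fst) = distr (distr (\<D> n) (\<Omega> n) fst) borel g"
    unfolding dml_space_def by (rule distr_distr[symmetric]) measurable
  also have "distr (\<D> n) (\<Omega> n) fst = \<Omega> n"
    unfolding dml_space_def by (rule R.distr_pair_fst)
  finally show ?thesis by (simp add: comp_def)
qed

end

text \<open>The functional form of "computed from the observations outside I": overwriting a
  coordinate in I does not change the fitted function. Together with joint measurability this is all
  that Fubini needs, so no \<sigma>-algebra of training data appears.\<close>

definition (in dml_seq) cross :: "nat \<Rightarrow> nat set \<Rightarrow> ((nat \<Rightarrow> 'x obs) \<Rightarrow> 'x obs \<Rightarrow> real) \<Rightarrow> bool" where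
  "cross n I F \<longleftrightarrow> (\<lambda>(\<omega>, w). F \<omega> w) \<in> borel_measurable (\<Omega> n \<Otimes>\<^sub>M P n) \<and>
     (\<forall>\<omega>\<in>space (\<Omega> n). \<forall>i\<in>I. \<forall>x\<in>space (P n). F (fun_upd \<omega> i x) = F \<omega>)"

context dml_seq
begin

lemma cross_measurable: "cross n I F \<Longrightarrow> (\<lambda>(\<omega>, w). F \<omega> w) \<in> borel_measurable (\<Omega> n \<Otimes>\<^sub>M P n)"
  by (simp add: cross_def)

lemma cross_local:
  "cross n I F \<Longrightarrow> \<omega> \<in> space (\<Omega> n) \<Longrightarrow> i \<in> I \<Longrightarrow> x \<in> space (P n) \<Longrightarrow> F (fun_upd \<omega> i x) = F \<omega>"
  unfolding cross_def by blast

lemma cross_const: "g \<in> borel_measurable (P n) \<Longrightarrow> cross n I (\<lambda>\<omega>. g)"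
  unfolding cross_def by auto

lemma cross_binop:
  assumes F: "cross n I F" and G: "cross n I G"
    and [measurable]: "(\<lambda>(x, y). g x y) \<in> borel_measurable (borel \<Otimes>\<^sub>M borel)"
  shows "cross n I (\<lambda>\<omega> w. g (F \<omega> w) (G \<omega> w))"
  unfolding cross_def
proof (intro conjI ballI)
  note [measurable] = cross_measurable[OF F] cross_measurable[OF G]
  have "(\<lambda>x. (case (F (fst x) (snd x), G (fst x) (snd x)) of (x, y) \<Rightarrow> g x y)) \<in> borel_measurable (\<Omega> n \<Otimes>\<^sub>M P n)"
    by measurable
  then show "(\<lambda>(\<omega>, w). g (F \<omega> w) (G \<omega> w)) \<in> borel_measurable (\<Omega> n \<Otimes>\<^sub>M P n)"
    by (simp add: case_prod_unfold)
qed (use F G in \<open>simp add: cross_local\<close>)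

lemma cross_mult: "cross n I F \<Longrightarrow> cross n I G \<Longrightarrow> cross n I (\<lambda>\<omega> w. F \<omega> w * G \<omega> w)"
  by (rule cross_binop) measurable

lemma cross_add: "cross n I F \<Longrightarrow> cross n I G \<Longrightarrow> cross n I (\<lambda>\<omega> w. F \<omega> w + G \<omega> w)"
  by (rule cross_binop) measurable

lemma cross_diff: "cross n I F \<Longrightarrow> cross n I G \<Longrightarrow> cross n I (\<lambda>\<omega> w. F \<omega> w - G \<omega> w)"
  by (rule cross_binop) measurable

lemma cross_power: "cross n I F \<Longrightarrow> cross n I (\<lambda>\<omega> w. F \<omega> w ^ j)"
  by (rule cross_binop[where G=F]) measurable

lemma cross_section: "cross n I F \<Longrightarrow> \<omega> \<in> space (\<Omega> n) \<Longrightarrow> F \<omega> \<in> borel_measurable (P n)"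
  using measurable_compose[OF measurable_Pair1', of \<omega> "\<Omega> n", OF _ cross_measurable] by simp

lemma cross_eval:
  assumes "cross n I F" "i < K * n"
  shows "(\<lambda>\<omega>. F \<omega> (\<omega> i)) \<in> borel_measurable (\<Omega> n)"
proof -
  have i: "i \<in> {..<K*n}" using assms by simp
  show ?thesis
    using measurable_compose[OF measurable_Pair[OF measurable_ident measurable_component_singleton[OF i]] cross_measurable[OF assms(1)]]
    by (simp add: id_def)
qed

lemma cross_En:
  assumes "cross n I F" "J \<subseteq> {..<K*n}"
  shows "(\<lambda>\<omega>. En n J (F \<omega>) \<omega>) \<in> borel_measurable (\<Omega> n)"
proof -
  have "(\<lambda>\<omega>. F \<omega> (\<omega> i)) \<in> borel_measurable (\<Omega> n)" if "i \<in> J" for i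
    using cross_eval[OF assms(1), of i] assms(2) that by auto
  then show ?thesis unfolding En_def by measurable
qed

lemma fold_subset: "fold K n f k \<subseteq> {..<K*n}"
  by (auto simp: fold_def)

lemma card_fold: "f \<in> partitions K n \<Longrightarrow> k < K \<Longrightarrow> card (fold K n f k) = n"
  by (auto simp: fold_def partitions_def)

end

text \<open>\<open>Good n I\<close> stands for the event that the learner trained off I meets its
  error bounds, and \<open>dl\<close> bounds the probability that it does not. Locality in I says
  that the held-out data have no influence on this event.\<close>

locale crossfit_event = dml_seq P K for P :: "nat \<Rightarrow> 'x obs measure" and K +
  fixes Good :: "nat \<Rightarrow> nat set \<Rightarrow> (nat \<Rightarrow> 'x obs) set" and dl :: "nat \<Rightarrow> real"
  assumes K_pos: "K > 0"
    and Good_sets: "Good n I \<in> sets (PiM {..<K*n} (\<lambda>_. P n))"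
    and Good_local: "\<omega> \<in> space (PiM {..<K*n} (\<lambda>_. P n)) \<Longrightarrow> i \<in> I \<Longrightarrow> I \<subseteq> {..<K*n} \<Longrightarrow> x \<in> space (P n) \<Longrightarrow>
      fun_upd \<omega> i x \<in> Good n I \<longleftrightarrow> \<omega> \<in> Good n I"
    and Good_prob: "I \<subseteq> {..<K*n} \<Longrightarrow> card I = n \<Longrightarrow>
      measure (PiM {..<K*n} (\<lambda>_. P n)) (space (PiM {..<K*n} (\<lambda>_. P n)) - Good n I) \<le> dl n"
    and dl: "dl n \<ge> 0" "dl \<longlonglongrightarrow> 0"
begin

text \<open>Multiplying by the indicator turns bounds valid on the good event into bounds valid
  everywhere, and it preserves the independence from the held-out fold.\<close>

lemma cross_Good:
  assumes F: "cross n I F" and "I \<subseteq> {..<K*n}"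
  shows "cross n I (\<lambda>\<omega> w. indicator (Good n I) \<omega> * F \<omega> w)"
  unfolding cross_def
proof (intro conjI ballI)
  note [measurable] = cross_measurable[OF F] Good_sets
  show "(\<lambda>(\<omega>, w). indicator (Good n I) \<omega> * F \<omega> w) \<in> borel_measurable (\<Omega> n \<Otimes>\<^sub>M P n)"
    by measurable
  show "(\<lambda>w. indicator (Good n I) (fun_upd \<omega> i x) * F (fun_upd \<omega> i x) w) = (\<lambda>w. indicator (Good n I) \<omega> * F \<omega> w)"
    if "\<omega> \<in> space (\<Omega> n)" "i \<in> I" "x \<in> space (P n)" for \<omega> i x
    using Good_local[OF that(1,2) assms(2) that(3)] cross_local[OF F that] by (simp add: indicator_def)
qed

lemma nn_integral_En_le:
  fixes b :: "real"
  assumes n: "n > 0" and I: "I \<subseteq> {..<K*n}" "card I = n" and F: "cross n I F"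
    and bound: "\<And>\<omega>. \<omega> \<in> Good n I \<Longrightarrow> (\<integral>\<^sup>+w. ennreal \<bar>F \<omega> w\<bar> \<partial>P n) \<le> ennreal b" and b: "b \<ge> 0"
  shows "(\<integral>\<^sup>+\<omega>. ennreal \<bar>En n I (F \<omega>) \<omega>\<bar> * indicator (Good n I) \<omega> \<partial>\<Omega> n) \<le> ennreal b"
proof -
  interpret Q: prob_space "\<Omega> n" by (rule prob_space_PiM) (rule prob_space_P)
  let ?F = "\<lambda>\<omega> w. indicator (Good n I) \<omega> * F \<omega> w"
  have cF: "cross n I ?F" by (rule cross_Good[OF F I(1)])
  note [measurable] = cross_measurable[OF cF]
  have finI: "finite I" using I(1) finite_subset by auto
  have meas: "(\<lambda>\<omega>. ennreal \<bar>?F \<omega> (\<omega> i)\<bar>) \<in> borel_measurable (\<Omega> n)" if "i \<in> I" for i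
    using cross_eval[OF cF, of i] I(1) that by auto
  have "(\<integral>\<^sup>+\<omega>. ennreal \<bar>En n I (F \<omega>) \<omega>\<bar> * indicator (Good n I) \<omega> \<partial>\<Omega> n)
     \<le> (\<integral>\<^sup>+\<omega>. ennreal (1 / n) * (\<Sum>i\<in>I. ennreal \<bar>?F \<omega> (\<omega> i)\<bar>) \<partial>\<Omega> n)"
  proof (rule nn_integral_mono)
    fix \<omega>
    show "ennreal \<bar>En n I (F \<omega>) \<omega>\<bar> * indicator (Good n I) \<omega> \<le> ennreal (1 / n) * (\<Sum>i\<in>I. ennreal \<bar>?F \<omega> (\<omega> i)\<bar>)"
    proof (cases "\<omega> \<in> Good n I")
      case True
      have "\<bar>En n I (F \<omega>) \<omega>\<bar> = 1 / n * \<bar>\<Sum>i\<in>I. F \<omega> (\<omega> i)\<bar>" by (simp add: En_def)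
      also have "\<dots> \<le> 1 / n * (\<Sum>i\<in>I. \<bar>F \<omega> (\<omega> i)\<bar>)" by (intro mult_left_mono sum_abs) auto
      finally have "ennreal \<bar>En n I (F \<omega>) \<omega>\<bar> \<le> ennreal (1 / n * (\<Sum>i\<in>I. \<bar>F \<omega> (\<omega> i)\<bar>))" by (rule ennreal_leI)
      also have "\<dots> = ennreal (1 / n) * (\<Sum>i\<in>I. ennreal \<bar>F \<omega> (\<omega> i)\<bar>)"
        by (subst ennreal_mult) (auto intro!: sum_nonneg simp: sum_ennreal)
      finally show ?thesis using True by simp
    qed simp
  qed
  also have "\<dots> = ennreal (1 / n) * (\<Sum>i\<in>I. (\<integral>\<^sup>+\<omega>. ennreal \<bar>?F \<omega> (\<omega> i)\<bar> \<partial>\<Omega> n))"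
    using meas by (subst nn_integral_cmult) (simp_all add: nn_integral_sum del: sum_ennreal)
  also have "\<dots> \<le> ennreal (1 / n) * (\<Sum>i\<in>I. ennreal b)"
  proof (intro mult_left_mono sum_mono)
    fix i assume i: "i \<in> I"
    have "(\<integral>\<^sup>+\<omega>. ennreal \<bar>?F \<omega> (\<omega> i)\<bar> \<partial>\<Omega> n) = (\<integral>\<^sup>+\<omega>. (\<integral>\<^sup>+w. ennreal \<bar>?F \<omega> w\<bar> \<partial>P n) \<partial>\<Omega> n)"
    proof (rule nn_integral_PiM_coordinate[OF prob_space_P, where F="\<lambda>\<omega> w. ennreal \<bar>?F \<omega> w\<bar>"])
      show "ennreal \<bar>?F (fun_upd \<omega> i x) w\<bar> = ennreal \<bar>?F \<omega> w\<bar>"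
        if "\<omega> \<in> space (\<Omega> n)" "x \<in> space (P n)" for \<omega> x w
        using fun_cong[OF cross_local[OF cF that(1) i that(2)], of w] by simp
    qed (use I i in auto)
    also have "\<dots> \<le> (\<integral>\<^sup>+\<omega>. ennreal b \<partial>\<Omega> n)"
    proof (rule nn_integral_mono)
      fix \<omega> show "(\<integral>\<^sup>+w. ennreal \<bar>?F \<omega> w\<bar> \<partial>P n) \<le> ennreal b"
        using bound[of \<omega>] by (cases "\<omega> \<in> Good n I") auto
    qed
    also have "\<dots> = ennreal b" by (simp add: Q.emeasure_space_1)
    finally show "(\<integral>\<^sup>+\<omega>. ennreal \<bar>?F \<omega> (\<omega> i)\<bar> \<partial>\<Omega> n) \<le> ennreal b" .
  qed simp
  also have "\<dots> = ennreal b"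
    using n b I by (simp add: ennreal_of_nat_eq_real_of_nat ennreal_mult[symmetric])
  finally show ?thesis .
qed

lemma nn_integral_En_square_le:
  fixes b :: "real"
  assumes n: "n > 0" and I: "I \<subseteq> {..<K*n}" "card I = n" and F: "cross n I F"
    and zero: "\<And>\<omega>. \<omega> \<in> Good n I \<Longrightarrow> (\<integral>w. F \<omega> w \<partial>P n) = 0"
    and bound: "\<And>\<omega>. \<omega> \<in> Good n I \<Longrightarrow> (\<integral>\<^sup>+w. ennreal ((F \<omega> w)\<^sup>2) \<partial>P n) \<le> ennreal b" and b: "b \<ge> 0"
  shows "(\<integral>\<^sup>+\<omega>. ennreal ((sqrt (K*n) * En n I (F \<omega>) \<omega>)\<^sup>2) * indicator (Good n I) \<omega> \<partial>\<Omega> n) \<le> ennreal (K * b)"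
proof -
  let ?F = "\<lambda>\<omega> w. indicator (Good n I) \<omega> * F \<omega> w"
  have cF: "cross n I ?F" by (rule cross_Good[OF F I(1)])
  note [measurable] = cross_measurable[OF cF]
  have meas: "(\<lambda>\<omega>. ennreal ((\<Sum>i\<in>I. ?F \<omega> (\<omega> i))\<^sup>2)) \<in> borel_measurable (\<Omega> n)"
  proof -
    have "(\<lambda>\<omega>. ?F \<omega> (\<omega> i)) \<in> borel_measurable (\<Omega> n)" if "i \<in> I" for i
      using cross_eval[OF cF, of i] I(1) that by auto
    then show ?thesis by measurable
  qed
  \<comment> \<open>A fold holds n of the K n observations, so rescaling its average by sqrt (K n)
    leaves the factor K/n, which meets a sum with second moment at most n b. This is the origin of
    the factor K.\<close>
  have eq: "(sqrt (real K * real n) * S / real n)\<^sup>2 = real K * S\<^sup>2 / real n" for S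
    using n by (simp add: power_mult_distrib power_divide) (simp add: power2_eq_square)
  have "(\<integral>\<^sup>+\<omega>. ennreal ((sqrt (K*n) * En n I (F \<omega>) \<omega>)\<^sup>2) * indicator (Good n I) \<omega> \<partial>\<Omega> n)
     = (\<integral>\<^sup>+\<omega>. ennreal (K / n) * ennreal ((\<Sum>i\<in>I. ?F \<omega> (\<omega> i))\<^sup>2) \<partial>\<Omega> n)"
    by (intro nn_integral_cong) (auto simp: En_def indicator_def eq ennreal_mult[symmetric])
  also have "\<dots> = ennreal (K / n) * (\<integral>\<^sup>+\<omega>. ennreal ((\<Sum>i\<in>I. ?F \<omega> (\<omega> i))\<^sup>2) \<partial>\<Omega> n)"
    by (rule nn_integral_cmult[OF meas])
  also have "\<dots> \<le> ennreal (K / n) * ennreal (real (card I) * b)"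
  proof (intro mult_left_mono)
    show "(\<integral>\<^sup>+\<omega>. ennreal ((\<Sum>i\<in>I. ?F \<omega> (\<omega> i))\<^sup>2) \<partial>\<Omega> n) \<le> ennreal (real (card I) * b)"
    proof (rule nn_integral_PiM_sum_orthogonal[OF prob_space_P _ I(1) b])
      show "(\<lambda>(\<omega>, w). ?F \<omega> w) \<in> borel_measurable (\<Omega> n \<Otimes>\<^sub>M P n)" by (rule cross_measurable[OF cF])
      show "?F (fun_upd \<omega> i x) w = ?F \<omega> w" if "\<omega> \<in> space (\<Omega> n)" "i \<in> I" "x \<in> space (P n)" for \<omega> i x w
        using fun_cong[OF cross_local[OF cF that], of w] by simp
      show "(\<integral>w. ?F \<omega> w \<partial>P n) = 0" for \<omega>
        using zero[of \<omega>] by (cases "\<omega> \<in> Good n I") auto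
      show "(\<integral>\<^sup>+w. ennreal ((?F \<omega> w)\<^sup>2) \<partial>P n) \<le> ennreal b" for \<omega>
        using bound[of \<omega>] by (cases "\<omega> \<in> Good n I") auto
    qed simp
  qed simp
  also have "\<dots> = ennreal (K * b)"
    using n b I by (simp add: ennreal_mult[symmetric])
  finally show ?thesis .
qed

section \<open>Calculus of fold averages\<close>

definition AV :: "nat \<Rightarrow> (nat \<Rightarrow> nat set \<Rightarrow> (nat \<Rightarrow> 'x obs) \<Rightarrow> 'x obs \<Rightarrow> real)
    \<Rightarrow> nat \<times> (nat \<Rightarrow> 'x obs) \<times> (nat \<Rightarrow> nat) \<Rightarrow> real" where
  "AV k F = (\<lambda>(n, \<omega>, f). En n (fold K n f k) (F n (fold K n f k) \<omega>) \<omega>)"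

definition rN :: "nat \<times> (nat \<Rightarrow> 'x obs) \<times> (nat \<Rightarrow> nat) \<Rightarrow> real" where
  "rN = (\<lambda>(n, z). sqrt (real (K * n)))"

lemma AV_measurable:
  assumes "cross n (fold K n f k) (F n (fold K n f k))"
  shows "(\<lambda>\<omega>. AV k F (n, \<omega>, f)) \<in> borel_measurable (\<Omega> n)"
  unfolding AV_def using cross_En[OF assms fold_subset] by simp

lemma AV_scaled:
  fixes b :: "nat \<Rightarrow> real"
  assumes k: "k < K" and F: "\<And>n I. I \<subseteq> {..<K*n} \<Longrightarrow> cross n I (F n I)"
    and bound: "\<And>n I \<omega>. I \<subseteq> {..<K*n} \<Longrightarrow> \<omega> \<in> Good n I \<Longrightarrow> (\<integral>\<^sup>+w. ennreal \<bar>F n I \<omega> w\<bar> \<partial>P n) \<le> ennreal (b n)"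
    and b: "\<And>n. b n \<ge> 0"
  shows "Op (\<lambda>x. AV k F x / (b (fst x) + inverse (real (Suc (fst x)))))"
proof (rule markov_scaled[where G="\<lambda>n f. Good n (fold K n f k)", OF Good_sets Good_prob[OF fold_subset card_fold] _ _ dl b])
  fix n f assume f: "f \<in> partitions K n"
  show "(\<lambda>\<omega>. AV k F (n, \<omega>, f)) \<in> borel_measurable (\<Omega> n)"
    by (rule AV_measurable) (rule F[OF fold_subset])
  assume n: "n > 0"
  show "(\<integral>\<^sup>+\<omega>. ennreal \<bar>AV k F (n, \<omega>, f)\<bar> * indicator (Good n (fold K n f k)) \<omega> \<partial>\<Omega> n) \<le> ennreal (b n)"
    unfolding AV_def prod.case
    by (rule nn_integral_En_le[OF n fold_subset card_fold[OF f k] F[OF fold_subset] bound[OF fold_subset] b])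
qed (use k in auto)

lemmas AV_tendsto_0 = scaled_tendsto_0[where b=b, OF AV_scaled[where b=b]] for b
lemmas AV_Op = scaled_Op[where b=b, OF AV_scaled[where b="\<lambda>_. b"]] for b

text \<open>The second-moment counterpart of \<open>AV_scaled\<close>. Only centring given the
  training data allows the average to be multiplied by the root of the sample size.\<close>

lemma rN_AV_scaled:
  fixes b :: "nat \<Rightarrow> real"
  assumes k: "k < K" and F: "\<And>n I. I \<subseteq> {..<K*n} \<Longrightarrow> cross n I (F n I)"
    and zero: "\<And>n I \<omega>. I \<subseteq> {..<K*n} \<Longrightarrow> \<omega> \<in> Good n I \<Longrightarrow> (\<integral>w. F n I \<omega> w \<partial>P n) = 0"
    and bound: "\<And>n I \<omega>. I \<subseteq> {..<K*n} \<Longrightarrow> \<omega> \<in> Good n I \<Longrightarrow> (\<integral>\<^sup>+w. ennreal ((F n I \<omega> w)\<^sup>2) \<partial>P n) \<le> ennreal (b n)"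
    and b: "\<And>n. b n \<ge> 0"
  shows "Op (\<lambda>x. (rN x * AV k F x)\<^sup>2 / (K * b (fst x) + inverse (real (Suc (fst x)))))"
proof (rule markov_scaled[where G="\<lambda>n f. Good n (fold K n f k)", OF Good_sets Good_prob[OF fold_subset card_fold] _ _ dl])
  fix n f assume f: "f \<in> partitions K n"
  show "(\<lambda>\<omega>. (rN (n, \<omega>, f) * AV k F (n, \<omega>, f))\<^sup>2) \<in> borel_measurable (\<Omega> n)"
    using AV_measurable[of n f k F, OF F[OF fold_subset]] by (auto simp: rN_def)
  assume n: "n > 0"
  show "(\<integral>\<^sup>+\<omega>. ennreal \<bar>(rN (n, \<omega>, f) * AV k F (n, \<omega>, f))\<^sup>2\<bar> * indicator (Good n (fold K n f k)) \<omega> \<partial>\<Omega> n) \<le> ennreal (K * b n)"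
    unfolding AV_def rN_def prod.case abs_power2
    by (rule nn_integral_En_square_le[OF n fold_subset card_fold[OF f k] F[OF fold_subset] zero[OF fold_subset] bound[OF fold_subset] b])
qed (use k b in auto)

lemma rN_AV_tendsto_0:
  fixes b :: "nat \<Rightarrow> real"
  assumes "k < K" "\<And>n I. I \<subseteq> {..<K*n} \<Longrightarrow> cross n I (F n I)"
    "\<And>n I \<omega>. I \<subseteq> {..<K*n} \<Longrightarrow> \<omega> \<in> Good n I \<Longrightarrow> (\<integral>w. F n I \<omega> w \<partial>P n) = 0"
    "\<And>n I \<omega>. I \<subseteq> {..<K*n} \<Longrightarrow> \<omega> \<in> Good n I \<Longrightarrow> (\<integral>\<^sup>+w. ennreal ((F n I \<omega> w)\<^sup>2) \<partial>P n) \<le> ennreal (b n)"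
    and b: "\<And>n. b n \<ge> 0" "b \<longlonglongrightarrow> 0"
  shows "((\<lambda>x. rN x * AV k F x) \<longlongrightarrow> 0) W"
  by (rule tendsto_0_square, rule scaled_tendsto_0[OF rN_AV_scaled[OF assms(1-5)]])
     (use b in \<open>auto intro: tendsto_mult_right_zero\<close>)

lemma rN_AV_Op:
  fixes b :: real
  assumes "k < K" "\<And>n I. I \<subseteq> {..<K*n} \<Longrightarrow> cross n I (F n I)"
    "\<And>n I \<omega>. I \<subseteq> {..<K*n} \<Longrightarrow> \<omega> \<in> Good n I \<Longrightarrow> (\<integral>w. F n I \<omega> w \<partial>P n) = 0"
    "\<And>n I \<omega>. I \<subseteq> {..<K*n} \<Longrightarrow> \<omega> \<in> Good n I \<Longrightarrow> (\<integral>\<^sup>+w. ennreal ((F n I \<omega> w)\<^sup>2) \<partial>P n) \<le> ennreal b"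
    and b: "b \<ge> 0"
  shows "Op (\<lambda>x. rN x * AV k F x)"
proof -
  have "Op (\<lambda>x. (rN x * AV k F x)\<^sup>2)" by (rule scaled_Op[OF rN_AV_scaled[OF assms]]) (use b in auto)
  then have "Op (\<lambda>x. 1 + (rN x * AV k F x)\<^sup>2)" by (intro Op_add Op_const)
  then show ?thesis
  proof (rule Op_abs_bound)
    show "\<bar>rN x * AV k F x\<bar> \<le> \<bar>1 + (rN x * AV k F x)\<^sup>2\<bar>" for x
      using abs_le_1_plus_square[of "rN x * AV k F x"] by linarith
  qed
qed

lemma inverse_rN: "((\<lambda>x. 1 / rN x) \<longlongrightarrow> 0) W"
proof -
  have "(\<lambda>n. 1 / sqrt (real K) * (1 / sqrt (real n))) \<longlonglongrightarrow> 0"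
    by (intro tendsto_mult_right_zero tendsto_divide_0[OF tendsto_const]
        filterlim_at_top_imp_at_infinity filterlim_compose[OF sqrt_at_top] filterlim_real_sequentially)
  from tendsto_whp_fst[OF this] show ?thesis
    by (simp add: rN_def case_prod_unfold real_sqrt_mult)
qed

lemma rN_cancel:
  assumes "((\<lambda>x. rN x * X x * (1 / rN x)) \<longlongrightarrow> 0) W"
  shows "(X \<longlongrightarrow> 0) W"
  using assms by (rule tendsto_W_cong) (use K_pos in \<open>simp add: rN_def\<close>)

lemma AV_add: "AV k (\<lambda>n I \<omega> w. F n I \<omega> w + G n I \<omega> w) x = AV k F x + AV k G x"
  by (simp add: AV_def En_def sum.distrib add_divide_distrib split: prod.split)

lemma AV_diff: "AV k (\<lambda>n I \<omega> w. F n I \<omega> w - G n I \<omega> w) x = AV k F x - AV k G x"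
  by (simp add: AV_def En_def sum_subtractf diff_divide_distrib split: prod.split)

lemma AV_cmult: "AV k (\<lambda>n I \<omega> w. a * F n I \<omega> w) x = a * AV k F x"
  by (simp add: AV_def En_def sum_distrib_left split: prod.split)

lemma AV_mono: "(\<And>n I \<omega> w. F n I \<omega> w \<le> G n I \<omega> w) \<Longrightarrow> AV k F x \<le> AV k G x"
  by (cases x) (simp add: AV_def En_def divide_right_mono sum_mono)

lemma AV_nonneg: "(\<And>n I \<omega> w. 0 \<le> F n I \<omega> w) \<Longrightarrow> 0 \<le> AV k F x"
  by (cases x) (simp add: AV_def En_def sum_nonneg)

lemma AV_Cauchy_Schwarz:
  "(AV k (\<lambda>n I \<omega> w. F n I \<omega> w * G n I \<omega> w) x)\<^sup>2 \<le> AV k (\<lambda>n I \<omega> w. (F n I \<omega> w)\<^sup>2) x * AV k (\<lambda>n I \<omega> w. (G n I \<omega> w)\<^sup>2) x"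
  by (auto simp: AV_def En_def power_divide power2_eq_square[of "real _"]
      intro!: divide_right_mono Cauchy_Schwarz_ineq_sum split: prod.split)

text \<open>Cauchy-Schwarz inside a fold: for products with nuisance errors it suffices to control
  mean squares of the factors.\<close>

lemma AV_mult_tendsto_0:
  assumes "Op (AV k (\<lambda>n I \<omega> w. (F n I \<omega> w)\<^sup>2))" "(AV k (\<lambda>n I \<omega> w. (G n I \<omega> w)\<^sup>2) \<longlongrightarrow> 0) W"
  shows "(AV k (\<lambda>n I \<omega> w. F n I \<omega> w * G n I \<omega> w) \<longlongrightarrow> 0) W"
proof (rule tendsto_0_square, rule tendsto_0_abs_bound[OF Op_mult_tendsto[OF assms]])
  fix n z
  show "\<bar>(AV k (\<lambda>n I \<omega> w. F n I \<omega> w * G n I \<omega> w) (n, z))\<^sup>2\<bar>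
    \<le> \<bar>AV k (\<lambda>n I \<omega> w. (F n I \<omega> w)\<^sup>2) (n, z) * AV k (\<lambda>n I \<omega> w. (G n I \<omega> w)\<^sup>2) (n, z)\<bar>"
    using AV_Cauchy_Schwarz[of k F G "(n, z)"] by simp
qed

lemma AV_centered:
  assumes "n > 0" "f \<in> partitions K n" "k < K"
  shows "AV k (\<lambda>n I \<omega> w. F n I \<omega> w - a n) (n, \<omega>, f) = AV k F (n, \<omega>, f) - a n"
  using assms by (simp add: AV_def En_def sum_subtractf card_fold diff_divide_distrib)

end

section \<open>Limit theory for an abstract cross-fitted score\<close>

lemma truncation_error_le:
  fixes x L r :: real
  assumes "x \<ge> 0" "L > 0" "r > 1"
  shows "x - min x L \<le> L powr (1 - r) * x powr r"
proof (cases "x \<le> L")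
  case False
  then have x: "x > 0" using assms by auto
  have "x = x powr (1 - r) * x powr r" using x by (simp add: powr_add[symmetric])
  also have "\<dots> \<le> L powr (1 - r) * x powr r"
    using False assms by (intro mult_right_mono powr_mono2') auto
  finally show ?thesis using False assms by (simp add: min_def)
qed (use assms in simp)

context crossfit_event
begin

text \<open>With only r > 1 moments there may be no variance, so the variables are truncated at a
  slowly growing level: the truncated part is handled by Chebyshev, the excess by its mean.\<close>

lemma lln:
  assumes k: "k < K" and r: "r > 1"
    and meas[measurable]: "\<And>n. \<xi> n \<in> borel_measurable (P n)" and nonneg: "\<And>n w. \<xi> n w \<ge> 0"
    and int: "\<And>n. integrable (P n) (\<xi> n)"
    and intr: "\<And>n. integrable (P n) (\<lambda>w. \<xi> n w powr r)" "\<And>n. (\<integral>w. \<xi> n w powr r \<partial>P n) \<le> B"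
  shows "((\<lambda>x. AV k (\<lambda>n I \<omega>. \<xi> n) x - (\<integral>w. \<xi> (fst x) w \<partial>P (fst x))) \<longlongrightarrow> 0) W"
proof -
  \<comment> \<open>Any growth slower than sqrt n would do: growth makes the mean excess, of order
    \<open>L n powr (1 - r)\<close>, vanish, and slowness makes the fluctuation, of order L n / sqrt
    n, vanish.\<close>
  define L where "L n = real (Suc n) powr (1/4)" for n
  have L: "L n > 0" for n by (simp add: L_def)
  define \<mu> where "\<mu> n = (\<integral>w. min (\<xi> n w) (L n) \<partial>P n)" for n
  define F where "F n w = min (\<xi> n w) (L n) - \<mu> n" for n w
  define H where "H n w = \<xi> n w - min (\<xi> n w) (L n)" for n w
  have Fm[measurable]: "F n \<in> borel_measurable (P n)" and Hm[measurable]: "H n \<in> borel_measurable (P n)" for n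
    unfolding F_def H_def by measurable
  have intmin: "integrable (P n) (\<lambda>w. min (\<xi> n w) (L n))" for n
    by (rule Bochner_Integration.integrable_bound[OF int]) (use nonneg L[of n] in \<open>auto simp: min_def\<close>)
  have intH: "integrable (P n) (H n)" for n unfolding H_def using int intmin by auto
  have H0: "H n w \<ge> 0" for n w by (simp add: H_def)
  define b where "b n = B * L n powr (1 - r)" for n
  have B: "B \<ge> 0" using intr(2)[of 0] by (intro order_trans[OF integral_nonneg_AE]) auto
  have EH: "(\<integral>w. H n w \<partial>P n) \<le> b n" for n
  proof -
    have "(\<integral>w. H n w \<partial>P n) \<le> (\<integral>w. L n powr (1 - r) * \<xi> n w powr r \<partial>P n)"
      using intr(1) truncation_error_le[OF nonneg L r] by (intro integral_mono[OF intH]) (auto simp: H_def)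
    also have "\<dots> = L n powr (1 - r) * (\<integral>w. \<xi> n w powr r \<partial>P n)" by simp
    also have "\<dots> \<le> L n powr (1 - r) * B" by (intro mult_left_mono intr) auto
    finally show ?thesis by (simp add: b_def mult.commute)
  qed
  have b: "b n \<ge> 0" "b \<longlonglongrightarrow> 0" for n
  proof -
    show "b n \<ge> 0" using B by (simp add: b_def)
    have "filterlim L at_top sequentially"
      unfolding L_def by (intro filterlim_compose[OF real_powr_at_top] filterlim_compose[OF filterlim_real_sequentially] filterlim_Suc) simp
    then have "b \<longlonglongrightarrow> B * 0" unfolding b_def using r by (intro tendsto_intros tendsto_neg_powr) auto
    then show "b \<longlonglongrightarrow> 0" by simp
  qed
  have 1: "(AV k (\<lambda>n I \<omega>. H n) \<longlongrightarrow> 0) W"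
  proof (rule AV_tendsto_0[OF k cross_const _ b(1) b])
    fix n :: nat
    have "(\<integral>\<^sup>+w. ennreal \<bar>H n w\<bar> \<partial>P n) = ennreal (\<integral>w. H n w \<partial>P n)"
      using H0 by (simp add: nn_integral_eq_integral[OF intH])
    then show "(\<integral>\<^sup>+w. ennreal \<bar>H n w\<bar> \<partial>P n) \<le> ennreal (b n)" using EH[of n] by (simp add: ennreal_leI)
  qed simp
  have 2: "(AV k (\<lambda>n I \<omega>. F n) \<longlongrightarrow> 0) W"
  proof -
    \<comment> \<open>After division by L n the centred truncated variable lies in [-1, 1], so a
      constant second-moment bound applies.\<close>
    have "Op (\<lambda>x. rN x * AV k (\<lambda>n I \<omega> w. F n w / L n) x)"
    proof (rule rN_AV_Op[OF k cross_const, where b=1])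
      fix n :: nat
      interpret prob_space "P n" by (rule prob_space_P)
      show "(\<integral>w. F n w / L n \<partial>P n) = 0"
        using intmin by (simp add: F_def \<mu>_def prob_space)
      have \<mu>: "0 \<le> \<mu> n" "\<mu> n \<le> L n"
        unfolding \<mu>_def using nonneg L[of n] intmin
        by (auto intro!: integral_nonneg_AE integral_le_const)
      have "(\<integral>\<^sup>+w. ennreal ((F n w / L n)\<^sup>2) \<partial>P n) \<le> (\<integral>\<^sup>+w. ennreal 1 \<partial>P n)"
      proof (intro nn_integral_mono ennreal_leI)
        fix w
        have "\<bar>F n w\<bar> \<le> L n" using \<mu> nonneg[of n w] L[of n] by (auto simp: F_def min_def abs_if)
        then show "(F n w / L n)\<^sup>2 \<le> 1" using L[of n] by (simp add: abs_square_le_1)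
      qed
      then show "(\<integral>\<^sup>+w. ennreal ((F n w / L n)\<^sup>2) \<partial>P n) \<le> ennreal 1" by (simp add: emeasure_space_1)
    qed simp_all
    moreover have "((\<lambda>x. L (fst x) / rN x) \<longlongrightarrow> 0) W"
    proof -
      have "(\<lambda>n. L n / sqrt (real (K * n))) \<longlonglongrightarrow> 0"
        unfolding L_def using K_pos by real_asymp
      from tendsto_whp_fst[OF this] show ?thesis by (simp add: rN_def case_prod_unfold)
    qed
    ultimately have "((\<lambda>x. rN x * AV k (\<lambda>n I \<omega> w. F n w / L n) x * (L (fst x) / rN x)) \<longlongrightarrow> 0) W"
      by (rule Op_mult_tendsto)
    then show ?thesis
      by (rule tendsto_W_cong) (use K_pos L in \<open>simp add: AV_def En_def rN_def sum_divide_distrib[symmetric] less_imp_neq[symmetric]\<close>)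
  qed
  have 3: "((\<lambda>x. \<integral>w. H (fst x) w \<partial>P (fst x)) \<longlongrightarrow> 0) W"
  proof -
    have "(\<lambda>n. \<integral>w. H n w \<partial>P n) \<longlonglongrightarrow> 0"
      by (rule Lim_null_comparison[OF _ b(2)]) (use EH H0 in \<open>auto simp: integral_nonneg_AE\<close>)
    from tendsto_whp_fst[OF this] show ?thesis by (simp add: case_prod_unfold)
  qed
  have "((\<lambda>x. AV k (\<lambda>n I \<omega>. F n) x + AV k (\<lambda>n I \<omega>. H n) x - (\<integral>w. H (fst x) w \<partial>P (fst x))) \<longlongrightarrow> 0 + 0 - 0) W"
    by (intro tendsto_intros 1 2 3)
  then have "((\<lambda>x. AV k (\<lambda>n I \<omega>. F n) x + AV k (\<lambda>n I \<omega>. H n) x - (\<integral>w. H (fst x) w \<partial>P (fst x))) \<longlongrightarrow> 0) W"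
    by simp
  then show ?thesis
  proof (rule tendsto_W_cong)
    fix n \<omega> f assume n: "n > 0" "f \<in> partitions K n"
    have "AV k (\<lambda>n I \<omega>. F n) (n, \<omega>, f) = AV k (\<lambda>n I \<omega> w. min (\<xi> n w) (L n)) (n, \<omega>, f) - \<mu> n"
      unfolding F_def by (rule AV_centered[OF n k])
    moreover have "AV k (\<lambda>n I \<omega>. H n) (n, \<omega>, f) = AV k (\<lambda>n I \<omega>. \<xi> n) (n, \<omega>, f) - AV k (\<lambda>n I \<omega> w. min (\<xi> n w) (L n)) (n, \<omega>, f)"
      unfolding H_def by (rule AV_diff)
    moreover have "(\<integral>w. H n w \<partial>P n) = (\<integral>w. \<xi> n w \<partial>P n) - \<mu> n"
      unfolding H_def \<mu>_def using int intmin by simp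
    ultimately show "AV k (\<lambda>n I \<omega>. \<xi> n) (n, \<omega>, f) - (\<integral>w. \<xi> (fst (n, \<omega>, f)) w \<partial>P (fst (n, \<omega>, f)))
      = AV k (\<lambda>n I \<omega>. F n) (n, \<omega>, f) + AV k (\<lambda>n I \<omega>. H n) (n, \<omega>, f) - (\<integral>w. H (fst (n, \<omega>, f)) w \<partial>P (fst (n, \<omega>, f)))"
      by simp
  qed
qed

end

text \<open>What the two scores have in common: U, V, D are the ideal residuals and regressor, h, m,
  s the errors of the fitted nuisances, d the rate and p the moment order of UV. \<open>hm1\<close>
  is the product rate for the estimator; \<open>hm2\<close> is the separate smallness that the
  variance estimator requires.\<close>

locale crossfit = crossfit_event P K Good dl
  for P :: "nat \<Rightarrow> 'x obs measure" and K Good dl +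
  fixes U V D :: "nat \<Rightarrow> 'x obs \<Rightarrow> real"
    and h m s :: "nat \<Rightarrow> nat set \<Rightarrow> (nat \<Rightarrow> 'x obs) \<Rightarrow> 'x obs \<Rightarrow> real"
    and d :: "nat \<Rightarrow> real" and B c p :: real
  assumes meas[measurable]: "U n \<in> borel_measurable (P n)" "V n \<in> borel_measurable (P n)" "D n \<in> borel_measurable (P n)"
    and cross_nuis: "I \<subseteq> {..<K*n} \<Longrightarrow> cross n I (h n I)" "I \<subseteq> {..<K*n} \<Longrightarrow> cross n I (m n I)"
      "I \<subseteq> {..<K*n} \<Longrightarrow> cross n I (s n I)"
    and d: "d n \<ge> 0" "d \<longlonglongrightarrow> 0" and B: "B \<ge> 0" and c: "c > 0" and p: "p > 2"
    and orth: "\<omega> \<in> Good n I \<Longrightarrow> (\<integral>w. U n w * m n I \<omega> w \<partial>P n) = 0"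
      "\<omega> \<in> Good n I \<Longrightarrow> (\<integral>w. V n w * h n I \<omega> w \<partial>P n) = 0"
    and Um: "\<omega> \<in> Good n I \<Longrightarrow> (\<integral>\<^sup>+w. ennreal ((U n w * m n I \<omega> w)\<^sup>2) \<partial>P n) \<le> ennreal (d n)"
    and Vh: "\<omega> \<in> Good n I \<Longrightarrow> (\<integral>\<^sup>+w. ennreal ((V n w * h n I \<omega> w)\<^sup>2) \<partial>P n) \<le> ennreal (d n)"
    and hm1: "\<omega> \<in> Good n I \<Longrightarrow> (\<integral>\<^sup>+w. ennreal \<bar>h n I \<omega> w * m n I \<omega> w\<bar> \<partial>P n) \<le> ennreal (d n / sqrt (real (K*n)))"
    and hm2: "\<omega> \<in> Good n I \<Longrightarrow> (\<integral>\<^sup>+w. ennreal ((h n I \<omega> w * m n I \<omega> w)\<^sup>2) \<partial>P n) \<le> ennreal (d n)"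
    and mm: "\<omega> \<in> Good n I \<Longrightarrow> (\<integral>\<^sup>+w. ennreal ((m n I \<omega> w)\<^sup>2) \<partial>P n) \<le> ennreal (d n)"
    and ss: "\<omega> \<in> Good n I \<Longrightarrow> (\<integral>\<^sup>+w. ennreal ((s n I \<omega> w)\<^sup>2) \<partial>P n) \<le> ennreal (d n)"
    and aa: "\<omega> \<in> Good n I \<Longrightarrow> (\<integral>\<^sup>+w. ennreal (((D n w - s n I \<omega> w) * (V n w - m n I \<omega> w))\<^sup>2) \<partial>P n) \<le> ennreal B"
    and DD: "(\<integral>\<^sup>+w. ennreal ((D n w)\<^sup>2) \<partial>P n) \<le> ennreal B"
    and VV: "(\<integral>\<^sup>+w. ennreal ((V n w)\<^sup>2) \<partial>P n) \<le> ennreal B"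
    and DDVV: "(\<integral>\<^sup>+w. ennreal ((D n w * V n w)\<^sup>2) \<partial>P n) \<le> ennreal B"
    and UV0: "(\<integral>w. U n w * V n w \<partial>P n) = 0"
    and UVp: "integrable (P n) (\<lambda>w. \<bar>U n w * V n w\<bar> powr p)" "(\<integral>w. \<bar>U n w * V n w\<bar> powr p \<partial>P n) \<le> B"
    and UV2: "integrable (P n) (\<lambda>w. (U n w * V n w)\<^sup>2)" "(\<integral>w. (U n w * V n w)\<^sup>2 \<partial>P n) \<ge> c"
    and DV: "\<bar>\<integral>w. D n w * V n w \<partial>P n\<bar> \<ge> c"
begin

text \<open>The Jacobian of the score is -a and e is the score variance, so e / a^2 is \<sigma>^2.
  Both may vary along the sequence, so later statements are about ratios to them.\<close>

definition a :: "nat \<Rightarrow> real" where "a n = (\<integral>w. D n w * V n w \<partial>P n)"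
definition e :: "nat \<Rightarrow> real" where "e n = (\<integral>w. (U n w * V n w)\<^sup>2 \<partial>P n)"

text \<open>\<open>PA\<close> is the slope of the estimated score and \<open>PB\<close> its value at
  \<theta>0, so the score at \<theta> equals \<open>PA\<close> times (\<theta> - \<theta>0) plus
  \<open>PB\<close>. \<open>UV\<close> is the limit of \<open>PB\<close> when the nuisances are
  known.\<close>

definition PA :: "nat \<Rightarrow> nat set \<Rightarrow> (nat \<Rightarrow> 'x obs) \<Rightarrow> 'x obs \<Rightarrow> real" where
  "PA n I \<omega> w = - (D n w - s n I \<omega> w) * (V n w - m n I \<omega> w)"
definition PB :: "nat \<Rightarrow> nat set \<Rightarrow> (nat \<Rightarrow> 'x obs) \<Rightarrow> 'x obs \<Rightarrow> real" where
  "PB n I \<omega> w = (U n w - h n I \<omega> w) * (V n w - m n I \<omega> w)"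
definition UV :: "nat \<Rightarrow> nat set \<Rightarrow> (nat \<Rightarrow> 'x obs) \<Rightarrow> 'x obs \<Rightarrow> real" where
  "UV n I \<omega> w = U n w * V n w"

lemma a_ge: "\<bar>a n\<bar> \<ge> c" and a_nz: "a n \<noteq> 0" and e_ge: "e n \<ge> c" and e_pos: "e n > 0"
  using DV[of n] UV2(2)[of n] c by (auto simp: a_def e_def)

lemmas cross_intros = cross_add cross_diff cross_mult cross_power cross_nuis cross_const[OF meas(1)] cross_const[OF meas(2)] cross_const[OF meas(3)]

lemma Op_inverse_a: "Op (\<lambda>x. 1 / a (fst x))"
proof -
  have "\<bar>1 / a n\<bar> \<le> 1 / c" for n using a_ge[of n] c by (simp add: frac_le)
  from Op_bounded_seq[of "\<lambda>n. 1 / a n", OF this] show ?thesis by (simp add: case_prod_unfold)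
qed

lemma Op_inverse_e: "Op (\<lambda>x. 1 / e (fst x))"
proof -
  have "\<bar>1 / e n\<bar> \<le> 1 / c" for n using e_ge[of n] c by (simp add: frac_le)
  from Op_bounded_seq[of "\<lambda>n. 1 / e n", OF this] show ?thesis by (simp add: case_prod_unfold)
qed

lemma AV_mm: "k < K \<Longrightarrow> (AV k (\<lambda>n I \<omega> w. (m n I \<omega> w)\<^sup>2) \<longlongrightarrow> 0) W"
  by (rule AV_tendsto_0[where b=d]) (auto intro!: cross_intros d simp: mm)

lemma AV_ss: "k < K \<Longrightarrow> (AV k (\<lambda>n I \<omega> w. (s n I \<omega> w)\<^sup>2) \<longlongrightarrow> 0) W"
  by (rule AV_tendsto_0[where b=d]) (auto intro!: cross_intros d simp: ss)

lemma AV_DD: "k < K \<Longrightarrow> Op (AV k (\<lambda>n I \<omega> w. (D n w)\<^sup>2))"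
  by (rule AV_Op[where b=B]) (auto intro!: cross_intros B simp: DD)

lemma AV_VV: "k < K \<Longrightarrow> Op (AV k (\<lambda>n I \<omega> w. (V n w)\<^sup>2))"
  by (rule AV_Op[where b=B]) (auto intro!: cross_intros B simp: VV)

lemma cross_PA: "I \<subseteq> {..<K*n} \<Longrightarrow> cross n I (PA n I)"
proof -
  assume I: "I \<subseteq> {..<K*n}"
  have "cross n I (\<lambda>\<omega> w. (s n I \<omega> w - D n w) * (V n w - m n I \<omega> w))"
    by (intro cross_intros I)
  then show ?thesis by (simp add: PA_def[abs_def])
qed

lemma cross_PB: "I \<subseteq> {..<K*n} \<Longrightarrow> cross n I (PB n I)"
  unfolding PB_def[abs_def] by (intro cross_intros)

lemma Op_PA2: "k < K \<Longrightarrow> Op (AV k (\<lambda>n I \<omega> w. (PA n I \<omega> w)\<^sup>2))"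
proof (rule AV_Op[where b=B])
  show "(\<integral>\<^sup>+w. ennreal \<bar>(PA n I \<omega> w)\<^sup>2\<bar> \<partial>P n) \<le> ennreal B" if "\<omega> \<in> Good n I" for n I \<omega>
    using aa[OF that] by (simp add: PA_def power_mult_distrib power2_commute)
qed (auto intro!: cross_power cross_PA B)

text \<open>A non-integrable function has Bochner integral 0, which the lower bound on |a| rules
  out.\<close>

lemma int_DV: "integrable (P n) (\<lambda>w. D n w * V n w)"
proof (rule ccontr)
  assume "\<not> ?thesis"
  then have "a n = 0" by (simp add: a_def not_integrable_integral_eq)
  with a_nz show False by simp
qed

lemma int_DV2: "integrable (P n) (\<lambda>w. (D n w * V n w)\<^sup>2)"
  by (rule integrableI_nonneg) (use DDVV[of n] in \<open>auto intro: le_less_trans\<close>)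

lemma DV2_le: "(\<integral>w. (D n w * V n w)\<^sup>2 \<partial>P n) \<le> B"
  using DDVV[of n] nn_integral_eq_integral[OF int_DV2] B by simp

lemma DV_lln: "k < K \<Longrightarrow> ((\<lambda>x. AV k (\<lambda>n I \<omega> w. D n w * V n w - a n) x) \<longlongrightarrow> 0) W"
proof -
  assume k: "k < K"
  let ?F = "\<lambda>n w. D n w * V n w - a n"
  have "Op (\<lambda>x. rN x * AV k (\<lambda>n I \<omega>. ?F n) x)"
  proof (rule rN_AV_Op[OF k cross_const, where b=B])
    fix n :: nat
    interpret prob_space "P n" by (rule prob_space_P)
    show "(\<integral>w. ?F n w \<partial>P n) = 0"
      using int_DV by (simp add: a_def prob_space)
    have "(\<integral>w. (?F n w)\<^sup>2 \<partial>P n) = (\<integral>w. (D n w * V n w)\<^sup>2 \<partial>P n) - (a n)\<^sup>2"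
      unfolding a_def by (rule variance_eq[OF int_DV int_DV2])
    also have "\<dots> \<le> (\<integral>w. (D n w * V n w)\<^sup>2 \<partial>P n)" by simp
    also have "\<dots> \<le> B" by (rule DV2_le)
    finally have le: "(\<integral>w. (?F n w)\<^sup>2 \<partial>P n) \<le> B" .
    have "integrable (P n) (\<lambda>w. (?F n w)\<^sup>2)"
      using int_DV2 int_DV by (simp add: power2_diff)
    from nn_integral_eq_integral[OF this] le
    show "(\<integral>\<^sup>+w. ennreal ((?F n w)\<^sup>2) \<partial>P n) \<le> ennreal B" by (simp add: ennreal_leI)
  qed (use B in auto)
  from rN_cancel[OF Op_mult_tendsto[OF this inverse_rN]] show ?thesis .
qed

text \<open>Expanding the slope, every term except DV contains an estimation error and vanishes by
  Cauchy-Schwarz. The ratio is taken because a n need not converge; it is only bounded away from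
  0.\<close>

lemma J_lim: "k < K \<Longrightarrow> ((\<lambda>x. AV k PA x / a (fst x)) \<longlongrightarrow> - 1) W"
proof -
  assume k: "k < K"
  have 1: "(AV k (\<lambda>n I \<omega> w. D n w * m n I \<omega> w) \<longlongrightarrow> 0) W"
    by (rule AV_mult_tendsto_0[OF AV_DD[OF k] AV_mm[OF k]])
  have 2: "(AV k (\<lambda>n I \<omega> w. V n w * s n I \<omega> w) \<longlongrightarrow> 0) W"
    by (rule AV_mult_tendsto_0[OF AV_VV[OF k] AV_ss[OF k]])
  have 3: "(AV k (\<lambda>n I \<omega> w. m n I \<omega> w * s n I \<omega> w) \<longlongrightarrow> 0) W"
    by (rule AV_mult_tendsto_0[OF Op_tendsto[OF AV_mm[OF k]] AV_ss[OF k]])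
  have eq: "PA = (\<lambda>n I \<omega> w. D n w * m n I \<omega> w + V n w * s n I \<omega> w - m n I \<omega> w * s n I \<omega> w - D n w * V n w)"
    by (intro ext) (simp add: PA_def algebra_simps)
  have "((\<lambda>x. 1 / a (fst x) * (AV k (\<lambda>n I \<omega> w. D n w * m n I \<omega> w) x + AV k (\<lambda>n I \<omega> w. V n w * s n I \<omega> w) x
     - AV k (\<lambda>n I \<omega> w. m n I \<omega> w * s n I \<omega> w) x - AV k (\<lambda>n I \<omega> w. D n w * V n w - a n) x)) \<longlongrightarrow> 0) W"
    by (intro Op_mult_tendsto Op_inverse_a) (use tendsto_diff[OF tendsto_diff[OF tendsto_add[OF 1 2] 3] DV_lln[OF k]] in simp)
  then have "((\<lambda>x. 1 / a (fst x) * (AV k (\<lambda>n I \<omega> w. D n w * m n I \<omega> w) x + AV k (\<lambda>n I \<omega> w. V n w * s n I \<omega> w) x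
     - AV k (\<lambda>n I \<omega> w. m n I \<omega> w * s n I \<omega> w) x - AV k (\<lambda>n I \<omega> w. D n w * V n w - a n) x) - 1) \<longlongrightarrow> 0 - 1) W"
    by (intro tendsto_intros)
  then have "((\<lambda>x. AV k PA x / a (fst x)) \<longlongrightarrow> 0 - 1) W"
  proof (rule tendsto_W_cong)
    fix n \<omega> f assume n: "n > 0" "f \<in> partitions K n"
    show "AV k PA (n, \<omega>, f) / a (fst (n, \<omega>, f)) =
       1 / a (fst (n, \<omega>, f)) * (AV k (\<lambda>n I \<omega> w. D n w * m n I \<omega> w) (n, \<omega>, f) + AV k (\<lambda>n I \<omega> w. V n w * s n I \<omega> w) (n, \<omega>, f)
     - AV k (\<lambda>n I \<omega> w. m n I \<omega> w * s n I \<omega> w) (n, \<omega>, f) - AV k (\<lambda>n I \<omega> w. D n w * V n w - a n) (n, \<omega>, f)) - 1"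
      unfolding AV_centered[OF n k, of "\<lambda>n I \<omega> w. D n w * V n w" a]
      using a_nz[of n] by (simp add: eq AV_diff AV_add field_simps)
  qed
  then show ?thesis by simp
qed

lemma S_lim: "k < K \<Longrightarrow> ((\<lambda>x. rN x * (AV k PB x - AV k UV x)) \<longlongrightarrow> 0) W"
proof -
  assume k: "k < K"
  have 1: "((\<lambda>x. rN x * AV k (\<lambda>n I \<omega> w. U n w * m n I \<omega> w) x) \<longlongrightarrow> 0) W"
    by (rule rN_AV_tendsto_0[OF k, where b=d]) (auto intro!: cross_intros d simp: orth Um)
  have 2: "((\<lambda>x. rN x * AV k (\<lambda>n I \<omega> w. V n w * h n I \<omega> w) x) \<longlongrightarrow> 0) W"
    by (rule rN_AV_tendsto_0[OF k, where b=d]) (auto intro!: cross_intros d simp: orth Vh)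
  have 3: "((\<lambda>x. rN x * AV k (\<lambda>n I \<omega> w. h n I \<omega> w * m n I \<omega> w) x) \<longlongrightarrow> 0) W"
  proof -
    \<comment> \<open>This product is not centred, so no orthogonality is available; its absolute
      mean is already of order d / sqrt N, and the root is absorbed into the integrand.\<close>
    have "(AV k (\<lambda>n I \<omega> w. sqrt (real (K*n)) * (h n I \<omega> w * m n I \<omega> w)) \<longlongrightarrow> 0) W"
    proof (rule AV_tendsto_0[OF k, where b=d])
      fix n I assume I: "I \<subseteq> {..<K*n}"
      show "cross n I (\<lambda>\<omega> w. sqrt (real (K*n)) * (h n I \<omega> w * m n I \<omega> w))"
        by (intro cross_intros I cross_mult[OF cross_const]) simp
      fix \<omega> assume g: "\<omega> \<in> Good n I"
      have \<omega>: "\<omega> \<in> space (\<Omega> n)" using sets.sets_into_space[OF Good_sets] g by auto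
      note [measurable] = cross_section[OF cross_nuis(1)[OF I] \<omega>] cross_section[OF cross_nuis(2)[OF I] \<omega>]
      have "(\<integral>\<^sup>+w. ennreal \<bar>sqrt (real (K*n)) * (h n I \<omega> w * m n I \<omega> w)\<bar> \<partial>P n)
        = (\<integral>\<^sup>+w. ennreal (sqrt (real (K*n))) * ennreal \<bar>h n I \<omega> w * m n I \<omega> w\<bar> \<partial>P n)"
        by (intro nn_integral_cong) (simp add: abs_mult ennreal_mult)
      also have "\<dots> = ennreal (sqrt (real (K*n))) * (\<integral>\<^sup>+w. ennreal \<bar>h n I \<omega> w * m n I \<omega> w\<bar> \<partial>P n)"
        by (rule nn_integral_cmult) measurable
      also have "\<dots> \<le> ennreal (sqrt (real (K*n))) * ennreal (d n / sqrt (real (K*n)))"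
        by (intro mult_left_mono hm1[OF g]) simp
      also have "\<dots> = ennreal (sqrt (real (K*n)) * (d n / sqrt (real (K*n))))"
        using d(1)[of n] by (intro ennreal_mult[symmetric]) auto
      also have "\<dots> \<le> ennreal (d n)" using d(1)[of n] by (intro ennreal_leI) auto
      finally show "(\<integral>\<^sup>+w. ennreal \<bar>sqrt (real (K*n)) * (h n I \<omega> w * m n I \<omega> w)\<bar> \<partial>P n) \<le> ennreal (d n)" .
    qed (use d in auto)
    then show ?thesis
      by (rule tendsto_W_cong) (simp add: AV_def En_def rN_def sum_distrib_left)
  qed
  have eq: "PB = (\<lambda>n I \<omega> w. U n w * V n w - U n w * m n I \<omega> w - V n w * h n I \<omega> w + h n I \<omega> w * m n I \<omega> w)"
    by (intro ext) (simp add: PB_def algebra_simps)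
  have "((\<lambda>x. rN x * AV k (\<lambda>n I \<omega> w. h n I \<omega> w * m n I \<omega> w) x - rN x * AV k (\<lambda>n I \<omega> w. U n w * m n I \<omega> w) x
     - rN x * AV k (\<lambda>n I \<omega> w. V n w * h n I \<omega> w) x) \<longlongrightarrow> 0 - 0 - 0) W"
    by (intro tendsto_diff 1 2 3)
  then show ?thesis
    unfolding eq AV_diff AV_add UV_def[abs_def] by (simp add: algebra_simps)
qed

lemma UV2_le: "(\<integral>\<^sup>+w. ennreal ((UV n I \<omega> w)\<^sup>2) \<partial>P n) \<le> ennreal (1 + B)"
proof -
  interpret prob_space "P n" by (rule prob_space_P)
  have "(\<integral>\<^sup>+w. ennreal ((U n w * V n w)\<^sup>2) \<partial>P n) = ennreal (\<integral>w. (U n w * V n w)\<^sup>2 \<partial>P n)"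
    by (rule nn_integral_eq_integral[OF UV2(1)]) simp
  also have "(\<integral>w. (U n w * V n w)\<^sup>2 \<partial>P n) \<le> (\<integral>w. 1 + \<bar>U n w * V n w\<bar> powr p \<partial>P n)"
  proof (rule integral_mono[OF UV2(1)])
    show "integrable (P n) (\<lambda>w. 1 + \<bar>U n w * V n w\<bar> powr p)" using UVp(1) by simp
    have "x\<^sup>2 \<le> 1 + \<bar>x\<bar> powr p" for x :: real
    proof (cases "\<bar>x\<bar> \<le> 1")
      case True
      then have "x\<^sup>2 \<le> 1" by (simp add: abs_square_le_1)
      then show ?thesis by (simp add: add_increasing2)
    next
      case False
      then have "\<bar>x\<bar> powr 2 \<le> \<bar>x\<bar> powr p" using p by (intro powr_mono) auto
      moreover have "\<bar>x\<bar> powr 2 = x\<^sup>2" using False by simp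
      ultimately show ?thesis by simp
    qed
    then show "(U n w * V n w)\<^sup>2 \<le> 1 + \<bar>U n w * V n w\<bar> powr p" for w .
  qed
  also have "\<dots> = 1 + (\<integral>w. \<bar>U n w * V n w\<bar> powr p \<partial>P n)" using UVp(1) by (simp add: prob_space)
  also have "\<dots> \<le> 1 + B" using UVp(2) by simp
  finally show ?thesis by (simp add: UV_def ennreal_leI)
qed

lemma UV_Op: "k < K \<Longrightarrow> Op (\<lambda>x. rN x * AV k UV x)"
  by (rule rN_AV_Op[where b="1 + B"])
     (use B in \<open>auto simp: UV_def[abs_def] UV0 simp del: ennreal_plus intro!: cross_intros UV2_le[unfolded UV_def]\<close>)

lemma UV2_Op: "k < K \<Longrightarrow> Op (AV k (\<lambda>n I \<omega> w. (UV n I \<omega> w)\<^sup>2))"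
  by (rule AV_Op[where b="1 + B"])
     (use B in \<open>auto simp: UV_def[abs_def] simp del: ennreal_plus intro!: cross_intros UV2_le[unfolded UV_def]\<close>)

text \<open>The truncated law of large numbers is applied with r = p/2, which exceeds 1 exactly
  because p > 2.\<close>

lemma UV2_lim: "k < K \<Longrightarrow> ((\<lambda>x. AV k (\<lambda>n I \<omega> w. (UV n I \<omega> w)\<^sup>2) x / e (fst x)) \<longlongrightarrow> 1) W"
proof -
  assume k: "k < K"
  have pow: "(x\<^sup>2) powr (p / 2) = \<bar>x\<bar> powr p" for x :: real
  proof (cases "x = 0")
    case False
    then have "x\<^sup>2 = \<bar>x\<bar> powr 2" by simp
    then show ?thesis by (simp only: powr_powr) simp
  qed (use p in simp)
  have "((\<lambda>x. AV k (\<lambda>n I \<omega> w. (U n w * V n w)\<^sup>2) x - (\<integral>w. (U (fst x) w * V (fst x) w)\<^sup>2 \<partial>P (fst x))) \<longlongrightarrow> 0) W"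
    by (rule lln[OF k, where r="p / 2" and B=B]) (use p UV2 UVp in \<open>auto simp: pow\<close>)
  from Op_mult_tendsto[OF Op_inverse_e this]
  have "((\<lambda>x. 1 + 1 / e (fst x) * (AV k (\<lambda>n I \<omega> w. (U n w * V n w)\<^sup>2) x - e (fst x))) \<longlongrightarrow> 1 + 0) W"
    by (intro tendsto_add tendsto_const) (simp add: e_def)
  moreover have "1 + 1 / e n * (y - e n) = y / e n" for y n using e_pos[of n] by (simp add: field_simps)
  ultimately show ?thesis by (simp add: UV_def)
qed

text \<open>Consistency of the variance estimator needs the estimated and ideal scores to be close
  in mean square. The cross product h m must therefore be small in L2, which its product rate in L1
  does not provide.\<close>

lemma PB_UV_lim: "k < K \<Longrightarrow> (AV k (\<lambda>n I \<omega> w. (PB n I \<omega> w - UV n I \<omega> w)\<^sup>2) \<longlongrightarrow> 0) W"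
proof -
  assume k: "k < K"
  have 1: "(AV k (\<lambda>n I \<omega> w. (U n w * m n I \<omega> w)\<^sup>2) \<longlongrightarrow> 0) W"
    by (rule AV_tendsto_0[OF k, where b=d]) (auto intro!: cross_intros d simp: Um)
  have 2: "(AV k (\<lambda>n I \<omega> w. (V n w * h n I \<omega> w)\<^sup>2) \<longlongrightarrow> 0) W"
    by (rule AV_tendsto_0[OF k, where b=d]) (auto intro!: cross_intros d simp: Vh)
  have 3: "(AV k (\<lambda>n I \<omega> w. (h n I \<omega> w * m n I \<omega> w)\<^sup>2) \<longlongrightarrow> 0) W"
    by (rule AV_tendsto_0[OF k, where b=d]) (auto intro!: cross_intros d simp: hm2)
  let ?R = "\<lambda>x. 3 * (AV k (\<lambda>n I \<omega> w. (U n w * m n I \<omega> w)\<^sup>2) x + AV k (\<lambda>n I \<omega> w. (V n w * h n I \<omega> w)\<^sup>2) x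
     + AV k (\<lambda>n I \<omega> w. (h n I \<omega> w * m n I \<omega> w)\<^sup>2) x)"
  have "(?R \<longlongrightarrow> 3 * (0 + 0 + 0)) W" by (intro tendsto_intros 1 2 3)
  then have "(?R \<longlongrightarrow> 0) W" by simp
  then show ?thesis
  proof (rule tendsto_0_abs_bound)
    fix n z
    have *: "(- x - y + t)\<^sup>2 \<le> 3 * (x\<^sup>2 + y\<^sup>2 + t\<^sup>2)" for x y t :: real
    proof -
      have "0 \<le> (x - y)\<^sup>2 + (x + t)\<^sup>2 + (y + t)\<^sup>2" by simp
      then show ?thesis by (simp add: power2_eq_square algebra_simps)
    qed
    have "PB n I \<omega> w - UV n I \<omega> w = - (U n w * m n I \<omega> w) - V n w * h n I \<omega> w + h n I \<omega> w * m n I \<omega> w" for n I \<omega> w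
      by (simp add: PB_def UV_def algebra_simps)
    then have "AV k (\<lambda>n I \<omega> w. (PB n I \<omega> w - UV n I \<omega> w)\<^sup>2) (n, z) \<le>
      AV k (\<lambda>n I \<omega> w. 3 * ((U n w * m n I \<omega> w)\<^sup>2 + (V n w * h n I \<omega> w)\<^sup>2 + (h n I \<omega> w * m n I \<omega> w)\<^sup>2)) (n, z)"
      by (intro AV_mono) (simp only: *)
    also have "\<dots> = ?R (n, z)" by (simp only: AV_cmult AV_add)
    finally show "\<bar>AV k (\<lambda>n I \<omega> w. (PB n I \<omega> w - UV n I \<omega> w)\<^sup>2) (n, z)\<bar> \<le> \<bar>?R (n, z)\<bar>"
      using AV_nonneg[of "\<lambda>n I \<omega> w. (PB n I \<omega> w - UV n I \<omega> w)\<^sup>2" k "(n, z)"] by simp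
  qed
qed

section \<open>Linear expansion of the estimators and studentization\<close>

definition avg :: "(nat \<Rightarrow> nat \<times> (nat \<Rightarrow> 'x obs) \<times> (nat \<Rightarrow> nat) \<Rightarrow> real) \<Rightarrow> nat \<times> (nat \<Rightarrow> 'x obs) \<times> (nat \<Rightarrow> nat) \<Rightarrow> real" where
  "avg X x = (\<Sum>k<K. X k x) / K"

lemma avg_tendsto:
  assumes "\<And>k. k < K \<Longrightarrow> (X k \<longlongrightarrow> l) W"
  shows "(avg X \<longlongrightarrow> l) W"
proof -
  have "((\<lambda>x. (\<Sum>k<K. X k x) / K) \<longlongrightarrow> (\<Sum>k<K. l) / K) W"
    using assms K_pos by (intro tendsto_intros) auto
  then show ?thesis using K_pos by (simp add: avg_def[abs_def])
qed

lemma avg_Op: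
  assumes "\<And>k. k < K \<Longrightarrow> Op (X k)"
  shows "Op (avg X)"
proof -
  have "Op (\<lambda>x. (\<Sum>k<K. X k x) * (1 / K))"
    by (intro Op_mult Op_const Op_sum assms) auto
  then show ?thesis by (simp add: avg_def[abs_def])
qed

text \<open>Solving J \<tau> + S = o(1 / sqrt N) with J close to -a and S close to A gives \<tau>
  close to A / a. The lemma is used fold by fold for DML1 and once with averaged J and S for DML2,
  so both acquire the same leading term.\<close>

lemma estimator_expansion:
  assumes J: "((\<lambda>x. J x / a (fst x)) \<longlongrightarrow> - 1) W"
    and SA: "((\<lambda>x. rN x * (S x - A x)) \<longlongrightarrow> 0) W" and A: "Op (\<lambda>x. rN x * A x)"
    and solve: "\<And>n \<omega> f. n > 0 \<Longrightarrow> \<omega> \<in> space (\<Omega> n) \<Longrightarrow> f \<in> partitions K n \<Longrightarrow> J (n, \<omega>, f) \<noteq> 0 \<Longrightarrow>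
      \<bar>J (n, \<omega>, f) * \<tau> (n, \<omega>, f) + S (n, \<omega>, f)\<bar> \<le> ep n"
    and ep: "(\<lambda>n. sqrt (real (K*n)) * ep n) \<longlonglongrightarrow> 0"
  shows "((\<lambda>x. rN x * \<tau> x - rN x * A x / a (fst x)) \<longlongrightarrow> 0) W"
proof -
  \<comment> \<open>The approximate equation is guaranteed only for nonzero slope; the default 0
    elsewhere is harmless because J / a tends to -1.\<close>
  define R where "R x = (if J x \<noteq> 0 then rN x * (J x * \<tau> x + S x) else 0)" for x
  have "(R \<longlongrightarrow> 0) W"
  proof (rule Lim_null_comparison)
    show "((\<lambda>x. sqrt (real (K*fst x)) * \<bar>ep (fst x)\<bar>) \<longlongrightarrow> 0) W"
      using tendsto_whp_fst[OF tendsto_rabs_zero[OF ep]] by (simp add: case_prod_unfold abs_mult)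
    show "\<forall>\<^sub>F x in W. norm (R x) \<le> sqrt (real (K*fst x)) * \<bar>ep (fst x)\<bar>"
      using eventually_W_pos_space
    proof eventually_elim
      case (elim x)
      obtain n \<omega> f where x: "x = (n, \<omega>, f)" by (cases x) auto
      show ?case
      proof (cases "J x = 0")
        case False
        then have "\<bar>J x * \<tau> x + S x\<bar> \<le> \<bar>ep n\<bar>"
          using solve[of n \<omega> f] elim abs_ge_self[of "ep n"] by (simp add: x)
        then show ?thesis using False by (simp add: R_def abs_mult rN_def x mult_left_mono)
      qed (simp add: R_def)
    qed
  qed
  note R = this
  have inv: "((\<lambda>x. inverse (J x / a (fst x))) \<longlongrightarrow> inverse (- 1)) W" by (intro tendsto_inverse J) simp
  then have inv0: "((\<lambda>x. inverse (J x / a (fst x)) + 1) \<longlongrightarrow> 0) W"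
    using tendsto_add[OF inv tendsto_const[of 1]] by simp
  \<comment> \<open>Dividing the equation by J / a: since R - rN (S - A) equals rN (J \<tau> + A),
    the displayed expression simplifies to a rN \<tau> - rN A wherever J is nonzero.\<close>
  have "((\<lambda>x. (R x - rN x * (S x - A x)) * inverse (J x / a (fst x)) - (rN x * A x) * (inverse (J x / a (fst x)) + 1))
     \<longlongrightarrow> (0 - 0) * inverse (- 1) - 0) W"
    by (intro tendsto_diff tendsto_mult R SA inv Op_mult_tendsto[OF A] inv0)
  then have "((\<lambda>x. 1 / a (fst x) * ((R x - rN x * (S x - A x)) * inverse (J x / a (fst x)) - (rN x * A x) * (inverse (J x / a (fst x)) + 1)))
     \<longlongrightarrow> 0) W"
    by (intro Op_mult_tendsto[OF Op_inverse_a]) simp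
  moreover have "\<forall>\<^sub>F x in W. 1 / a (fst x) * ((R x - rN x * (S x - A x)) * inverse (J x / a (fst x)) - (rN x * A x) * (inverse (J x / a (fst x)) + 1))
     = rN x * \<tau> x - rN x * A x / a (fst x)"
    using tendsto_imp_eventually_ne[OF J, of 0, simplified]
  proof eventually_elim
    case (elim x)
    then have "J x \<noteq> 0" by auto
    with a_nz[of "fst x"] show ?case by (simp add: R_def field_simps)
  qed
  ultimately show ?thesis by (rule Lim_transform_eventually)
qed

lemma AV_PB2_lim: "k < K \<Longrightarrow> ((\<lambda>x. AV k (\<lambda>n I \<omega> w. (PB n I \<omega> w)\<^sup>2) x - AV k (\<lambda>n I \<omega> w. (UV n I \<omega> w)\<^sup>2) x) \<longlongrightarrow> 0) W"
proof -
  assume k: "k < K"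
  have 1: "(AV k (\<lambda>n I \<omega> w. UV n I \<omega> w * (PB n I \<omega> w - UV n I \<omega> w)) \<longlongrightarrow> 0) W"
    by (rule AV_mult_tendsto_0[OF UV2_Op[OF k] PB_UV_lim[OF k]])
  have "((\<lambda>x. 2 * AV k (\<lambda>n I \<omega> w. UV n I \<omega> w * (PB n I \<omega> w - UV n I \<omega> w)) x + AV k (\<lambda>n I \<omega> w. (PB n I \<omega> w - UV n I \<omega> w)\<^sup>2) x) \<longlongrightarrow> 2 * 0 + 0) W"
    by (intro tendsto_intros 1 PB_UV_lim[OF k])
  moreover have "(PB n I \<omega> w)\<^sup>2 = 2 * (UV n I \<omega> w * (PB n I \<omega> w - UV n I \<omega> w)) + (PB n I \<omega> w - UV n I \<omega> w)\<^sup>2 + (UV n I \<omega> w)\<^sup>2" for n I \<omega> w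
    by (simp add: power2_eq_square algebra_simps)
  then have "AV k (\<lambda>n I \<omega> w. (PB n I \<omega> w)\<^sup>2) x = 2 * AV k (\<lambda>n I \<omega> w. UV n I \<omega> w * (PB n I \<omega> w - UV n I \<omega> w)) x
     + AV k (\<lambda>n I \<omega> w. (PB n I \<omega> w - UV n I \<omega> w)\<^sup>2) x + AV k (\<lambda>n I \<omega> w. (UV n I \<omega> w)\<^sup>2) x" for x
    by (simp only: AV_cmult AV_add)
  ultimately show ?thesis by simp
qed

text \<open>The estimation error t depends on the whole sample and cannot stay inside a cross-fitted
  average. Expanding in t leaves averages to which the fold calculus applies, each with t as an
  outer factor.\<close>

lemma AV_quadratic:
  "AV k (\<lambda>n I \<omega> w. (PA n I \<omega> w * t + PB n I \<omega> w)\<^sup>2) x =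
    t * (t * AV k (\<lambda>n I \<omega> w. (PA n I \<omega> w)\<^sup>2) x + 2 * AV k (\<lambda>n I \<omega> w. PA n I \<omega> w * PB n I \<omega> w) x) + AV k (\<lambda>n I \<omega> w. (PB n I \<omega> w)\<^sup>2) x"
proof -
  have "(PA n I \<omega> w * t + PB n I \<omega> w)\<^sup>2 = t\<^sup>2 * (PA n I \<omega> w)\<^sup>2 + (2 * t) * (PA n I \<omega> w * PB n I \<omega> w) + (PB n I \<omega> w)\<^sup>2" for n I \<omega> w
    by (simp add: power2_eq_square algebra_simps)
  then have "AV k (\<lambda>n I \<omega> w. (PA n I \<omega> w * t + PB n I \<omega> w)\<^sup>2) x =
    t\<^sup>2 * AV k (\<lambda>n I \<omega> w. (PA n I \<omega> w)\<^sup>2) x + (2 * t) * AV k (\<lambda>n I \<omega> w. PA n I \<omega> w * PB n I \<omega> w) x + AV k (\<lambda>n I \<omega> w. (PB n I \<omega> w)\<^sup>2) x"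
    by (simp only: AV_cmult AV_add)
  then show ?thesis by (simp add: power2_eq_square algebra_simps)
qed

lemma Op_PB2: "k < K \<Longrightarrow> Op (AV k (\<lambda>n I \<omega> w. (PB n I \<omega> w)\<^sup>2))"
  using Op_add[OF Op_tendsto[OF AV_PB2_lim[of k]] UV2_Op[of k]] by simp

lemma Op_PA_PB: "k < K \<Longrightarrow> Op (AV k (\<lambda>n I \<omega> w. PA n I \<omega> w * PB n I \<omega> w))"
proof -
  assume k: "k < K"
  let ?R = "\<lambda>x. 1 + AV k (\<lambda>n I \<omega> w. (PA n I \<omega> w)\<^sup>2) x * AV k (\<lambda>n I \<omega> w. (PB n I \<omega> w)\<^sup>2) x"
  have "Op ?R" by (intro Op_add Op_mult Op_const Op_PA2 Op_PB2 k)
  then show ?thesis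
  proof (rule Op_abs_bound)
    fix n z
    let ?y = "AV k (\<lambda>n I \<omega> w. PA n I \<omega> w * PB n I \<omega> w) (n, z)"
    have "\<bar>?y\<bar> \<le> 1 + ?y\<^sup>2" by (rule abs_le_1_plus_square)
    also have "\<dots> \<le> ?R (n, z)" by (intro add_left_mono AV_Cauchy_Schwarz)
    finally show "\<bar>?y\<bar> \<le> \<bar>?R (n, z)\<bar>" by linarith
  qed
qed

definition score_sq :: "(nat \<times> (nat \<Rightarrow> 'x obs) \<times> (nat \<Rightarrow> nat) \<Rightarrow> real) \<Rightarrow> nat \<Rightarrow> nat \<times> (nat \<Rightarrow> 'x obs) \<times> (nat \<Rightarrow> nat) \<Rightarrow> real" where
  "score_sq \<tau> k x = AV k (\<lambda>n I \<omega> w. (PA n I \<omega> w * \<tau> x + PB n I \<omega> w)\<^sup>2) x"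

lemma score_sq_lim:
  assumes k: "k < K" and \<tau>: "(\<tau> \<longlongrightarrow> 0) W"
  shows "((\<lambda>x. score_sq \<tau> k x / e (fst x)) \<longlongrightarrow> 1) W"
proof -
  let ?Y = "\<lambda>x. (\<tau> x * AV k (\<lambda>n I \<omega> w. (PA n I \<omega> w)\<^sup>2) x + 2 * AV k (\<lambda>n I \<omega> w. PA n I \<omega> w * PB n I \<omega> w) x)"
  have "Op ?Y" by (intro Op_add Op_mult Op_const Op_PA2 Op_PA_PB Op_tendsto[OF \<tau>] k)
  then have "((\<lambda>x. \<tau> x * ?Y x) \<longlongrightarrow> 0) W" using \<tau> by (rule Op_mult_tendsto')
  from tendsto_add[OF this AV_PB2_lim[OF k]]
  have "((\<lambda>x. 1 / e (fst x) * (\<tau> x * ?Y x + (AV k (\<lambda>n I \<omega> w. (PB n I \<omega> w)\<^sup>2) x - AV k (\<lambda>n I \<omega> w. (UV n I \<omega> w)\<^sup>2) x))) \<longlongrightarrow> 0) W"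
    by (intro Op_mult_tendsto[OF Op_inverse_e]) simp
  from tendsto_add[OF this UV2_lim[OF k]] show ?thesis
    by (simp add: score_sq_def AV_quadratic add_divide_distrib diff_divide_distrib)
qed

definition Am :: "nat \<times> (nat \<Rightarrow> 'x obs) \<times> (nat \<Rightarrow> nat) \<Rightarrow> real" where
  "Am = avg (\<lambda>k. AV k UV)"

text \<open>The common limiting statistic. Dividing A / a by sqrt (e / a^2) leaves the sign of a,
  which does not affect the standard normal limit.\<close>

definition Tst :: "nat \<times> (nat \<Rightarrow> 'x obs) \<times> (nat \<Rightarrow> nat) \<Rightarrow> real" where
  "Tst x = sgn (a (fst x)) / sqrt (e (fst x)) * (rN x * Am x)"

definition s2h :: "(nat \<times> (nat \<Rightarrow> 'x obs) \<times> (nat \<Rightarrow> nat) \<Rightarrow> real) \<Rightarrow> nat \<times> (nat \<Rightarrow> 'x obs) \<times> (nat \<Rightarrow> nat) \<Rightarrow> real" where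
  "s2h \<tau> x = inverse ((avg (\<lambda>k. AV k PA) x)\<^sup>2) * avg (score_sq \<tau>) x"

lemma Am_Op: "Op (\<lambda>x. rN x * Am x)"
proof -
  have "Op (avg (\<lambda>k x. rN x * AV k UV x))" by (rule avg_Op[OF UV_Op])
  then show ?thesis by (simp add: Am_def avg_def[abs_def] sum_distrib_left)
qed

lemma avg_J_lim: "((\<lambda>x. avg (\<lambda>k. AV k PA) x / a (fst x)) \<longlongrightarrow> - 1) W"
  using avg_tendsto[OF J_lim] by (simp add: avg_def[abs_def] sum_divide_distrib mult.commute)

lemma avg_S_lim: "((\<lambda>x. rN x * (avg (\<lambda>k. AV k PB) x - Am x)) \<longlongrightarrow> 0) W"
proof -
  have "(avg (\<lambda>k x. rN x * (AV k PB x - AV k UV x)) \<longlongrightarrow> 0) W"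
    by (intro avg_tendsto S_lim)
  moreover have "avg (\<lambda>k x. rN x * (AV k PB x - AV k UV x)) = (\<lambda>x. rN x * (avg (\<lambda>k. AV k PB) x - Am x))"
    by (intro ext) (simp add: avg_def Am_def sum_distrib_left[symmetric] sum_subtractf right_diff_distrib diff_divide_distrib)
  ultimately show ?thesis by simp
qed

lemma DML1_expansion:
  assumes solve: "\<And>k n \<omega> f. k < K \<Longrightarrow> n > 0 \<Longrightarrow> \<omega> \<in> space (\<Omega> n) \<Longrightarrow> f \<in> partitions K n \<Longrightarrow> AV k PA (n, \<omega>, f) \<noteq> 0 \<Longrightarrow>
      \<bar>AV k PA (n, \<omega>, f) * \<tau> k (n, \<omega>, f) + AV k PB (n, \<omega>, f)\<bar> \<le> ep n"
    and ep: "(\<lambda>n. sqrt (real (K*n)) * ep n) \<longlonglongrightarrow> 0"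
  shows "((\<lambda>x. rN x * avg \<tau> x - rN x * Am x / a (fst x)) \<longlongrightarrow> 0) W"
proof -
  have "(avg (\<lambda>k x. rN x * \<tau> k x - rN x * AV k UV x / a (fst x)) \<longlongrightarrow> 0) W"
    by (intro avg_tendsto estimator_expansion[OF J_lim S_lim UV_Op solve ep])
  then show ?thesis
    by (simp add: avg_def[abs_def] Am_def sum_subtractf sum_distrib_left[symmetric] sum_divide_distrib[symmetric] diff_divide_distrib mult.commute)
qed

lemma DML2_expansion:
  assumes solve: "\<And>n \<omega> f. n > 0 \<Longrightarrow> \<omega> \<in> space (\<Omega> n) \<Longrightarrow> f \<in> partitions K n \<Longrightarrow> avg (\<lambda>k. AV k PA) (n, \<omega>, f) \<noteq> 0 \<Longrightarrow>
      \<bar>avg (\<lambda>k. AV k PA) (n, \<omega>, f) * \<tau> (n, \<omega>, f) + avg (\<lambda>k. AV k PB) (n, \<omega>, f)\<bar> \<le> ep n"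
    and ep: "(\<lambda>n. sqrt (real (K*n)) * ep n) \<longlonglongrightarrow> 0"
  shows "((\<lambda>x. rN x * \<tau> x - rN x * Am x / a (fst x)) \<longlongrightarrow> 0) W"
  by (rule estimator_expansion[OF avg_J_lim avg_S_lim Am_Op solve ep])

lemma a_le: "\<bar>a n\<bar> \<le> 1 + B"
proof -
  interpret prob_space "P n" by (rule prob_space_P)
  have "\<bar>a n\<bar> \<le> (\<integral>w. \<bar>D n w * V n w\<bar> \<partial>P n)" unfolding a_def by (rule integral_abs_bound)
  also have "\<dots> \<le> (\<integral>w. 1 + (D n w * V n w)\<^sup>2 \<partial>P n)"
    by (rule integral_mono) (use int_DV int_DV2 in \<open>auto intro: abs_le_1_plus_square\<close>)
  also have "\<dots> = 1 + (\<integral>w. (D n w * V n w)\<^sup>2 \<partial>P n)" using int_DV2 by (simp add: prob_space)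
  also have "(\<integral>w. (D n w * V n w)\<^sup>2 \<partial>P n) \<le> B" by (rule DV2_le)
  finally show ?thesis by simp
qed

text \<open>Normalising by the true or by the estimated standard deviation leads to the same
  statistic up to o_P(1). Positivity of the variance estimate is recorded because inverting the
  confidence interval divides by its root.\<close>

lemma studentization:
  assumes \<tau>: "((\<lambda>x. rN x * \<tau> x - rN x * Am x / a (fst x)) \<longlongrightarrow> 0) W"
  shows "((\<lambda>x. inverse (sqrt (e (fst x) / (a (fst x))\<^sup>2)) * rN x * \<tau> x - Tst x) \<longlongrightarrow> 0) W" (is ?A)
    and "((\<lambda>x. inverse (sqrt (s2h \<tau> x)) * rN x * \<tau> x - Tst x) \<longlongrightarrow> 0) W" (is ?B)
    and "eventually (\<lambda>x. s2h \<tau> x > 0) W" (is ?C)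
proof -
  \<comment> \<open>This is 1/\<sigma>; it is bounded since |a| \<le> 1 + B and e \<ge> c, so
    multiplication by it preserves o_P(1).\<close>
  define \<kappa> where "\<kappa> n = \<bar>a n\<bar> / sqrt (e n)" for n
  have \<kappa>eq: "inverse (sqrt (e n / (a n)\<^sup>2)) = \<kappa> n" for n
    by (simp add: \<kappa>_def real_sqrt_divide)
  have "\<bar>\<kappa> n\<bar> \<le> (1 + B) / sqrt c" for n
    unfolding \<kappa>_def using a_le[of n] e_ge[of n] c B by (auto simp: abs_div intro!: frac_le)
  from Op_bounded_seq[of \<kappa>, OF this] have Op\<kappa>: "Op (\<lambda>x. \<kappa> (fst x))" by (simp add: case_prod_unfold)
  have "((\<lambda>x. \<kappa> (fst x) * (rN x * \<tau> x - rN x * Am x / a (fst x))) \<longlongrightarrow> 0) W"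
    by (rule Op_mult_tendsto[OF Op\<kappa> \<tau>])
  moreover have \<kappa>a: "\<kappa> n / a n = sgn (a n) / sqrt (e n)" for n
    using a_nz[of n] by (simp add: \<kappa>_def sgn_real_def abs_if)
  have "\<kappa> (fst x) * (rN x * \<tau> x - rN x * Am x / a (fst x)) = \<kappa> (fst x) * rN x * \<tau> x - Tst x" for x
    unfolding Tst_def \<kappa>a[symmetric] by (simp add: right_diff_distrib)
  ultimately have A: "((\<lambda>x. \<kappa> (fst x) * rN x * \<tau> x - Tst x) \<longlongrightarrow> 0) W" by simp
  then show ?A unfolding \<kappa>eq .
  have OpT: "Op (\<lambda>x. rN x * \<tau> x)"
  proof -
    have "Op (\<lambda>x. (rN x * \<tau> x - rN x * Am x / a (fst x)) + (1 / a (fst x)) * (rN x * Am x))"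
      by (intro Op_add Op_mult Op_inverse_a Am_Op Op_tendsto[OF \<tau>])
    then show ?thesis by simp
  qed
  have \<tau>0: "(\<tau> \<longlongrightarrow> 0) W"
  proof -
    show ?thesis by (rule rN_cancel[OF Op_mult_tendsto[OF OpT inverse_rN]])
  qed
  \<comment> \<open>The ratio of estimated to true variance has limit 1, whether or not the true
    variance converges along the sequence.\<close>
  define R where "R x = s2h \<tau> x / (e (fst x) / (a (fst x))\<^sup>2)" for x
  have "(avg (\<lambda>k x. score_sq \<tau> k x / e (fst x)) \<longlongrightarrow> 1) W"
    by (rule avg_tendsto[OF score_sq_lim[OF _ \<tau>0]])
  then have Q: "((\<lambda>x. avg (score_sq \<tau>) x / e (fst x)) \<longlongrightarrow> 1) W"
    by (simp add: avg_def[abs_def] sum_divide_distrib mult.commute)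
  have "((\<lambda>x. avg (score_sq \<tau>) x / e (fst x) * inverse ((avg (\<lambda>k. AV k PA) x / a (fst x))\<^sup>2)) \<longlongrightarrow> 1 * inverse ((- 1)\<^sup>2)) W"
    by (intro tendsto_mult Q tendsto_inverse tendsto_power avg_J_lim) simp
  moreover have "avg (score_sq \<tau>) x / e (fst x) * inverse ((avg (\<lambda>k. AV k PA) x / a (fst x))\<^sup>2) = R x" for x
    by (simp only: R_def s2h_def power_divide divide_inverse inverse_mult_distrib inverse_inverse_eq power_mult_distrib power_inverse mult_ac)
  ultimately have R: "(R \<longlongrightarrow> 1) W" by simp
  have sR: "s2h \<tau> x = e (fst x) / (a (fst x))\<^sup>2 * R x" for x
    using a_nz[of "fst x"] e_pos[of "fst x"] by (simp add: R_def)
  have "eventually (\<lambda>x. R x > 0) W" using order_tendstoD(1)[OF R, of 0] by simp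
  then show ?C
    by eventually_elim (use a_nz e_pos in \<open>simp add: sR\<close>)
  have "((\<lambda>x. inverse (sqrt (R x))) \<longlongrightarrow> inverse (sqrt 1)) W"
    by (intro tendsto_inverse tendsto_real_sqrt R) simp
  from tendsto_diff[OF this tendsto_const[of 1]]
  have "((\<lambda>x. inverse (sqrt (R x)) - 1) \<longlongrightarrow> 0) W" by simp
  then have "((\<lambda>x. (\<kappa> (fst x) * (rN x * \<tau> x)) * (inverse (sqrt (R x)) - 1)) \<longlongrightarrow> 0) W"
    by (intro Op_mult_tendsto Op_mult Op\<kappa> OpT)
  from tendsto_add[OF this A]
  have "((\<lambda>x. \<kappa> (fst x) * inverse (sqrt (R x)) * rN x * \<tau> x - Tst x) \<longlongrightarrow> 0) W"
    by (simp add: algebra_simps)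
  moreover have "inverse (sqrt (s2h \<tau> x)) = \<kappa> (fst x) * inverse (sqrt (R x))" for x
    by (simp only: sR \<kappa>eq[symmetric] real_sqrt_mult inverse_mult_distrib)
  ultimately show ?B by simp
qed

text \<open>The folds cover the sample, so averaging the fold averages gives back the full i.i.d.
  sum. The partition drops out, and the central limit theorem on the sample space alone
  applies.\<close>

lemma Tst_sum:
  assumes "f \<in> partitions K n"
  shows "Tst (n, \<omega>, f) = (\<Sum>i<K*n. sgn (a n) / sqrt (e n) * (U n (\<omega> i) * V n (\<omega> i))) / sqrt (real (K*n))"
proof -
  have "(\<Sum>i<K*n. U n (\<omega> i) * V n (\<omega> i)) = (\<Sum>k<K. \<Sum>i\<in>fold K n f k. U n (\<omega> i) * V n (\<omega> i))"
    unfolding fold_def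
    by (rule sum.group[symmetric, where g=f and S="{..<K*n}" and T="{..<K}"])
       (use assms in \<open>auto simp: partitions_def\<close>)
  then have "rN (n, \<omega>, f) * Am (n, \<omega>, f) = sqrt (real (K*n)) * ((\<Sum>i<K*n. U n (\<omega> i) * V n (\<omega> i)) / real (K*n))"
    by (simp add: rN_def Am_def avg_def AV_def UV_def En_def sum_divide_distrib[symmetric] mult.commute)
  also have "\<dots> = (\<Sum>i<K*n. U n (\<omega> i) * V n (\<omega> i)) / sqrt (real (K*n))"
    using real_div_sqrt[of "real (K*n)"] by (cases "K * n = 0") (auto simp: field_simps)
  finally show ?thesis unfolding Tst_def sum_distrib_left[symmetric] by simp
qed

text \<open>By Levy's continuity theorem only characteristic functions matter. They agree in the
  limit with those of \<open>Tst\<close>, a normalised sum of UV scaled to unit variance; e \<ge> c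
  keeps the Lyapunov bound uniform after this scaling.\<close>

lemma weak_conv_studentized:
  assumes X[measurable]: "\<And>n. X n \<in> borel_measurable (\<D> n)"
    and lim: "((\<lambda>(n, z). X n z - Tst (n, z)) \<longlongrightarrow> 0) W"
  shows "weak_conv_m (\<lambda>n. distr (\<D> n) borel (X n)) N01"
  unfolding N01_def
proof (rule levy_continuity)
  interpret M: prob_space "\<D> n" for n by (rule prob_space_dml_space[OF prob_space_P])
  show "real_distribution (distr (\<D> n) borel (X n))" for n
    by (rule M.real_distribution_distr) simp
  show "real_distribution std_normal_distribution" by (rule real_dist_normal_dist)
  fix t
  define \<xi> where "\<xi> n w = sgn (a n) / sqrt (e n) * (U n w * V n w)" for n w
  define g where "g n \<omega> = (\<Sum>i<K*n. \<xi> n (\<omega> i)) / sqrt (real (K*n))" for n \<omega>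
  have \<xi>m[measurable]: "\<xi> n \<in> borel_measurable (P n)" for n unfolding \<xi>_def by measurable
  have gm[measurable]: "g n \<in> borel_measurable (\<Omega> n)" for n unfolding g_def by measurable
  have gm'[measurable]: "(\<lambda>z. g n (fst z)) \<in> borel_measurable (\<D> n)" for n
    unfolding dml_space_def by measurable
  have lim': "((\<lambda>(n, z). X n z - g n (fst z)) \<longlongrightarrow> 0) W"
    using lim by (rule tendsto_W_cong) (simp add: Tst_sum g_def \<xi>_def)
  have sq: "(sgn (a n) / sqrt (e n))\<^sup>2 = 1 / e n" for n
    using a_nz[of n] e_pos[of n] by (simp add: power_divide power2_eq_square sgn_real_def)
  have abs: "\<bar>sgn (a n) / sqrt (e n)\<bar> = 1 / sqrt (e n)" for n
    using a_nz[of n] e_pos[of n] by (simp add: abs_div abs_sgn_eq)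
  have pw: "\<bar>\<xi> n w\<bar> powr p = (1 / sqrt (e n)) powr p * \<bar>U n w * V n w\<bar> powr p" for n w
    unfolding \<xi>_def abs_mult[of "sgn (a n) / sqrt (e n)"] abs by (rule powr_mult)
  have "(\<lambda>n. char (distr (\<Omega> n) borel (g n)) t) \<longlonglongrightarrow> exp (- (t\<^sup>2) / 2)"
    unfolding g_def[abs_def]
  proof (rule clt_char[OF K_pos p \<xi>m, where B="(1 / sqrt c) powr p * B"])
    fix n
    have sq2: "(\<xi> n w)\<^sup>2 = 1 / e n * (U n w * V n w)\<^sup>2" for w unfolding \<xi>_def power_mult_distrib[of "sgn (a n) / sqrt (e n)"] sq ..
    show "integrable (P n) (\<lambda>w. (\<xi> n w)\<^sup>2)" unfolding sq2 using UV2(1)[of n] by simp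
    show "(\<integral>w. \<xi> n w \<partial>P n) = 0" unfolding \<xi>_def using UV0[of n] by simp
    show "(\<integral>w. (\<xi> n w)\<^sup>2 \<partial>P n) = 1" unfolding sq2 using e_pos[of n] by (simp add: e_def)
    show "integrable (P n) (\<lambda>w. \<bar>\<xi> n w\<bar> powr p)" unfolding pw using UVp(1)[of n] by simp
    have "(\<integral>w. \<bar>\<xi> n w\<bar> powr p \<partial>P n) = (1 / sqrt (e n)) powr p * (\<integral>w. \<bar>U n w * V n w\<bar> powr p \<partial>P n)"
      unfolding pw by simp
    also have "\<dots> \<le> (1 / sqrt c) powr p * B"
      using UVp(2)[of n] e_ge[of n] e_pos[of n] c p
      by (intro mult_mono powr_mono2 frac_le) auto
    finally show "(\<integral>w. \<bar>\<xi> n w\<bar> powr p \<partial>P n) \<le> (1 / sqrt c) powr p * B" .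
  qed
  moreover have "(\<lambda>n. char (distr (\<D> n) borel (X n)) t - char (distr (\<Omega> n) borel (g n)) t) \<longlonglongrightarrow> 0"
    using char_diff_tendsto_0[OF lim' X gm', of t] by (simp add: char_dml_space_fst)
  ultimately have "(\<lambda>n. char (distr (\<D> n) borel (X n)) t) \<longlonglongrightarrow> exp (- (t\<^sup>2) / 2)"
    by (rule Lim_transform)
  then show "(\<lambda>n. char (distr (\<D> n) borel (X n)) t) \<longlonglongrightarrow> char std_normal_distribution t"
    by (simp add: char_std_normal_distribution)
qed

end

section \<open>Moment bounds\<close>

text \<open>The bound is on the q-th power rather than on the norm, so constants combine by sums and
  factors \<open>2 powr q\<close> without roots. It is kept explicit so that it can be shared by all
  distributions of the family.\<close>

definition mom :: "'a measure \<Rightarrow> real \<Rightarrow> ('a \<Rightarrow> real) \<Rightarrow> real \<Rightarrow> bool" where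
  "mom P q f M \<longleftrightarrow> f \<in> borel_measurable P \<and> integrable P (\<lambda>w. \<bar>f w\<bar> powr q) \<and> (\<integral>w. \<bar>f w\<bar> powr q \<partial>P) \<le> M"

lemma momI:
  assumes "f \<in> borel_measurable P" "integrable P g" "\<And>w. \<bar>f w\<bar> powr q \<le> g w" "(\<integral>w. g w \<partial>P) \<le> M"
  shows "mom P q f M"
proof -
  have 1: "integrable P (\<lambda>w. \<bar>f w\<bar> powr q)"
    by (rule Bochner_Integration.integrable_bound[OF assms(2)])
       (use assms(1,3) in \<open>auto intro: order_trans[OF _ abs_ge_self]\<close>)
  moreover have "(\<integral>w. \<bar>f w\<bar> powr q \<partial>P) \<le> (\<integral>w. g w \<partial>P)"
    by (rule integral_mono[OF 1 assms(2,3)])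
  ultimately show ?thesis unfolding mom_def using assms by auto
qed

lemma mom_measurable: "mom P q f M \<Longrightarrow> f \<in> borel_measurable P"
  and mom_integrable: "mom P q f M \<Longrightarrow> integrable P (\<lambda>w. \<bar>f w\<bar> powr q)"
  and mom_le: "mom P q f M \<Longrightarrow> (\<integral>w. \<bar>f w\<bar> powr q \<partial>P) \<le> M"
  by (simp_all add: mom_def)

lemma mom_mono: "mom P q f M \<Longrightarrow> M \<le> M' \<Longrightarrow> mom P q f M'"
  by (auto simp: mom_def)

lemma powr_add_le:
  fixes x y q :: real
  assumes "q > 0"
  shows "\<bar>x + y\<bar> powr q \<le> 2 powr q * (\<bar>x\<bar> powr q + \<bar>y\<bar> powr q)"
proof -
  have "\<bar>x + y\<bar> powr q \<le> (2 * max \<bar>x\<bar> \<bar>y\<bar>) powr q"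
    using assms by (intro powr_mono2) auto
  also have "\<dots> = 2 powr q * (max \<bar>x\<bar> \<bar>y\<bar>) powr q" by (simp add: powr_mult)
  also have "\<dots> \<le> 2 powr q * (\<bar>x\<bar> powr q + \<bar>y\<bar> powr q)"
    by (intro mult_left_mono) (auto simp: max_def)
  finally show ?thesis .
qed

lemma mom_add:
  assumes q: "q > 0" and f: "mom P q f M" and g: "mom P q g N"
  shows "mom P q (\<lambda>w. f w + g w) (2 powr q * (M + N))"
proof (rule momI[where g="\<lambda>w. 2 powr q * (\<bar>f w\<bar> powr q + \<bar>g w\<bar> powr q)"])
  show "(\<integral>w. 2 powr q * (\<bar>f w\<bar> powr q + \<bar>g w\<bar> powr q) \<partial>P) \<le> 2 powr q * (M + N)"
    using mom_integrable[OF f] mom_integrable[OF g] mom_le[OF f] mom_le[OF g] by simp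
qed (use mom_measurable[OF f] mom_measurable[OF g] mom_integrable[OF f] mom_integrable[OF g] powr_add_le[OF q] in auto)

lemma mom_minus: "mom P q f M \<Longrightarrow> mom P q (\<lambda>w. - f w) M"
  by (auto simp: mom_def)

lemma mom_diff:
  assumes q: "q > 0" and f: "mom P q f M" and g: "mom P q g N"
  shows "mom P q (\<lambda>w. f w - g w) (2 powr q * (M + N))"
  using mom_add[OF q f mom_minus[OF g]] by simp

lemma mom_cmult:
  assumes f: "mom P q f M"
  shows "mom P q (\<lambda>w. t * f w) (\<bar>t\<bar> powr q * M)"
  using assms by (auto simp: mom_def abs_mult powr_mult mult_left_mono)

text \<open>Bounding a product by the sum of squares of its factors replaces Cauchy-Schwarz here and
  keeps the constants additive.\<close>

lemma mom_mult:
  assumes q: "q > 0" and f: "mom P q f M" and g: "mom P q g N"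
  shows "mom P (q / 2) (\<lambda>w. f w * g w) (M + N)"
proof (rule momI[where g="\<lambda>w. \<bar>f w\<bar> powr q + \<bar>g w\<bar> powr q"])
  fix w
  have sq: "(x powr (q / 2))\<^sup>2 = x powr q" for x :: real by (simp add: power2_eq_square powr_add[symmetric])
  have "\<bar>f w * g w\<bar> powr (q / 2) = \<bar>f w\<bar> powr (q / 2) * \<bar>g w\<bar> powr (q / 2)" by (simp add: abs_mult powr_mult)
  also have "\<dots> \<le> \<bar>f w\<bar> powr q + \<bar>g w\<bar> powr q"
    using abs_mult_le_squares[of "\<bar>f w\<bar> powr (q / 2)" "\<bar>g w\<bar> powr (q / 2)"] by (simp add: sq abs_mult)
  finally show "\<bar>f w * g w\<bar> powr (q / 2) \<le> \<bar>f w\<bar> powr q + \<bar>g w\<bar> powr q" .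
qed (use mom_measurable[OF f] mom_measurable[OF g] mom_integrable[OF f] mom_integrable[OF g] mom_le[OF f] mom_le[OF g] in auto)

lemma power_le_powr:
  fixes x q :: real
  assumes "real j \<le> q" "j > 0"
  shows "\<bar>x\<bar> ^ j \<le> 1 + \<bar>x\<bar> powr q"
proof (cases "\<bar>x\<bar> \<le> 1")
  case True
  then have "\<bar>x\<bar> ^ j \<le> 1" by (simp add: power_le_one)
  then show ?thesis by (simp add: add_increasing2)
next
  case False
  then have "\<bar>x\<bar> ^ j = \<bar>x\<bar> powr real j" by (simp add: powr_realpow)
  also have "\<dots> \<le> \<bar>x\<bar> powr q" using False assms by (intro powr_mono) auto
  finally show ?thesis by simp
qed

lemma mom_abs_power:
  assumes P: "prob_space P" and f: "mom P q f M" and j: "real j \<le> q" "j > 0"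
  shows "integrable P (\<lambda>w. \<bar>f w\<bar> ^ j)" "(\<integral>w. \<bar>f w\<bar> ^ j \<partial>P) \<le> 1 + M"
proof -
  interpret prob_space P by fact
  note [measurable] = mom_measurable[OF f]
  have i: "integrable P (\<lambda>w. 1 + \<bar>f w\<bar> powr q)" using mom_integrable[OF f] by simp
  show 1: "integrable P (\<lambda>w. \<bar>f w\<bar> ^ j)"
    by (rule Bochner_Integration.integrable_bound[OF i]) (use power_le_powr[OF j] in \<open>auto simp: power_abs[symmetric]\<close>)
  have "(\<integral>w. \<bar>f w\<bar> ^ j \<partial>P) \<le> (\<integral>w. 1 + \<bar>f w\<bar> powr q \<partial>P)"
    by (rule integral_mono[OF 1 i power_le_powr[OF j]])
  also have "\<dots> = 1 + (\<integral>w. \<bar>f w\<bar> powr q \<partial>P)" using mom_integrable[OF f] by (simp add: prob_space)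
  finally show "(\<integral>w. \<bar>f w\<bar> ^ j \<partial>P) \<le> 1 + M" using mom_le[OF f] by simp
qed

lemma nn_square_le:
  fixes f :: "'a \<Rightarrow> real"
  assumes "integrable P (\<lambda>w. (f w)\<^sup>2)" "(\<integral>w. (f w)\<^sup>2 \<partial>P) \<le> B"
  shows "(\<integral>\<^sup>+w. ennreal ((f w)\<^sup>2) \<partial>P) \<le> ennreal B"
  using nn_integral_eq_integral[OF assms(1)] assms(2) by (simp add: ennreal_leI)

lemma mom_square:
  assumes "prob_space P" "mom P q f M" "q \<ge> 2"
  shows "integrable P (\<lambda>w. (f w)\<^sup>2)" "(\<integral>w. (f w)\<^sup>2 \<partial>P) \<le> 1 + M"
  using mom_abs_power[OF assms(1,2), of 2] assms(3) by simp_all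

lemma mom_integrable1:
  assumes "prob_space P" "mom P q f M" "q \<ge> 1"
  shows "integrable P f"
  using mom_abs_power[OF assms(1,2), of 1] assms(3) mom_measurable[OF assms(2)]
  by (simp add: integrable_abs_iff)

lemma mom_product_square:
  assumes "prob_space P" "mom P q f M" "mom P q g N" "q \<ge> 4"
  shows "integrable P (\<lambda>w. (f w * g w)\<^sup>2)" "(\<integral>w. (f w * g w)\<^sup>2 \<partial>P) \<le> 1 + (M + N)"
  using mom_square[OF assms(1) mom_mult[OF _ assms(2,3)]] assms(4) by auto

lemma fourth_power_interpolation:
  fixes x L q :: real
  assumes "L > 0" "q > 4"
  shows "x ^ 4 \<le> L\<^sup>2 * x\<^sup>2 + L powr (4 - q) * \<bar>x\<bar> powr q"
proof (cases "\<bar>x\<bar> \<le> L")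
  case True
  then have "x\<^sup>2 \<le> L\<^sup>2" using assms by (simp add: power2_le_iff_abs_le)
  then have "x\<^sup>2 * x\<^sup>2 \<le> L\<^sup>2 * x\<^sup>2" by (intro mult_right_mono) auto
  then show ?thesis by (simp add: power_add[symmetric] add_increasing2)
next
  case False
  then have x: "\<bar>x\<bar> > 0" using assms by auto
  have "x ^ 4 = \<bar>x\<bar> powr 4" using x by simp
  also have "\<dots> = \<bar>x\<bar> powr (4 - q) * \<bar>x\<bar> powr q"
    using x by (simp add: powr_add[symmetric] del: powr_numeral)
  also have "\<dots> \<le> L powr (4 - q) * \<bar>x\<bar> powr q"
    using False assms by (intro mult_right_mono powr_mono2') auto
  finally show ?thesis by (simp add: add_increasing)
qed

text \<open>L2 rates alone do not control the second moment of a product. The square of the product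
  is at most f^4 + g^4, and fourth moments are interpolated between the small second and the bounded
  q-th moments, which requires q > 4.\<close>

lemma product_square_bound:
  assumes P: "prob_space P" and f: "mom P q f M" and g: "mom P q g N" and q: "q > 4"
    and f2: "(\<integral>w. (f w)\<^sup>2 \<partial>P) \<le> A * \<delta>\<^sup>2" and g2: "(\<integral>w. (g w)\<^sup>2 \<partial>P) \<le> A' * \<delta>\<^sup>2" and \<delta>: "\<delta> > 0"
  shows "(\<integral>w. (f w * g w)\<^sup>2 \<partial>P) \<le> (A + A') * \<delta> + (M + N) * \<delta> powr ((q - 4) / 2)"
proof -
  \<comment> \<open>With this level L^2 \<delta>^2 equals \<delta> and \<open>L powr (4 - q)\<close>
    equals \<open>\<delta> powr ((q - 4) / 2)\<close>, so both parts of the interpolation vanish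
    with \<delta>.\<close>
  define L where "L = \<delta> powr (- 1 / 2)"
  have L: "L > 0" using \<delta> by (simp add: L_def)
  have L2: "L\<^sup>2 = 1 / \<delta>" using \<delta>
    by (simp add: L_def power2_eq_square powr_add[symmetric] powr_minus_divide)
  have "- 1 / 2 * (4 - q) = (q - 4) / 2" by (simp add: field_simps)
  then have Lq: "L powr (4 - q) = \<delta> powr ((q - 4) / 2)"
    unfolding L_def powr_powr by (rule arg_cong)
  have i: "integrable P (\<lambda>w. (f w)\<^sup>2)" "integrable P (\<lambda>w. (g w)\<^sup>2)" "integrable P (\<lambda>w. (f w * g w)\<^sup>2)"
    using mom_square(1)[OF P f] mom_square(1)[OF P g] mom_product_square(1)[OF P f g] q by auto
  note i' = mom_integrable[OF f] mom_integrable[OF g]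
  have "(\<integral>w. (f w * g w)\<^sup>2 \<partial>P) \<le> (\<integral>w. L\<^sup>2 * (f w)\<^sup>2 + L powr (4 - q) * \<bar>f w\<bar> powr q + (L\<^sup>2 * (g w)\<^sup>2 + L powr (4 - q) * \<bar>g w\<bar> powr q) \<partial>P)"
  proof (rule integral_mono[OF i(3)])
    fix w
    have "2 * ((f w)\<^sup>2 * (g w)\<^sup>2) \<le> (f w) ^ 4 + (g w) ^ 4"
      using sum_squares_bound[of "(f w)\<^sup>2" "(g w)\<^sup>2"] by (simp add: mult.assoc flip: power_mult)
    moreover have "0 \<le> (f w)\<^sup>2 * (g w)\<^sup>2" by simp
    ultimately have "(f w * g w)\<^sup>2 \<le> (f w) ^ 4 + (g w) ^ 4" unfolding power_mult_distrib by linarith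
    then show "(f w * g w)\<^sup>2 \<le> L\<^sup>2 * (f w)\<^sup>2 + L powr (4 - q) * \<bar>f w\<bar> powr q + (L\<^sup>2 * (g w)\<^sup>2 + L powr (4 - q) * \<bar>g w\<bar> powr q)"
      using fourth_power_interpolation[OF L q, of "f w"] fourth_power_interpolation[OF L q, of "g w"] by linarith
  qed (use i i' in auto)
  also have "\<dots> = L\<^sup>2 * (\<integral>w. (f w)\<^sup>2 \<partial>P) + L powr (4 - q) * (\<integral>w. \<bar>f w\<bar> powr q \<partial>P)
    + (L\<^sup>2 * (\<integral>w. (g w)\<^sup>2 \<partial>P) + L powr (4 - q) * (\<integral>w. \<bar>g w\<bar> powr q \<partial>P))"
    using i i' by simp
  also have "\<dots> \<le> L\<^sup>2 * (A * \<delta>\<^sup>2) + L powr (4 - q) * M + (L\<^sup>2 * (A' * \<delta>\<^sup>2) + L powr (4 - q) * N)"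
    using f2 g2 mom_le[OF f] mom_le[OF g] by (intro add_mono mult_left_mono) auto
  also have "\<dots> = (A + A') * \<delta> + (M + N) * \<delta> powr ((q - 4) / 2)"
    unfolding L2 Lq using \<delta> by (simp add: field_simps power2_eq_square)
  finally show ?thesis .
qed

lemma Lnorm_le_D:
  assumes P: "prob_space P" and f: "f \<in> borel_measurable P" and q: "q > 0" and C: "C \<ge> 0"
    and le: "Lnorm P q f \<le> ennreal C"
  shows "mom P q f (C powr q)"
proof -
  let ?I = "\<integral>\<^sup>+w. ennreal (\<bar>f w\<bar> powr q) \<partial>P"
  have I: "?I \<noteq> \<top>" using le by (auto simp: Lnorm_def Let_def top_unique split: if_splits)
  then have "ennreal (enn2real ?I powr (1 / q)) \<le> ennreal C" using le by (simp add: Lnorm_def Let_def)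
  then have "enn2real ?I powr (1 / q) \<le> C" using C by simp
  then have "(enn2real ?I powr (1 / q)) powr q \<le> C powr q" using q by (intro powr_mono2) auto
  then have le': "enn2real ?I \<le> C powr q" using q by (simp add: powr_powr)
  have int: "integrable P (\<lambda>w. \<bar>f w\<bar> powr q)"
    by (rule integrableI_nonneg) (use f I in \<open>auto simp: less_top\<close>)
  moreover have "(\<integral>w. \<bar>f w\<bar> powr q \<partial>P) = enn2real ?I"
    by (rule integral_eq_nn_integral) (use f in auto)
  ultimately show ?thesis using le' f by (simp add: mom_def)
qed

lemma Lnorm_2_eq:
  assumes f: "f \<in> borel_measurable P" and i: "integrable P (\<lambda>w. (f w)\<^sup>2)"
  shows "Lnorm P 2 f = ennreal (sqrt (\<integral>w. (f w)\<^sup>2 \<partial>P))"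
proof -
  have pw: "\<bar>x\<bar> powr 2 = x\<^sup>2" for x :: real by (cases "x = 0") auto
  have I: "(\<integral>\<^sup>+w. ennreal (\<bar>f w\<bar> powr 2) \<partial>P) = ennreal (\<integral>w. (f w)\<^sup>2 \<partial>P)"
    unfolding pw by (rule nn_integral_eq_integral[OF i]) simp
  show ?thesis unfolding Lnorm_def Let_def I by (simp add: powr_half_sqrt)
qed

lemma integral_Cauchy_Schwarz:
  assumes f: "f \<in> borel_measurable P" and g: "g \<in> borel_measurable P"
    and i: "integrable P (\<lambda>w. (f w)\<^sup>2)" "integrable P (\<lambda>w. (g w)\<^sup>2)"
  shows "(\<integral>\<^sup>+w. ennreal \<bar>f w * g w\<bar> \<partial>P) \<le> ennreal (sqrt (\<integral>w. (f w)\<^sup>2 \<partial>P) * sqrt (\<integral>w. (g w)\<^sup>2 \<partial>P))"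
proof -
  let ?I = "\<integral>\<^sup>+w. ennreal \<bar>f w * g w\<bar> \<partial>P" and ?F = "\<integral>w. (f w)\<^sup>2 \<partial>P" and ?G = "\<integral>w. (g w)\<^sup>2 \<partial>P"
  have nn: "0 \<le> ?F" "0 \<le> ?G" by simp_all
  have "?I\<^sup>2 = (\<integral>\<^sup>+w. ennreal \<bar>f w\<bar> * ennreal \<bar>g w\<bar> \<partial>P)\<^sup>2" by (simp add: abs_mult ennreal_mult)
  also have "\<dots> \<le> (\<integral>\<^sup>+w. ennreal \<bar>f w\<bar> ^ 2 \<partial>P) * (\<integral>\<^sup>+w. ennreal \<bar>g w\<bar> ^ 2 \<partial>P)"
    by (rule Cauchy_Schwarz_nn_integral) (use f g in auto)
  also have "\<dots> = ennreal ?F * ennreal ?G"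
    using nn_integral_eq_integral[OF i(1)] nn_integral_eq_integral[OF i(2)] by (simp add: ennreal_power)
  also have "\<dots> = ennreal (?F * ?G)" using nn by (simp add: ennreal_mult)
  finally have le: "?I\<^sup>2 \<le> ennreal (?F * ?G)" .
  then have "?I\<^sup>2 < \<top>" by (rule le_less_trans) simp
  then have fin: "?I < \<top>" by (simp add: power_less_top_ennreal)
  then obtain r where r: "r \<ge> 0" "?I = ennreal r" by (cases ?I) auto
  have "r\<^sup>2 \<le> ?F * ?G" using le r nn by (simp add: ennreal_power)
  then have "r \<le> sqrt (?F * ?G)" by (rule real_le_rsqrt)
  then show ?thesis using r nn by (simp add: real_sqrt_mult ennreal_leI)
qed

text \<open>Conditional Jensen for the q-th power: regressions on X inherit the moments of the
  regressed variable with a constant free of the distribution.\<close>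

lemma cond_exp_mom:
  assumes P: "prob_space P" and F: "subalgebra P F" and f: "mom P q f M" and q: "q \<ge> 1"
    and g: "g \<in> borel_measurable P" "AE w in P. g w = real_cond_exp P F f w"
  shows "mom P q g (2 powr q * (M + 1))"
proof -
  interpret prob_space P by fact
  interpret finite_measure_subalgebra P F by unfold_locales (rule F)
  note [measurable] = mom_measurable[OF f] g(1)
  \<comment> \<open>Jensen is applied on the open half line, where the power is convex; the shift by
    1 keeps |f| inside it and accounts for M + 1 in the bound.\<close>
  let ?X = "\<lambda>w. \<bar>f w\<bar> + 1"
  have intf: "integrable P f" by (rule mom_integrable1[OF P f q])
  have mX: "mom P q ?X (2 powr q * (M + 1))"
  proof -
    have "mom P q (\<lambda>w. \<bar>f w\<bar>) M" using f by (auto simp: mom_def)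
    moreover have "mom P q (\<lambda>w. 1) 1" by (auto simp: mom_def prob_space)
    ultimately show ?thesis using q by (intro mom_add) auto
  qed
  have intX: "integrable P ?X" by (rule mom_integrable1[OF P mX q])
  have qX: "integrable P (\<lambda>w. (?X w) powr q)" "(\<integral>w. (?X w) powr q \<partial>P) \<le> 2 powr q * (M + 1)"
    using mom_integrable[OF mX] mom_le[OF mX] by (simp_all add: add_nonneg_nonneg)
  note J = real_cond_exp_jensens_inequality[of ?X "{0<..}" 0 0 "\<lambda>x. x powr q", OF intX _ _ qX(1) powr_convex[OF q]]
  have J1: "AE w in P. (real_cond_exp P F ?X w) powr q \<le> real_cond_exp P F (\<lambda>w. (?X w) powr q) w"
    and J0: "AE w in P. real_cond_exp P F ?X w \<in> {0<..}"
    by (rule J; simp add: add_nonneg_pos)+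
  have up: "AE w in P. real_cond_exp P F f w \<le> real_cond_exp P F ?X w"
    by (rule real_cond_exp_mono) (use intf intX in auto)
  have "AE w in P. real_cond_exp P F (\<lambda>w. (-1) * f w) w \<le> real_cond_exp P F ?X w"
    by (rule real_cond_exp_mono) (use intf intX in auto)
  then have lo: "AE w in P. - real_cond_exp P F f w \<le> real_cond_exp P F ?X w"
    using real_cond_exp_cmult[OF intf, of "-1"] by eventually_elim auto
  have ae: "AE w in P. \<bar>g w\<bar> powr q \<le> real_cond_exp P F (\<lambda>w. (?X w) powr q) w"
    using J1 J0 up lo g(2)
  proof eventually_elim
    case (elim w)
    then have "\<bar>g w\<bar> \<le> real_cond_exp P F ?X w" by (simp add: abs_le_iff)
    then have "\<bar>g w\<bar> powr q \<le> (real_cond_exp P F ?X w) powr q" using q by (intro powr_mono2) auto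
    with elim show ?case by simp
  qed
  note ic = real_cond_exp_int[OF qX(1)]
  have int: "integrable P (\<lambda>w. \<bar>g w\<bar> powr q)"
    by (rule Bochner_Integration.integrable_bound[OF ic(1)]) (use ae in \<open>auto elim: eventually_mono\<close>)
  moreover have "(\<integral>w. \<bar>g w\<bar> powr q \<partial>P) \<le> (\<integral>w. real_cond_exp P F (\<lambda>w. (?X w) powr q) w \<partial>P)"
    by (rule integral_mono_AE[OF int ic(1) ae])
  ultimately show ?thesis using ic(2) qX(2) by (simp add: mom_def)
qed

section \<open>The partially linear IV model\<close>

text \<open>\<open>scU\<close> and \<open>scD\<close> are the residual and regressor of the score at
  the true nuisances; \<open>scH\<close> and \<open>scS\<close> are the corresponding estimation
  errors. Score (A) does not residualise D, hence its \<open>scS\<close> is 0, and every later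
  formula covers both scores.\<close>

definition scU :: "score \<Rightarrow> real \<Rightarrow> ('x \<Rightarrow> real) \<Rightarrow> ('x \<Rightarrow> real) \<Rightarrow> ('x \<Rightarrow> real) \<Rightarrow> 'x obs \<Rightarrow> real" where
  "scU sc \<theta> g l r w = (case sc of ScoreA \<Rightarrow> Uerr \<theta> g w
     | ScoreB \<Rightarrow> (Yv w - l (Xv w)) - \<theta> * (Dv w - r (Xv w)))"

definition scD :: "score \<Rightarrow> ('x \<Rightarrow> real) \<Rightarrow> 'x obs \<Rightarrow> real" where
  "scD sc r w = (case sc of ScoreA \<Rightarrow> Dv w | ScoreB \<Rightarrow> Dv w - r (Xv w))"

definition scH :: "score \<Rightarrow> real \<Rightarrow> ('x \<Rightarrow> real) \<Rightarrow> ('x \<Rightarrow> real) \<Rightarrow> ('x \<Rightarrow> real) \<Rightarrow> 'x nuis \<Rightarrow> 'x \<Rightarrow> real" where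
  "scH sc \<theta> g l r \<eta> x = (case sc of ScoreA \<Rightarrow> nf \<eta> x - g x
     | ScoreB \<Rightarrow> (nf \<eta> x - l x) - \<theta> * (nr \<eta> x - r x))"

definition scS :: "score \<Rightarrow> ('x \<Rightarrow> real) \<Rightarrow> 'x nuis \<Rightarrow> 'x \<Rightarrow> real" where
  "scS sc r \<eta> x = (case sc of ScoreA \<Rightarrow> 0 | ScoreB \<Rightarrow> nr \<eta> x - r x)"

lemma psi_a_decomp:
  "psi_a sc \<eta> w = - (scD sc r w - scS sc r \<eta> (Xv w)) * (Verr m w - (nm \<eta> (Xv w) - m (Xv w)))"
  by (cases sc) (simp_all add: psi_a_def scD_def scS_def Verr_def algebra_simps)

lemma psi_decomp:
  "psi sc \<theta> \<eta> w = (scU sc \<theta> g l r w - scH sc \<theta> g l r \<eta> (Xv w)) * (Verr m w - (nm \<eta> (Xv w) - m (Xv w)))"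
  by (cases sc) (simp_all add: psi_def psi_a_def psi_b_def scU_def scH_def Uerr_def Verr_def algebra_simps)

lemma square_diff_le: "(x - y)\<^sup>2 \<le> 2 * x\<^sup>2 + 2 * y\<^sup>2" for x y :: real
  using zero_le_power2[of "x + y"] by (simp add: power2_eq_square algebra_simps)

lemma integrable_mult_squares:
  fixes f g :: "'a \<Rightarrow> real"
  assumes [measurable]: "f \<in> borel_measurable P" "g \<in> borel_measurable P"
    and i: "integrable P (\<lambda>w. (f w)\<^sup>2)" "integrable P (\<lambda>w. (g w)\<^sup>2)"
  shows "integrable P (\<lambda>w. f w * g w)"
proof (rule Bochner_Integration.integrable_bound)
  show "integrable P (\<lambda>w. (f w)\<^sup>2 + (g w)\<^sup>2)" using i by simp
  show "AE w in P. norm (f w * g w) \<le> norm ((f w)\<^sup>2 + (g w)\<^sup>2)"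
    by (simp add: abs_mult_le_squares)
qed measurable

lemma mom_cong_AE:
  assumes "mom P q f M" "g \<in> borel_measurable P" "AE w in P. f w = g w"
  shows "mom P q g M"
proof -
  note [measurable] = mom_measurable[OF assms(1)] assms(2)
  have ae: "AE w in P. \<bar>f w\<bar> powr q = \<bar>g w\<bar> powr q" using assms(3) by eventually_elim simp
  have "integrable P (\<lambda>w. \<bar>f w\<bar> powr q) \<longleftrightarrow> integrable P (\<lambda>w. \<bar>g w\<bar> powr q)"
    by (rule integrable_cong_AE[OF _ _ ae]) measurable
  moreover have "(\<integral>w. \<bar>f w\<bar> powr q \<partial>P) = (\<integral>w. \<bar>g w\<bar> powr q \<partial>P)"
    by (rule integral_cong_AE[OF _ _ ae]) measurable
  ultimately show ?thesis using assms by (simp add: mom_def)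
qed

text \<open>Moment constants for the observables, their regressions on X, the residuals, \<theta>0
  and U, in this order. That they are functions of c, C and q only is what makes all limits uniform
  over the family.\<close>

definition M_obs :: "real \<Rightarrow> real \<Rightarrow> real" where "M_obs C q = C powr q"
definition M_proj :: "real \<Rightarrow> real \<Rightarrow> real" where "M_proj C q = 2 powr q * (M_obs C q + 1)"
definition M_res :: "real \<Rightarrow> real \<Rightarrow> real" where "M_res C q = 2 powr q * (M_obs C q + M_proj C q)"
definition Theta_bd :: "real \<Rightarrow> real \<Rightarrow> real \<Rightarrow> real" where "Theta_bd c C q = (2 + M_obs C q + M_res C q) / c"
definition M_U :: "real \<Rightarrow> real \<Rightarrow> real \<Rightarrow> real" where
  "M_U c C q = 2 powr q * (M_res C q + Theta_bd c C q powr q * M_res C q)"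

locale pliv =
  fixes SX :: "'x measure" and P :: "'x obs measure" and \<theta>0 :: real
    and g0 m0 l0 r0 :: "'x \<Rightarrow> real" and c C q :: real
  assumes cC: "c > 0" "C > 0" and q: "q > 4"
    and model: "pliv_model SX P \<theta>0 g0 m0 l0 r0"
    and moments: "Lnorm P q Yv + Lnorm P q Dv + Lnorm P q Zv \<le> ennreal C"
    and ident: "Lnorm P 2 (\<lambda>w. Uerr \<theta>0 g0 w * Verr m0 w) \<ge> ennreal (c\<^sup>2)"
      "\<bar>\<integral>w. Dv w * Verr m0 w \<partial>P\<bar> \<ge> c"
    and condvar: "AE w in P. real_cond_exp P (sigma_X SX P) (\<lambda>w. (Uerr \<theta>0 g0 w)\<^sup>2) w \<le> C"
      "AE w in P. real_cond_exp P (sigma_X SX P) (\<lambda>w. (Verr m0 w)\<^sup>2) w \<le> C"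
begin

abbreviation "U \<equiv> Uerr \<theta>0 g0"
abbreviation "V \<equiv> Verr m0"
abbreviation "EcX \<equiv> real_cond_exp P (sigma_X SX P)"
abbreviation "EcXZ \<equiv> real_cond_exp P (sigma_XZ SX P)"
abbreviation sqn :: "('x \<Rightarrow> real) \<Rightarrow> real" where
  "sqn u \<equiv> (\<integral>w. (u (Xv w))\<^sup>2 \<partial>P)"

lemma prob_P: "prob_space P" and sets_P[measurable_cong]: "sets P = sets (obs_space SX)"
  using model by (auto simp: pliv_model_def)

sublocale prob_space P by (rule prob_P)

lemma nuis_meas[measurable]: "g0 \<in> borel_measurable SX" "m0 \<in> borel_measurable SX" "l0 \<in> borel_measurable SX" "r0 \<in> borel_measurable SX"
  using model by (auto simp: pliv_model_def)

lemma nuis_L2: "integrable P (\<lambda>w. (g0 (Xv w))\<^sup>2)" "integrable P (\<lambda>w. (m0 (Xv w))\<^sup>2)"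
    "integrable P (\<lambda>w. (l0 (Xv w))\<^sup>2)" "integrable P (\<lambda>w. (r0 (Xv w))\<^sup>2)"
  using model by (auto simp: pliv_model_def)

lemma coord_meas[measurable]: "Yv \<in> borel_measurable P" "Dv \<in> borel_measurable P" "Zv \<in> borel_measurable P" "Xv \<in> measurable P SX"
  unfolding measurable_cong_sets[OF sets_P refl] obs_space_def Yv_def[abs_def] Dv_def[abs_def] Zv_def[abs_def] Xv_def[abs_def]
  by measurable

lemma UV_meas[measurable]: "U \<in> borel_measurable P" "V \<in> borel_measurable P"
  unfolding Uerr_def[abs_def] Verr_def[abs_def] by measurable

lemma subalg_X: "subalgebra P (sigma_X SX P)"
  unfolding subalgebra_def sigma_X_def
  using coord_meas(4) by (auto simp: sets_vimage_algebra2 measurable_def)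

lemma subalg_XZ: "subalgebra P (sigma_XZ SX P)"
proof -
  have "(\<lambda>w. (Xv w, Zv w)) \<in> measurable P (SX \<Otimes>\<^sub>M borel)" by measurable
  then show ?thesis unfolding subalgebra_def sigma_XZ_def
    by (auto simp: sets_vimage_algebra2 measurable_def)
qed

lemma Xv_sigma_X: "Xv \<in> measurable (sigma_X SX P) SX"
  unfolding sigma_X_def using measurable_space[OF coord_meas(4)] by (intro measurable_vimage_algebra1) auto

lemma XZ_sigma_XZ: "(\<lambda>w. (Xv w, Zv w)) \<in> measurable (sigma_XZ SX P) (SX \<Otimes>\<^sub>M borel)"
  unfolding sigma_XZ_def using measurable_space[OF coord_meas(4)]
  by (intro measurable_vimage_algebra1) (auto simp: space_pair_measure)

lemma subalg_XZ_X: "subalgebra (sigma_XZ SX P) (sigma_X SX P)"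
proof -
  have "Xv \<in> measurable (sigma_XZ SX P) SX"
    using measurable_compose[OF XZ_sigma_XZ measurable_fst] by simp
  moreover have "space (sigma_XZ SX P) = space P" by (simp add: sigma_XZ_def)
  ultimately show ?thesis unfolding subalgebra_def
    by (auto simp: sigma_X_def sets_vimage_algebra2 measurable_def)
qed

lemma X_meas: "u \<in> borel_measurable SX \<Longrightarrow> (\<lambda>w. u (Xv w)) \<in> borel_measurable (sigma_X SX P)"
  by (rule measurable_compose[OF Xv_sigma_X])

lemma V_XZ: "V \<in> borel_measurable (sigma_XZ SX P)"
proof -
  have "(\<lambda>p. snd p - m0 (fst p)) \<in> borel_measurable (SX \<Otimes>\<^sub>M borel)" by measurable
  from measurable_compose[OF XZ_sigma_XZ this] show ?thesis by (simp add: Verr_def[abs_def])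
qed

sublocale FX: finite_measure_subalgebra P "sigma_X SX P"
  by unfold_locales (rule subalg_X)

sublocale FXZ: finite_measure_subalgebra P "sigma_XZ SX P"
  by unfold_locales (rule subalg_XZ)

lemma mom_obs: "mom P q Yv (M_obs C q)" "mom P q Dv (M_obs C q)" "mom P q Zv (M_obs C q)"
proof -
  have "Lnorm P q Yv \<le> Lnorm P q Yv + Lnorm P q Dv + Lnorm P q Zv" "Lnorm P q Dv \<le> Lnorm P q Yv + Lnorm P q Dv + Lnorm P q Zv"
    "Lnorm P q Zv \<le> Lnorm P q Yv + Lnorm P q Dv + Lnorm P q Zv"
    by (auto intro: add_increasing add_increasing2)
  note le = this[THEN order_trans, OF moments]
  then show "mom P q Yv (M_obs C q)" "mom P q Dv (M_obs C q)" "mom P q Zv (M_obs C q)"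
    unfolding M_obs_def using q cC by (auto intro!: Lnorm_le_D prob_P le)
qed

lemma int_obs: "integrable P Yv" "integrable P Dv" "integrable P Zv"
  using mom_obs q by (auto intro: mom_integrable1[OF prob_P])

lemma int_X:
  fixes u :: "'x \<Rightarrow> real"
  shows "u \<in> borel_measurable SX \<Longrightarrow> integrable P (\<lambda>w. (u (Xv w))\<^sup>2) \<Longrightarrow> integrable P (\<lambda>w. u (Xv w))"
  using integrable_mult_squares[of "\<lambda>w. u (Xv w)" P "\<lambda>w. 1"] by simp

lemma cond_exp_X: "u \<in> borel_measurable SX \<Longrightarrow> integrable P (\<lambda>w. (u (Xv w))\<^sup>2) \<Longrightarrow>
    AE w in P. EcX (\<lambda>w. u (Xv w)) w = u (Xv w)"
  by (rule FX.real_cond_exp_F_meas[OF int_X X_meas])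

lemma int_UV: "integrable P U" "integrable P V"
  using model by (auto simp: pliv_model_def)

lemma cond_exp_V: "AE w in P. EcX V w = 0"
  using model by (auto simp: pliv_model_def)

lemma cond_exp_U_XZ: "AE w in P. EcXZ U w = 0"
  using model by (auto simp: pliv_model_def)

lemma cond_exp_U: "AE w in P. EcX U w = 0"
proof -
  have "AE w in P. EcX (EcXZ U) w = EcX U w"
    by (rule FX.real_cond_exp_nested_subalg[OF subalg_XZ subalg_XZ_X int_UV(1)])
  moreover have "AE w in P. EcX (EcXZ U) w = EcX (\<lambda>w. 0) w"
    by (rule FX.real_cond_exp_cong[OF cond_exp_U_XZ]) (auto intro: measurable_from_subalg[OF subalg_XZ])
  moreover have "AE w in P. EcX (\<lambda>w. 0) w = 0"
    by (rule FX.real_cond_exp_F_meas) auto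
  ultimately show ?thesis by eventually_elim auto
qed

lemma cond_exp_m: "AE w in P. m0 (Xv w) = EcX Zv w"
proof -
  have "AE w in P. EcX (\<lambda>w. Zv w - m0 (Xv w)) w
    = EcX Zv w - EcX (\<lambda>w. m0 (Xv w)) w"
    by (rule FX.real_cond_exp_diff[OF int_obs(3) int_X[OF nuis_meas(2) nuis_L2(2)]])
  with cond_exp_V cond_exp_X[OF nuis_meas(2) nuis_L2(2)] show ?thesis
    unfolding Verr_def[abs_def] by eventually_elim simp
qed

lemma cond_exp_l: "AE w in P. l0 (Xv w) = EcX Yv w"
  and cond_exp_r: "AE w in P. r0 (Xv w) = EcX Dv w"
  using model by (auto simp: pliv_model_def)

text \<open>Taking conditional expectations given X in the structural equation. Consequently the
  residuals of scores (A) and (B) agree almost surely, and U gets q-th moments although g0(X) is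
  only assumed square integrable.\<close>

lemma g0_eq: "AE w in P. g0 (Xv w) = l0 (Xv w) - \<theta>0 * r0 (Xv w)"
proof -
  have i: "integrable P (\<lambda>w. \<theta>0 * Dv w)" using int_obs by simp
  have 1: "AE w in P. EcX (\<lambda>w. (Yv w - \<theta>0 * Dv w) - g0 (Xv w)) w
    = EcX (\<lambda>w. Yv w - \<theta>0 * Dv w) w - EcX (\<lambda>w. g0 (Xv w)) w"
    by (rule FX.real_cond_exp_diff) (use int_obs i int_X[OF nuis_meas(1) nuis_L2(1)] in auto)
  have 2: "AE w in P. EcX (\<lambda>w. Yv w - \<theta>0 * Dv w) w
    = EcX Yv w - EcX (\<lambda>w. \<theta>0 * Dv w) w"
    by (rule FX.real_cond_exp_diff) (use int_obs i in auto)
  have 3: "AE w in P. EcX (\<lambda>w. \<theta>0 * Dv w) w = \<theta>0 * EcX Dv w"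
    by (rule FX.real_cond_exp_cmult[OF int_obs(2)])
  have U: "U = (\<lambda>w. (Yv w - \<theta>0 * Dv w) - g0 (Xv w))" by (simp add: Uerr_def[abs_def] mult.commute)
  show ?thesis
    using 1 2 3 cond_exp_U[unfolded U] cond_exp_X[OF nuis_meas(1) nuis_L2(1)] cond_exp_l cond_exp_r
    by eventually_elim simp
qed

lemma mom_nuis: "mom P q (\<lambda>w. m0 (Xv w)) (M_proj C q)" "mom P q (\<lambda>w. l0 (Xv w)) (M_proj C q)" "mom P q (\<lambda>w. r0 (Xv w)) (M_proj C q)"
  unfolding M_proj_def using q
  by (intro cond_exp_mom[OF prob_P subalg_X mom_obs(3) _ _ cond_exp_m] cond_exp_mom[OF prob_P subalg_X mom_obs(1) _ _ cond_exp_l]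
      cond_exp_mom[OF prob_P subalg_X mom_obs(2) _ _ cond_exp_r]; simp)+

lemma mom_res: "mom P q V (M_res C q)" "mom P q (\<lambda>w. Yv w - l0 (Xv w)) (M_res C q)" "mom P q (\<lambda>w. Dv w - r0 (Xv w)) (M_res C q)"
  unfolding M_res_def Verr_def[abs_def] using q by (auto intro!: mom_diff mom_nuis mom_obs)

lemma V_orth:
  assumes u: "u \<in> borel_measurable SX" and i: "integrable P (\<lambda>w. (u (Xv w))\<^sup>2)"
  shows "(\<integral>w. V w * u (Xv w) \<partial>P) = 0"
proof -
  have int: "integrable P (\<lambda>w. u (Xv w) * V w)"
    using u mom_square(1)[OF prob_P mom_res(1)] q by (intro integrable_mult_squares i) auto
  have "(\<integral>w. u (Xv w) * V w \<partial>P) = (\<integral>w. u (Xv w) * EcX V w \<partial>P)"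
    by (rule FX.real_cond_exp_intg(2)[OF int X_meas[OF u] UV_meas(2), symmetric])
  also have "\<dots> = (\<integral>w. 0 \<partial>P)"
    by (rule integral_cong_AE) (use cond_exp_V u in \<open>auto intro: measurable_from_subalg[OF subalg_X]\<close>)
  finally show ?thesis by (simp add: mult.commute)
qed

lemma U_L2: "integrable P (\<lambda>w. (U w)\<^sup>2)"
proof -
  have "mom P q (\<lambda>w. Yv w - Dv w * \<theta>0) (2 powr q * (M_obs C q + \<bar>\<theta>0\<bar> powr q * M_obs C q))"
    using q mom_cmult[OF mom_obs(2), of \<theta>0] by (intro mom_diff mom_obs) (auto simp: mult.commute)
  then have "integrable P (\<lambda>w. (Yv w - Dv w * \<theta>0)\<^sup>2)" by (rule mom_square(1)[OF prob_P]) (use q in simp)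
  then have "integrable P (\<lambda>w. 2 * (Yv w - Dv w * \<theta>0)\<^sup>2 + 2 * (g0 (Xv w))\<^sup>2)" using nuis_L2 by simp
  then show ?thesis
  proof (rule Bochner_Integration.integrable_bound)
    show "AE w in P. norm ((U w)\<^sup>2) \<le> norm (2 * (Yv w - Dv w * \<theta>0)\<^sup>2 + 2 * (g0 (Xv w))\<^sup>2)"
      using square_diff_le by (simp add: Uerr_def)
  qed measurable
qed

text \<open>V is a function of (X, Z), so this uses the exogeneity of U given both; conditioning on
  X alone would not let V be pulled out.\<close>

lemma UV_orth: "(\<integral>w. U w * V w \<partial>P) = 0"
proof -
  have int: "integrable P (\<lambda>w. V w * U w)"
    using U_L2 mom_square(1)[OF prob_P mom_res(1)] q by (intro integrable_mult_squares) auto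
  have "(\<integral>w. V w * U w \<partial>P) = (\<integral>w. V w * EcXZ U w \<partial>P)"
    by (rule FXZ.real_cond_exp_intg(2)[OF int V_XZ UV_meas(1), symmetric])
  also have "\<dots> = (\<integral>w. 0 \<partial>P)"
    by (rule integral_cong_AE) (use cond_exp_U_XZ in \<open>auto intro: measurable_from_subalg[OF subalg_XZ]\<close>)
  finally show ?thesis by (simp add: mult.commute)
qed

text \<open>Since V is orthogonal to U and to g0(X), the equation \<theta>0 E[DV] = E[YV] holds, and
  the identification condition |E[DV]| \<ge> c allows division.\<close>

lemma theta_bound: "\<bar>\<theta>0\<bar> \<le> Theta_bd c C q"
proof -
  have V2: "integrable P (\<lambda>w. (V w)\<^sup>2)" "(\<integral>w. (V w)\<^sup>2 \<partial>P) \<le> 1 + M_res C q"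
    using mom_square[OF prob_P mom_res(1)] q by auto
  have Y2: "integrable P (\<lambda>w. (Yv w)\<^sup>2)" "(\<integral>w. (Yv w)\<^sup>2 \<partial>P) \<le> 1 + M_obs C q"
    using mom_square[OF prob_P mom_obs(1)] q by auto
  have D2: "integrable P (\<lambda>w. (Dv w)\<^sup>2)" using mom_square[OF prob_P mom_obs(2)] q by auto
  have i: "integrable P (\<lambda>w. Yv w * V w)" "integrable P (\<lambda>w. Dv w * V w)" "integrable P (\<lambda>w. V w * g0 (Xv w))"
    by (intro integrable_mult_squares V2 Y2 D2 nuis_L2; measurable)+
  have "0 = (\<integral>w. Yv w * V w - \<theta>0 * (Dv w * V w) - V w * g0 (Xv w) \<partial>P)"
    using UV_orth by (simp add: Uerr_def algebra_simps)
  also have "\<dots> = (\<integral>w. Yv w * V w \<partial>P) - \<theta>0 * (\<integral>w. Dv w * V w \<partial>P)"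
    using i V_orth[OF nuis_meas(1) nuis_L2(1)] by simp
  finally have eq: "\<theta>0 * (\<integral>w. Dv w * V w \<partial>P) = (\<integral>w. Yv w * V w \<partial>P)" by simp
  have "\<bar>\<theta>0\<bar> * c \<le> \<bar>\<theta>0\<bar> * \<bar>\<integral>w. Dv w * V w \<partial>P\<bar>" using ident by (intro mult_left_mono) auto
  also have "\<dots> = \<bar>\<integral>w. Yv w * V w \<partial>P\<bar>" using eq by (simp add: abs_mult[symmetric])
  also have "\<dots> \<le> (\<integral>w. \<bar>Yv w * V w\<bar> \<partial>P)" by (rule integral_abs_bound)
  also have "\<dots> \<le> (\<integral>w. (Yv w)\<^sup>2 + (V w)\<^sup>2 \<partial>P)"
    by (rule integral_mono) (use i Y2 V2 in \<open>auto intro: abs_mult_le_squares\<close>)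
  also have "\<dots> \<le> 2 + M_obs C q + M_res C q" using Y2 V2 by simp
  finally show ?thesis using cC by (simp add: Theta_bd_def pos_le_divide_eq)
qed

lemma scU_eq: "AE w in P. U w = scU sc \<theta>0 g0 l0 r0 w"
  using g0_eq by eventually_elim (cases sc; simp add: scU_def Uerr_def algebra_simps)

lemma scU_meas[measurable]: "scU sc \<theta>0 g0 l0 r0 \<in> borel_measurable P"
  unfolding scU_def[abs_def] by (cases sc) simp_all

lemma scD_meas[measurable]: "scD sc r0 \<in> borel_measurable P"
  unfolding scD_def[abs_def] by (cases sc) simp_all

lemma M_nonneg: "M_obs C q \<ge> 0" "M_proj C q \<ge> 0" "M_res C q \<ge> 0" "M_U c C q \<ge> 0" "Theta_bd c C q \<ge> 0"
  using cC by (auto simp: M_obs_def M_proj_def M_res_def M_U_def Theta_bd_def)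

lemma mom_scU: "mom P q (scU sc \<theta>0 g0 l0 r0) (M_U c C q)"
proof -
  have B: "mom P q (scU ScoreB \<theta>0 g0 l0 r0) (M_U c C q)"
  proof -
    have "mom P q (\<lambda>w. \<theta>0 * (Dv w - r0 (Xv w))) (\<bar>\<theta>0\<bar> powr q * M_res C q)"
      by (rule mom_cmult[OF mom_res(3)])
    then have "mom P q (\<lambda>w. \<theta>0 * (Dv w - r0 (Xv w))) (Theta_bd c C q powr q * M_res C q)"
      by (rule mom_mono) (use theta_bound M_nonneg q in \<open>auto intro!: mult_right_mono powr_mono2\<close>)
    then have "mom P q (\<lambda>w. (Yv w - l0 (Xv w)) - \<theta>0 * (Dv w - r0 (Xv w))) (M_U c C q)"
      unfolding M_U_def using q by (intro mom_diff mom_res) auto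
    then show ?thesis by (simp add: scU_def[abs_def])
  qed
  show ?thesis
    by (rule mom_cong_AE[OF B]) (use scU_eq[of ScoreB] scU_eq[of sc] in \<open>auto elim: eventually_elim2\<close>)
qed

lemma mom_scD: "mom P q (scD sc r0) (M_obs C q + M_res C q)"
  by (cases sc) (use mom_mono[OF mom_obs(2)] mom_mono[OF mom_res(3)] M_nonneg in \<open>simp_all add: scD_def[abs_def]\<close>)

lemma scU_orth:
  assumes u: "u \<in> borel_measurable SX" and i: "integrable P (\<lambda>w. (u (Xv w))\<^sup>2)"
  shows "(\<integral>w. scU sc \<theta>0 g0 l0 r0 w * u (Xv w) \<partial>P) = 0"
proof -
  have int: "integrable P (\<lambda>w. u (Xv w) * U w)"
    using u by (intro integrable_mult_squares i U_L2) auto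
  have "(\<integral>w. u (Xv w) * U w \<partial>P) = (\<integral>w. u (Xv w) * EcX U w \<partial>P)"
    by (rule FX.real_cond_exp_intg(2)[OF int X_meas[OF u] UV_meas(1), symmetric])
  also have "\<dots> = (\<integral>w. 0 \<partial>P)"
    by (rule integral_cong_AE) (use cond_exp_U u in \<open>auto intro: measurable_from_subalg[OF subalg_X]\<close>)
  finally have "(\<integral>w. u (Xv w) * U w \<partial>P) = 0" by simp
  moreover have "(\<integral>w. scU sc \<theta>0 g0 l0 r0 w * u (Xv w) \<partial>P) = (\<integral>w. u (Xv w) * U w \<partial>P)"
    by (rule integral_cong_AE) (use scU_eq[of sc] u in \<open>auto elim!: eventually_mono\<close>)
  ultimately show ?thesis by simp
qed

lemma cond_second_moment:
  assumes T: "T \<in> borel_measurable P" and cv: "AE w in P. EcX (\<lambda>w. (T w)\<^sup>2) w \<le> C"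
    and u: "u \<in> borel_measurable SX" and i: "integrable P (\<lambda>w. (u (Xv w))\<^sup>2)"
    and int: "integrable P (\<lambda>w. (T w * u (Xv w))\<^sup>2)"
  shows "(\<integral>w. (T w * u (Xv w))\<^sup>2 \<partial>P) \<le> C * sqn u"
proof -
  have int': "integrable P (\<lambda>w. (u (Xv w))\<^sup>2 * (T w)\<^sup>2)" using int by (simp add: power_mult_distrib mult.commute)
  have um: "(\<lambda>w. (u (Xv w))\<^sup>2) \<in> borel_measurable (sigma_X SX P)" using X_meas[OF u] by measurable
  have Tm: "(\<lambda>w. (T w)\<^sup>2) \<in> borel_measurable P" using T by measurable
  note c = FX.real_cond_exp_intg[OF int' um Tm]
  have "(\<integral>w. (T w * u (Xv w))\<^sup>2 \<partial>P) = (\<integral>w. (u (Xv w))\<^sup>2 * EcX (\<lambda>w. (T w)\<^sup>2) w \<partial>P)"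
    unfolding c(2) by (simp add: power_mult_distrib mult.commute)
  also have "\<dots> \<le> (\<integral>w. (u (Xv w))\<^sup>2 * C \<partial>P)"
    by (rule integral_mono_AE[OF c(1)]) (use i cv in \<open>auto elim!: eventually_mono intro!: mult_left_mono\<close>)
  finally show ?thesis by (simp add: mult.commute)
qed

lemma V_second:
  assumes u: "u \<in> borel_measurable SX" and m: "mom P q (\<lambda>w. u (Xv w)) M"
  shows "(\<integral>w. (V w * u (Xv w))\<^sup>2 \<partial>P) \<le> C * sqn u"
  using q by (intro cond_second_moment UV_meas condvar u mom_square(1)[OF prob_P m] mom_product_square(1)[OF prob_P mom_res(1) m]) auto

lemma scU_second:
  assumes u: "u \<in> borel_measurable SX" and m: "mom P q (\<lambda>w. u (Xv w)) M"
  shows "(\<integral>w. (scU sc \<theta>0 g0 l0 r0 w * u (Xv w))\<^sup>2 \<partial>P) \<le> C * sqn u"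
proof -
  have "mom P q U (M_U c C q)" using mom_scU[of ScoreA] by (simp add: scU_def[abs_def])
  then have "(\<integral>w. (U w * u (Xv w))\<^sup>2 \<partial>P) \<le> C * sqn u"
    using q by (intro cond_second_moment UV_meas condvar u mom_square(1)[OF prob_P m] mom_product_square(1)[OF prob_P _ m]) auto
  moreover have "(\<integral>w. (scU sc \<theta>0 g0 l0 r0 w * u (Xv w))\<^sup>2 \<partial>P) = (\<integral>w. (U w * u (Xv w))\<^sup>2 \<partial>P)"
    by (rule integral_cong_AE) (use scU_eq[of sc] u in \<open>auto elim!: eventually_mono\<close>)
  ultimately show ?thesis by simp
qed

lemma scU_V: "(\<integral>w. scU sc \<theta>0 g0 l0 r0 w * V w \<partial>P) = 0"
proof -
  have "(\<integral>w. scU sc \<theta>0 g0 l0 r0 w * V w \<partial>P) = (\<integral>w. U w * V w \<partial>P)"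
    by (rule integral_cong_AE) (use scU_eq[of sc] in \<open>auto elim!: eventually_mono\<close>)
  then show ?thesis using UV_orth by simp
qed

lemma scU_V2_eq: "(\<integral>w. (scU sc \<theta>0 g0 l0 r0 w * V w)\<^sup>2 \<partial>P) = (\<integral>w. (U w * V w)\<^sup>2 \<partial>P)"
  by (rule integral_cong_AE) (use scU_eq[of sc] in \<open>auto elim!: eventually_mono\<close>)

text \<open>The identification condition bounds the L2 norm of UV from below by c^2, hence its
  square by c^4.\<close>

lemma scU_V2: "(\<integral>w. (scU sc \<theta>0 g0 l0 r0 w * V w)\<^sup>2 \<partial>P) \<ge> c ^ 4"
proof -
  have "mom P q U (M_U c C q)" using mom_scU[of ScoreA] by (simp add: scU_def[abs_def])
  from mom_product_square(1)[OF prob_P this mom_res(1)] q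
  have i: "integrable P (\<lambda>w. (U w * V w)\<^sup>2)" by simp
  have "ennreal (c\<^sup>2) \<le> ennreal (sqrt (\<integral>w. (U w * V w)\<^sup>2 \<partial>P))"
    using ident(1) Lnorm_2_eq[OF _ i] by simp
  then have "c\<^sup>2 \<le> sqrt (\<integral>w. (U w * V w)\<^sup>2 \<partial>P)" by (simp add: ennreal_le_iff)
  then have "(c\<^sup>2)\<^sup>2 \<le> (sqrt (\<integral>w. (U w * V w)\<^sup>2 \<partial>P))\<^sup>2" by (intro power_mono) auto
  then show ?thesis unfolding scU_V2_eq by (simp flip: power_mult)
qed

text \<open>Partialling r0(X) out of D leaves the Jacobian unchanged because E[V | X] = 0; this is
  why both scores share one asymptotic variance.\<close>

lemma scD_V: "(\<integral>w. scD sc r0 w * V w \<partial>P) = (\<integral>w. Dv w * V w \<partial>P)"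
proof (cases sc)
  case ScoreB
  have V2: "integrable P (\<lambda>w. (V w)\<^sup>2)" using mom_square[OF prob_P mom_res(1)] q by auto
  have D2: "integrable P (\<lambda>w. (Dv w)\<^sup>2)" using mom_square[OF prob_P mom_obs(2)] q by auto
  have i: "integrable P (\<lambda>w. Dv w * V w)" "integrable P (\<lambda>w. V w * r0 (Xv w))"
    by (intro integrable_mult_squares V2 D2 nuis_L2; measurable)+
  have "(\<integral>w. scD sc r0 w * V w \<partial>P) = (\<integral>w. Dv w * V w - V w * r0 (Xv w) \<partial>P)"
    by (simp add: ScoreB scD_def algebra_simps)
  also have "\<dots> = (\<integral>w. Dv w * V w \<partial>P)" using i V_orth[OF nuis_meas(4) nuis_L2(4)] by simp
  finally show ?thesis .
qed (simp add: scD_def)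

lemma sigma2_eq: "sigma2 P \<theta>0 g0 m0 =
  (\<integral>w. (scU sc \<theta>0 g0 l0 r0 w * V w)\<^sup>2 \<partial>P) / (\<integral>w. scD sc r0 w * V w \<partial>P)\<^sup>2"
proof -
  have eq: "(V w)\<^sup>2 * (U w)\<^sup>2 = (U w * V w)\<^sup>2" for w by (simp add: power_mult_distrib mult.commute)
  have "inverse x * y * inverse x = y / x\<^sup>2" for x y :: real
    by (simp add: power2_eq_square divide_inverse mult_ac)
  then show ?thesis unfolding sigma2_def scD_V scU_V2_eq eq .
qed

end

section \<open>Error bounds on the good event\<close>

definition M_H :: "real \<Rightarrow> real \<Rightarrow> real \<Rightarrow> real" where
  "M_H c C q = 2 powr q * (M_obs C q + Theta_bd c C q powr q * M_obs C q)"
definition A_H :: "real \<Rightarrow> real \<Rightarrow> real \<Rightarrow> real" where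
  "A_H c C q = 2 * (1 + (Theta_bd c C q)\<^sup>2)"
definition M_score :: "real \<Rightarrow> real \<Rightarrow> real" where
  "M_score C q = 1 + (2 powr q * ((M_obs C q + M_res C q) + M_obs C q) + 2 powr q * (M_res C q + M_obs C q))"
definition B_bd :: "real \<Rightarrow> real \<Rightarrow> real \<Rightarrow> real" where
  "B_bd c C q = M_score C q + (1 + (M_obs C q + M_res C q)) + (1 + M_res C q) + (1 + (M_obs C q + M_res C q + M_res C q)) + (M_U c C q + M_res C q)"
text \<open>The sum of all coefficients that arise in the error bounds, so that one rate
  \<open>d_rate\<close> dominates each of them. Its powers of \<delta> come from the interpolation
  (first and last), the product rate (first) and the conditional second moments (square).\<close>

definition C_rate :: "real \<Rightarrow> real \<Rightarrow> real \<Rightarrow> real" where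
  "C_rate c C q = 1 + C + C * A_H c C q + 2 * (1 + Theta_bd c C q) + (A_H c C q + 1) + (M_H c C q + M_obs C q)"
definition d_rate :: "real \<Rightarrow> real \<Rightarrow> real \<Rightarrow> real \<Rightarrow> real" where
  "d_rate c C q \<delta> = C_rate c C q * (\<delta> + \<delta>\<^sup>2 + \<delta> powr ((q - 4) / 2))"

context pliv
begin

lemma bd_nonneg: "M_H c C q \<ge> 0" "A_H c C q \<ge> 0" "M_score C q \<ge> 0" "B_bd c C q \<ge> 0" "C_rate c C q \<ge> 0"
proof -
  show H: "M_H c C q \<ge> 0" "A_H c C q \<ge> 0" "M_score C q \<ge> 0"
    using M_nonneg by (simp_all add: M_H_def A_H_def M_score_def)
  then show "B_bd c C q \<ge> 0" "C_rate c C q \<ge> 0"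
    using M_nonneg cC by (simp_all add: B_bd_def C_rate_def)
qed

lemma component_bounds:
  fixes u :: "'x \<Rightarrow> real"
  assumes u[measurable]: "u \<in> borel_measurable SX" and uq: "fnorm P q u \<le> ennreal C"
    and u2: "fnorm P 2 u \<le> ennreal \<delta>" and \<delta>: "\<delta> > 0"
  shows "mom P q (\<lambda>w. u (Xv w)) (M_obs C q)" "sqn u \<le> \<delta>\<^sup>2"
    "fnorm P 2 u = ennreal (sqrt (sqn u))"
proof -
  show m: "mom P q (\<lambda>w. u (Xv w)) (M_obs C q)"
    unfolding M_obs_def using uq q cC by (intro Lnorm_le_D prob_P) (auto simp: fnorm_def)
  show 1: "fnorm P 2 u = ennreal (sqrt (sqn u))"
    unfolding fnorm_def using mom_square(1)[OF prob_P m] q by (intro Lnorm_2_eq) auto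
  have "sqrt (sqn u) \<le> \<delta>" using u2 \<delta> unfolding 1 by simp
  then have "(sqrt (sqn u))\<^sup>2 \<le> \<delta>\<^sup>2" by (intro power_mono) auto
  then show "sqn u \<le> \<delta>\<^sup>2" by simp
qed

section \<open>Consequences of the rates for one realised nuisance estimate\<close>

context
  fixes \<eta> :: "'x nuis" and sc :: score and \<delta> b :: real
  assumes \<eta>m[measurable]: "nf \<eta> \<in> borel_measurable SX" "nm \<eta> \<in> borel_measurable SX" "nr \<eta> \<in> borel_measurable SX"
    and \<eta>q: "nuis_dist sc P q \<eta> (eta0 sc g0 m0 l0 r0) \<le> ennreal C"
    and \<eta>2: "nuis_dist sc P 2 \<eta> (eta0 sc g0 m0 l0 r0) \<le> ennreal \<delta>"
    and rate: "rate_cond sc P b \<eta> (eta0 sc g0 m0 l0 r0)"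
    and \<delta>: "\<delta> > 0" and b: "b \<ge> 0"
begin

abbreviation "h \<equiv> \<lambda>x. scH sc \<theta>0 g0 l0 r0 \<eta> x"
abbreviation "m \<equiv> \<lambda>x. nm \<eta> x - m0 x"
abbreviation "s \<equiv> \<lambda>x. scS sc r0 \<eta> x"
abbreviation "U' \<equiv> scU sc \<theta>0 g0 l0 r0"
abbreviation "D' \<equiv> scD sc r0"

lemma hms_meas[measurable]: "h \<in> borel_measurable SX" "m \<in> borel_measurable SX" "s \<in> borel_measurable SX"
  unfolding scH_def[abs_def] scS_def[abs_def] by (cases sc; simp; measurable)+

lemma m_bounds: "mom P q (\<lambda>w. m (Xv w)) (M_obs C q)" "sqn m \<le> \<delta>\<^sup>2"
    "fnorm P 2 m = ennreal (sqrt (sqn m))"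
proof -
  have "fnorm P q m \<le> ennreal C" "fnorm P 2 m \<le> ennreal \<delta>"
    using \<eta>q \<eta>2 by (cases sc; simp add: nuis_dist_def eta0_def nm_def)+
  note component_bounds[OF hms_meas(2) this \<delta>]
  then show "mom P q (\<lambda>w. m (Xv w)) (M_obs C q)" "sqn m \<le> \<delta>\<^sup>2"
    "fnorm P 2 m = ennreal (sqrt (sqn m))" by auto
qed

lemma s_bounds: "mom P q (\<lambda>w. s (Xv w)) (M_obs C q)" "sqn s \<le> \<delta>\<^sup>2"
  and s_norm: "sc = ScoreB \<Longrightarrow> fnorm P 2 s = ennreal (sqrt (sqn s))"
proof -
  have "mom P q (\<lambda>w. s (Xv w)) (M_obs C q) \<and> sqn s \<le> \<delta>\<^sup>2 \<and> (sc = ScoreB \<longrightarrow> fnorm P 2 s = ennreal (sqrt (sqn s)))"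
  proof (cases sc)
    case ScoreA
    then show ?thesis using M_nonneg by (simp add: scS_def mom_def)
  next
    case ScoreB
    then have "fnorm P q s \<le> ennreal C" "fnorm P 2 s \<le> ennreal \<delta>"
      using \<eta>q \<eta>2 by (simp_all add: nuis_dist_def eta0_def nr_def scS_def)
    from component_bounds[OF hms_meas(3) this \<delta>] show ?thesis by blast
  qed
  then show "mom P q (\<lambda>w. s (Xv w)) (M_obs C q)" "sqn s \<le> \<delta>\<^sup>2"
    "sc = ScoreB \<Longrightarrow> fnorm P 2 s = ennreal (sqrt (sqn s))" by auto
qed

text \<open>The error of the first factor is h = f - \<theta>0 s, with f the error in g or l and s =
  0 for score (A). The bound on \<theta>0 gives a norm of h of at most 2 (1 +
  \<open>Theta_bd c C q\<close>) times the sum of the norms of s and f, which converts the assumed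
  product rate into the third claim.\<close>

lemma h_bounds:
  "mom P q (\<lambda>w. h (Xv w)) (M_H c C q)" "sqn h \<le> A_H c C q * \<delta>\<^sup>2"
  "sqrt (sqn h) * sqrt (sqn m) \<le> 2 * (1 + Theta_bd c C q) * b"
proof -
  let ?T = "Theta_bd c C q"
  have T: "?T \<ge> 0" by (rule M_nonneg)
  define f where "f x = nf \<eta> x - (case sc of ScoreA \<Rightarrow> g0 x | ScoreB \<Rightarrow> l0 x)" for x
  have fm[measurable]: "f \<in> borel_measurable SX" unfolding f_def[abs_def] by (cases sc; simp)
  have "fnorm P q f \<le> ennreal C" "fnorm P 2 f \<le> ennreal \<delta>"
    using \<eta>q \<eta>2 by (cases sc; simp add: nuis_dist_def eta0_def nf_def f_def[abs_def])+
  note f = component_bounds[OF fm this \<delta>]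
  let ?a = "sqrt (sqn f)" and ?b = "sqrt (sqn s)"
  have h: "h x = f x - \<theta>0 * s x" for x by (cases sc) (simp_all add: scH_def scS_def f_def)
  have r': "mom P q (\<lambda>w. \<theta>0 * s (Xv w)) (?T powr q * M_obs C q)"
    by (rule mom_mono[OF mom_cmult[OF s_bounds(1)]])
       (use theta_bound M_nonneg q in \<open>auto intro!: mult_right_mono powr_mono2\<close>)
  show 1: "mom P q (\<lambda>w. h (Xv w)) (M_H c C q)"
    unfolding h M_H_def using q by (intro mom_diff f(1) r') auto
  have i: "integrable P (\<lambda>w. (f (Xv w))\<^sup>2)" "integrable P (\<lambda>w. (s (Xv w))\<^sup>2)" "integrable P (\<lambda>w. (h (Xv w))\<^sup>2)"
    using mom_square(1)[OF prob_P f(1)] mom_square(1)[OF prob_P s_bounds(1)] mom_square(1)[OF prob_P 1] q by auto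
  have "\<theta>0\<^sup>2 \<le> ?T\<^sup>2" using theta_bound by (simp add: abs_le_square_iff[symmetric])
  have "sqn h \<le> (\<integral>w. 2 * (f (Xv w))\<^sup>2 + 2 * ?T\<^sup>2 * (s (Xv w))\<^sup>2 \<partial>P)"
  proof (rule integral_mono[OF i(3)])
    fix w
    have "(h (Xv w))\<^sup>2 \<le> 2 * (f (Xv w))\<^sup>2 + 2 * (\<theta>0 * s (Xv w))\<^sup>2" unfolding h by (rule square_diff_le)
    also have "\<dots> \<le> 2 * (f (Xv w))\<^sup>2 + 2 * ?T\<^sup>2 * (s (Xv w))\<^sup>2"
      using \<open>\<theta>0\<^sup>2 \<le> ?T\<^sup>2\<close> by (simp add: power_mult_distrib mult_right_mono)
    finally show "(h (Xv w))\<^sup>2 \<le> 2 * (f (Xv w))\<^sup>2 + 2 * ?T\<^sup>2 * (s (Xv w))\<^sup>2" .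
  qed (use i in auto)
  also have "\<dots> = 2 * ?a\<^sup>2 + 2 * ?T\<^sup>2 * ?b\<^sup>2" using i by simp
  finally have h2: "sqn h \<le> 2 * ?a\<^sup>2 + 2 * ?T\<^sup>2 * ?b\<^sup>2" .
  have "\<dots> \<le> 2 * \<delta>\<^sup>2 + 2 * ?T\<^sup>2 * \<delta>\<^sup>2" using f(2) s_bounds(2) by (intro add_mono mult_left_mono) auto
  also have "\<dots> = A_H c C q * \<delta>\<^sup>2" by (simp add: A_H_def algebra_simps)
  finally show "sqn h \<le> A_H c C q * \<delta>\<^sup>2" using h2 by linarith
  have ab: "0 \<le> ?a" "0 \<le> ?b" by auto
  have "2 * ?a\<^sup>2 + 2 * ?T\<^sup>2 * ?b\<^sup>2 \<le> (2 * ?a + 2 * ?T * ?b)\<^sup>2"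
  proof -
    have "0 \<le> 2 * ?a\<^sup>2 + 2 * (?T * ?b)\<^sup>2 + 8 * (?a * (?T * ?b))" using ab T by simp
    then show ?thesis by (simp only: power2_eq_square) (simp add: algebra_simps)
  qed
  also have "\<dots> \<le> (2 * (1 + ?T) * (?b + ?a))\<^sup>2"
    using ab T by (intro power_mono) (auto simp: algebra_simps)
  finally have hs: "sqrt (sqn h) \<le> 2 * (1 + ?T) * (?b + ?a)"
    using ab T h2 by (intro real_le_lsqrt) auto
  have "fnorm P 2 m * (ennreal ?b + fnorm P 2 f) \<le> ennreal b"
    using rate s_norm by (cases sc; simp add: rate_cond_def eta0_def nf_def nm_def nr_def f_def[abs_def] scS_def)
  then have "ennreal (sqrt (sqn m) * (?b + ?a)) \<le> ennreal b"
    unfolding f(3) m_bounds(3) by (simp add: ennreal_mult ennreal_plus)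
  then have mb: "(?b + ?a) * sqrt (sqn m) \<le> b" using b by (simp add: mult.commute)
  have "sqrt (sqn h) * sqrt (sqn m) \<le> 2 * (1 + ?T) * (?b + ?a) * sqrt (sqn m)"
    by (intro mult_right_mono hs) auto
  also have "\<dots> = 2 * (1 + ?T) * ((?b + ?a) * sqrt (sqn m))" by simp
  also have "\<dots> \<le> 2 * (1 + ?T) * b" using T by (intro mult_left_mono mb) auto
  finally show "sqrt (sqn h) * sqrt (sqn m) \<le> 2 * (1 + Theta_bd c C q) * b" .
qed

lemma sq_int: "integrable P (\<lambda>w. (h (Xv w))\<^sup>2)" "integrable P (\<lambda>w. (m (Xv w))\<^sup>2)" "integrable P (\<lambda>w. (s (Xv w))\<^sup>2)"
  using mom_square(1)[OF prob_P h_bounds(1)] mom_square(1)[OF prob_P m_bounds(1)] mom_square(1)[OF prob_P s_bounds(1)] q by auto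

lemma d_rate_ge:
  assumes "x \<ge> 0" "y \<ge> 0" "t \<ge> 0" "x + y + t \<le> C_rate c C q"
  shows "x * \<delta> + y * \<delta>\<^sup>2 + t * \<delta> powr ((q - 4) / 2) \<le> d_rate c C q \<delta>"
proof -
  have "x * \<delta> + y * \<delta>\<^sup>2 + t * \<delta> powr ((q - 4) / 2) \<le> C_rate c C q * \<delta> + C_rate c C q * \<delta>\<^sup>2 + C_rate c C q * \<delta> powr ((q - 4) / 2)"
    using assms \<delta> by (intro add_mono mult_right_mono) auto
  then show ?thesis by (simp add: d_rate_def algebra_simps)
qed

lemma coef_le: "C \<le> C_rate c C q" "C * A_H c C q \<le> C_rate c C q" "1 \<le> C_rate c C q" "2 * (1 + Theta_bd c C q) \<le> C_rate c C q"
  "(A_H c C q + 1) + (M_H c C q + M_obs C q) \<le> C_rate c C q"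
  using bd_nonneg M_nonneg cC mult_nonneg_nonneg[of C "A_H c C q"] by (simp_all add: C_rate_def)

lemma good_orth: "(\<integral>w. U' w * m (Xv w) \<partial>P) = 0" "(\<integral>w. V w * h (Xv w) \<partial>P) = 0"
  using scU_orth[OF hms_meas(2) sq_int(2)] V_orth[OF hms_meas(1) sq_int(1)] by auto

lemma good_Um: "(\<integral>\<^sup>+w. ennreal ((U' w * m (Xv w))\<^sup>2) \<partial>P) \<le> ennreal (d_rate c C q \<delta>)"
proof (rule nn_square_le)
  show "integrable P (\<lambda>w. (U' w * m (Xv w))\<^sup>2)"
    using mom_product_square(1)[OF prob_P mom_scU m_bounds(1)] q by simp
  have "(\<integral>w. (U' w * m (Xv w))\<^sup>2 \<partial>P) \<le> C * sqn m"
    by (rule scU_second[OF hms_meas(2) m_bounds(1)])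
  also have "\<dots> \<le> C * \<delta>\<^sup>2" using cC by (intro mult_left_mono m_bounds) auto
  also have "\<dots> \<le> d_rate c C q \<delta>" using d_rate_ge[of 0 C 0] cC coef_le by simp
  finally show "(\<integral>w. (U' w * m (Xv w))\<^sup>2 \<partial>P) \<le> d_rate c C q \<delta>" .
qed

lemma good_Vh: "(\<integral>\<^sup>+w. ennreal ((V w * h (Xv w))\<^sup>2) \<partial>P) \<le> ennreal (d_rate c C q \<delta>)"
proof (rule nn_square_le)
  show "integrable P (\<lambda>w. (V w * h (Xv w))\<^sup>2)"
    using mom_product_square(1)[OF prob_P mom_res(1) h_bounds(1)] q by simp
  have "(\<integral>w. (V w * h (Xv w))\<^sup>2 \<partial>P) \<le> C * sqn h"
    by (rule V_second[OF hms_meas(1) h_bounds(1)])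
  also have "\<dots> \<le> C * (A_H c C q * \<delta>\<^sup>2)" using cC by (intro mult_left_mono h_bounds) auto
  also have "\<dots> \<le> d_rate c C q \<delta>" using d_rate_ge[of 0 "C * A_H c C q" 0] cC bd_nonneg coef_le by simp
  finally show "(\<integral>w. (V w * h (Xv w))\<^sup>2 \<partial>P) \<le> d_rate c C q \<delta>" .
qed

lemma good_mm: "(\<integral>\<^sup>+w. ennreal ((m (Xv w))\<^sup>2) \<partial>P) \<le> ennreal (d_rate c C q \<delta>)"
  by (rule nn_square_le[OF sq_int(2)], rule order_trans[OF m_bounds(2)])
     (use d_rate_ge[of 0 1 0] coef_le in simp)

lemma good_ss: "(\<integral>\<^sup>+w. ennreal ((s (Xv w))\<^sup>2) \<partial>P) \<le> ennreal (d_rate c C q \<delta>)"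
  by (rule nn_square_le[OF sq_int(3)], rule order_trans[OF s_bounds(2)])
     (use d_rate_ge[of 0 1 0] coef_le in simp)

lemma good_hm2: "(\<integral>\<^sup>+w. ennreal ((h (Xv w) * m (Xv w))\<^sup>2) \<partial>P) \<le> ennreal (d_rate c C q \<delta>)"
proof (rule nn_square_le)
  show "integrable P (\<lambda>w. (h (Xv w) * m (Xv w))\<^sup>2)"
    using mom_product_square(1)[OF prob_P h_bounds(1) m_bounds(1)] q by simp
  have "(\<integral>w. (h (Xv w) * m (Xv w))\<^sup>2 \<partial>P) \<le> (A_H c C q + 1) * \<delta> + (M_H c C q + M_obs C q) * \<delta> powr ((q - 4) / 2)"
    using m_bounds(2) by (intro product_square_bound[OF prob_P h_bounds(1) m_bounds(1) q h_bounds(2) _ \<delta>]) simp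
  also have "\<dots> \<le> d_rate c C q \<delta>"
    using d_rate_ge[of "A_H c C q + 1" 0 "M_H c C q + M_obs C q"] bd_nonneg M_nonneg coef_le(5) by simp
  finally show "(\<integral>w. (h (Xv w) * m (Xv w))\<^sup>2 \<partial>P) \<le> d_rate c C q \<delta>" .
qed

lemma good_hm1: "(\<integral>\<^sup>+w. ennreal \<bar>h (Xv w) * m (Xv w)\<bar> \<partial>P) \<le> ennreal (2 * (1 + Theta_bd c C q) * b)"
proof -
  have "(\<integral>\<^sup>+w. ennreal \<bar>h (Xv w) * m (Xv w)\<bar> \<partial>P) \<le> ennreal (sqrt (sqn h) * sqrt (sqn m))"
    by (rule integral_Cauchy_Schwarz[OF _ _ sq_int(1,2)]) measurable
  also have "\<dots> \<le> ennreal (2 * (1 + Theta_bd c C q) * b)" by (rule ennreal_leI[OF h_bounds(3)])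
  finally show ?thesis .
qed

lemma good_aa: "(\<integral>\<^sup>+w. ennreal (((D' w - s (Xv w)) * (V w - m (Xv w)))\<^sup>2) \<partial>P) \<le> ennreal (B_bd c C q)"
proof (rule nn_square_le)
  have 1: "mom P q (\<lambda>w. D' w - s (Xv w)) (2 powr q * ((M_obs C q + M_res C q) + M_obs C q))"
    using q by (intro mom_diff mom_scD s_bounds) auto
  have 2: "mom P q (\<lambda>w. V w - m (Xv w)) (2 powr q * (M_res C q + M_obs C q))"
    using q by (intro mom_diff mom_res m_bounds) auto
  note 3 = mom_product_square[OF prob_P 1 2]
  show "integrable P (\<lambda>w. ((D' w - s (Xv w)) * (V w - m (Xv w)))\<^sup>2)" using 3(1) q by simp
  have "(\<integral>w. ((D' w - s (Xv w)) * (V w - m (Xv w)))\<^sup>2 \<partial>P) \<le> M_score C q" using 3(2) q by (simp add: M_score_def)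
  also have "\<dots> \<le> B_bd c C q" using M_nonneg by (simp add: B_bd_def)
  finally show "(\<integral>w. ((D' w - s (Xv w)) * (V w - m (Xv w)))\<^sup>2 \<partial>P) \<le> B_bd c C q" .
qed

end

lemma global_bounds:
  "(\<integral>\<^sup>+w. ennreal ((scD sc r0 w)\<^sup>2) \<partial>P) \<le> ennreal (B_bd c C q)"
  "(\<integral>\<^sup>+w. ennreal ((V w)\<^sup>2) \<partial>P) \<le> ennreal (B_bd c C q)"
  "(\<integral>\<^sup>+w. ennreal ((scD sc r0 w * V w)\<^sup>2) \<partial>P) \<le> ennreal (B_bd c C q)"
  "integrable P (\<lambda>w. \<bar>scU sc \<theta>0 g0 l0 r0 w * V w\<bar> powr (q / 2))"
  "(\<integral>w. \<bar>scU sc \<theta>0 g0 l0 r0 w * V w\<bar> powr (q / 2) \<partial>P) \<le> B_bd c C q"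
  "integrable P (\<lambda>w. (scU sc \<theta>0 g0 l0 r0 w * V w)\<^sup>2)"
proof -
  note nn = M_nonneg bd_nonneg(3)
  show "(\<integral>\<^sup>+w. ennreal ((scD sc r0 w)\<^sup>2) \<partial>P) \<le> ennreal (B_bd c C q)"
    using mom_square[OF prob_P mom_scD[of sc]] q nn by (intro nn_square_le) (auto simp: B_bd_def)
  show "(\<integral>\<^sup>+w. ennreal ((V w)\<^sup>2) \<partial>P) \<le> ennreal (B_bd c C q)"
    using mom_square[OF prob_P mom_res(1)] q nn by (intro nn_square_le) (auto simp: B_bd_def)
  show "(\<integral>\<^sup>+w. ennreal ((scD sc r0 w * V w)\<^sup>2) \<partial>P) \<le> ennreal (B_bd c C q)"
    using mom_product_square[OF prob_P mom_scD[of sc] mom_res(1)] q nn by (intro nn_square_le) (auto simp: B_bd_def)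
  have m: "mom P (q / 2) (\<lambda>w. scU sc \<theta>0 g0 l0 r0 w * V w) (M_U c C q + M_res C q)"
    using q by (intro mom_mult mom_scU mom_res) auto
  show "integrable P (\<lambda>w. \<bar>scU sc \<theta>0 g0 l0 r0 w * V w\<bar> powr (q / 2))" by (rule mom_integrable[OF m])
  show "(\<integral>w. \<bar>scU sc \<theta>0 g0 l0 r0 w * V w\<bar> powr (q / 2) \<partial>P) \<le> B_bd c C q"
    using mom_le[OF m] nn by (simp add: B_bd_def)
  show "integrable P (\<lambda>w. (scU sc \<theta>0 g0 l0 r0 w * V w)\<^sup>2)"
    using mom_product_square(1)[OF prob_P mom_scU mom_res(1)] q by simp
qed

end

section \<open>Normal quantiles and measurability of the learner\<close>

interpretation N01: real_distribution N01
  unfolding N01_def by (rule real_dist_normal_dist)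

lemma N01_null:
  assumes "A \<in> sets borel" "emeasure lborel A = 0"
  shows "emeasure N01 A = 0"
proof -
  have "A \<in> null_sets lborel" using assms by auto
  then have "AE x in lborel. x \<notin> A" by (rule AE_not_in)
  then show ?thesis unfolding N01_def using assms
    by (subst emeasure_density) (auto intro!: nn_integral_0_iff_AE[THEN iffD2] elim!: eventually_mono)
qed

lemma isCont_Phi: "isCont Phi x"
proof -
  have "measure N01 {x} = 0" using N01_null[of "{x}"] by (simp add: measure_def)
  then show ?thesis unfolding Phi_def[abs_def] using N01.isCont_cdf by simp
qed

text \<open>Equality would give an interval of positive length zero mass, contradicting the positive
  density. Strictness makes the quantile in \<open>Phi_inv\<close> unique.\<close>

lemma Phi_strict_mono:
  assumes "x < y"
  shows "Phi x < Phi y"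
proof -
  have "Phi x \<noteq> Phi y"
  proof
    assume eq: "Phi x = Phi y"
    have "Phi y - Phi x = measure N01 {x<..y}"
      unfolding Phi_def using N01.cdf_diff_eq[OF assms] by simp
    with eq have "emeasure N01 {x<..y} = 0" by (simp add: N01.emeasure_eq_measure)
    then have "AE z in lborel. ennreal (std_normal_density z) * indicator {x<..y} z = 0"
      unfolding N01_def by (subst (asm) emeasure_density) (auto simp: nn_integral_0_iff_AE)
    then have "AE z in lborel. z \<notin> {x<..y}"
      by eventually_elim (auto simp: indicator_def std_normal_density_def split: if_splits)
    then have "emeasure lborel {x<..y} = 0"
      by (subst (asm) AE_iff_measurable[of "{x<..y}"]) auto
    with assms show False by simp
  qed
  moreover have "Phi x \<le> Phi y" unfolding Phi_def using assms by (intro N01.cdf_nondecreasing) simp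
  ultimately show ?thesis by simp
qed

lemma Phi_minus: "Phi (- z) = 1 - Phi z"
proof -
  have sets: "sets N01 = sets borel" by (simp add: N01_def)
  have "emeasure N01 {..- z} = (\<integral>\<^sup>+x. ennreal (std_normal_density x) * indicator {..- z} x \<partial>lborel)"
    unfolding N01_def by (rule emeasure_density) auto
  also have "\<dots> = (\<integral>\<^sup>+x. ennreal (std_normal_density x) * indicator {..- z} x \<partial>distr lborel borel uminus)"
    by (simp add: lborel_distr_uminus)
  also have "\<dots> = (\<integral>\<^sup>+x. ennreal (std_normal_density (- x)) * indicator {..- z} (- x) \<partial>lborel)"
    by (rule nn_integral_distr) auto
  also have "\<dots> = (\<integral>\<^sup>+x. ennreal (std_normal_density x) * indicator {z..} x \<partial>lborel)"
    by (intro nn_integral_cong) (auto simp: std_normal_density_def indicator_def)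
  also have "\<dots> = emeasure N01 {z..}"
    unfolding N01_def by (rule emeasure_density[symmetric]) auto
  also have "\<dots> = emeasure N01 {z<..}"
  proof (rule emeasure_eq_AE)
    have "emeasure N01 {z} = 0" by (rule N01_null) auto
    then have "AE x in N01. x \<noteq> z" by (subst AE_iff_measurable[of "{z}"]) (auto simp: sets)
    then show "AE x in N01. x \<in> {z..} \<longleftrightarrow> x \<in> {z<..}" by eventually_elim auto
  qed (auto simp: sets)
  finally have "measure N01 {..- z} = measure N01 {z<..}" by (simp add: measure_def)
  also have "{z<..} = space N01 - {..z}" by (auto simp: N01_def)
  also have "measure N01 (space N01 - {..z}) = 1 - measure N01 {..z}"
    by (rule N01.prob_compl) (simp add: sets)
  finally show ?thesis by (simp add: Phi_def cdf_def)
qed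

text \<open>\<open>Phi_inv\<close> is a definite description: existence comes from the intermediate
  value theorem and the limits at both ends, uniqueness from strict monotonicity.\<close>

lemma Phi_Phi_inv:
  assumes "0 < p" "p < 1"
  shows "Phi (Phi_inv p) = p"
proof -
  have "(Phi \<longlongrightarrow> 0) at_bot" unfolding Phi_def[abs_def] using N01.cdf_lim_at_bot by simp
  then have "eventually (\<lambda>x. Phi x < p) at_bot" using assms by (intro order_tendstoD(2)) auto
  then obtain x where x: "Phi x < p" by (auto simp: eventually_at_bot_linorder)
  have "(Phi \<longlongrightarrow> 1) at_top" unfolding Phi_def[abs_def] using N01.cdf_lim_at_top_prob by simp
  then have "eventually (\<lambda>x. Phi x > p) at_top" using assms by (intro order_tendstoD(1)) auto
  then obtain y where y: "Phi y > p" by (auto simp: eventually_at_top_linorder)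
  have "x \<le> y"
  proof (rule ccontr)
    assume "\<not> x \<le> y"
    then have "Phi y < Phi x" by (intro Phi_strict_mono) simp
    with x y show False by simp
  qed
  then obtain z where z: "Phi z = p"
    using IVT[of Phi x p y] x y isCont_Phi by auto
  have "Phi_inv p = z" unfolding Phi_inv_def
  proof (rule the_equality)
    fix z' assume "Phi z' = p"
    with z show "z' = z" using Phi_strict_mono[of z z'] Phi_strict_mono[of z' z] by (cases z z' rule: linorder_cases) auto
  qed (rule z)
  then show ?thesis using z by simp
qed

lemma N01_symmetric_interval:
  assumes "0 < \<alpha>" "\<alpha> < 1"
  shows "measure N01 {- Phi_inv (1 - \<alpha> / 2) .. Phi_inv (1 - \<alpha> / 2)} = 1 - \<alpha>"
proof -
  let ?z = "Phi_inv (1 - \<alpha> / 2)"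
  have z: "Phi ?z = 1 - \<alpha> / 2" by (rule Phi_Phi_inv) (use assms in auto)
  have "Phi 0 = 1 / 2" using Phi_minus[of 0] by simp
  then have pos: "?z > 0" using z assms Phi_strict_mono[of ?z 0] by (cases ?z "0::real" rule: linorder_cases) auto
  have sets: "sets N01 = sets borel" by (simp add: N01_def)
  \<comment> \<open>Differences of distribution functions measure half-open intervals; the left end
    point has mass zero.\<close>
  have "measure N01 {- ?z .. ?z} = measure N01 {- ?z <.. ?z}"
  proof (rule measure_eq_AE)
    have "emeasure N01 {- ?z} = 0" by (rule N01_null) auto
    then have "AE x in N01. x \<noteq> - ?z" by (subst AE_iff_measurable[of "{- ?z}"]) (auto simp: sets)
    then show "AE x in N01. x \<in> {- ?z .. ?z} \<longleftrightarrow> x \<in> {- ?z <.. ?z}" by eventually_elim auto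
  qed (auto simp: sets)
  also have "\<dots> = Phi ?z - Phi (- ?z)" unfolding Phi_def using N01.cdf_diff_eq[of "- ?z" ?z] pos by simp
  also have "\<dots> = 1 - \<alpha>" unfolding Phi_minus z by (simp add: field_simps)
  finally show ?thesis .
qed

text \<open>Needed for the good event, which compares norms of the fitted errors with the rates, to
  be a measurable set of samples.\<close>

lemma Lnorm_measurable:
  assumes P: "prob_space P" and F[measurable]: "(\<lambda>(\<omega>, w). F \<omega> w) \<in> borel_measurable (M \<Otimes>\<^sub>M P)"
  shows "(\<lambda>\<omega>. Lnorm P p (F \<omega>)) \<in> borel_measurable M"
proof -
  interpret prob_space P by fact
  have [measurable]: "(\<lambda>\<omega>. \<integral>\<^sup>+w. ennreal (\<bar>F \<omega> w\<bar> powr p) \<partial>P) \<in> borel_measurable M" by measurable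
  show ?thesis unfolding Lnorm_def Let_def by measurable
qed

locale dml_setting =
  fixes SX :: "'x measure"
    and Pfam :: "'x obs measure set"
    and theta0 :: "'x obs measure \<Rightarrow> real"
    and g0 m0 l0 r0 :: "'x obs measure \<Rightarrow> 'x \<Rightarrow> real"
    and K :: nat and c C q :: real
    and delta Delta eps :: "nat \<Rightarrow> real"
    and sc :: score
    and etahat :: "nat \<Rightarrow> nat set \<Rightarrow> (nat \<Rightarrow> 'x obs) \<Rightarrow> 'x nuis"
  assumes K: "K \<ge> 2"
    and cC: "c > 0" "C > 0" and q: "q > 4"
    and delta: "\<forall>N. delta N > 0" "delta \<longlonglongrightarrow> 0"
    and Delta: "\<forall>N. Delta N > 0" "Delta \<longlonglongrightarrow> 0"
    and eps: "\<forall>N. eps N \<ge> 0" "(\<lambda>N. eps N / (delta N / sqrt (real N))) \<longlonglongrightarrow> 0"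
    and pliv_P: "P \<in> Pfam \<Longrightarrow> pliv SX P (theta0 P) (g0 P) (m0 P) (l0 P) (r0 P) c C q"
    and learner_local: "\<forall>N I \<omega> \<omega>'. (\<forall>i\<in>{..<N} - I. \<omega> i = \<omega>' i) \<longrightarrow> etahat N I \<omega> = etahat N I \<omega>'"
    and learner_meas: "\<forall>N I. (\<lambda>(\<omega>, x). nf (etahat N I \<omega>) x) \<in> borel_measurable (PiM {..<N} (\<lambda>_. obs_space SX) \<Otimes>\<^sub>M SX)
                       \<and> (\<lambda>(\<omega>, x). nm (etahat N I \<omega>) x) \<in> borel_measurable (PiM {..<N} (\<lambda>_. obs_space SX) \<Otimes>\<^sub>M SX)
                       \<and> (\<lambda>(\<omega>, x). nr (etahat N I \<omega>) x) \<in> borel_measurable (PiM {..<N} (\<lambda>_. obs_space SX) \<Otimes>\<^sub>M SX)"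
    and learner_rate: "\<forall>P\<in>Pfam. \<forall>n I. I \<subseteq> {..<K*n} \<and> card I = n \<longrightarrow>
         measure (PiM {..<K*n} (\<lambda>_. P))
           {\<omega> \<in> space (PiM {..<K*n} (\<lambda>_. P)).
              nuis_dist sc P q (etahat (K*n) I \<omega>) (eta0 sc (g0 P) (m0 P) (l0 P) (r0 P)) \<le> ennreal C
            \<and> nuis_dist sc P 2 (etahat (K*n) I \<omega>) (eta0 sc (g0 P) (m0 P) (l0 P) (r0 P)) \<le> ennreal (delta (K*n))
            \<and> rate_cond sc P (delta (K*n) / sqrt (real (K*n))) (etahat (K*n) I \<omega>) (eta0 sc (g0 P) (m0 P) (l0 P) (r0 P))}
         \<ge> 1 - Delta (K*n)"
begin

abbreviation "\<eta>0 P \<equiv> eta0 sc (g0 P) (m0 P) (l0 P) (r0 P)"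
abbreviation "\<Omega>P P n \<equiv> PiM {..<K*n} (\<lambda>_. P)"
abbreviation "shat th n z \<equiv> sigma2_hat sc etahat K n (th n z) (fst z) (snd z)"
abbreviation "T_sigma th P n z \<equiv>
  inverse (sqrt (sigma2 P (theta0 P) (g0 P) (m0 P))) * sqrt (real (K*n)) * (th n z - theta0 P)"
abbreviation "T_shat th P n z \<equiv> inverse (sqrt (shat th n z)) * sqrt (real (K*n)) * (th n z - theta0 P)"
abbreviation "covered th \<alpha> P n \<equiv> {z \<in> space (dml_space P K n).
  theta0 P \<in> {th n z - Phi_inv (1 - \<alpha> / 2) * sqrt (shat th n z) / sqrt (real (K*n))
              .. th n z + Phi_inv (1 - \<alpha> / 2) * sqrt (shat th n z) / sqrt (real (K*n))}}"

lemma filterlim_K: "filterlim (\<lambda>n. K * n) at_top sequentially"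
  using K by (intro filterlim_subseq) (simp add: strict_mono_def)

definition good :: "'x obs measure \<Rightarrow> nat \<Rightarrow> nat set \<Rightarrow> (nat \<Rightarrow> 'x obs) set" where
  "good P n I = {\<omega> \<in> space (\<Omega>P P n).
              nuis_dist sc P q (etahat (K*n) I \<omega>) (\<eta>0 P) \<le> ennreal C
            \<and> nuis_dist sc P 2 (etahat (K*n) I \<omega>) (\<eta>0 P) \<le> ennreal (delta (K*n))
            \<and> rate_cond sc P (delta (K*n) / sqrt (real (K*n))) (etahat (K*n) I \<omega>) (\<eta>0 P)}"

context
  fixes P assumes P: "P \<in> Pfam"
begin

interpretation pliv SX P "theta0 P" "g0 P" "m0 P" "l0 P" "r0 P" c C q
  by (rule pliv_P[OF P])

lemma sets_PiM_obs: "sets (PiM {..<N} (\<lambda>_. P)) = sets (PiM {..<N} (\<lambda>_. obs_space SX))"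
  by (intro sets_PiM_cong refl sets_P)

lemma eval_X:
  assumes "(\<lambda>(\<omega>, x). F \<omega> x) \<in> borel_measurable (PiM {..<N} (\<lambda>_. obs_space SX) \<Otimes>\<^sub>M SX)"
  shows "(\<lambda>(\<omega>, w). (F \<omega> (Xv w) :: real)) \<in> borel_measurable (PiM {..<N} (\<lambda>_. P) \<Otimes>\<^sub>M P)"
proof -
  have "(\<lambda>p. (fst p, Xv (snd p))) \<in> measurable (PiM {..<N} (\<lambda>_. P) \<Otimes>\<^sub>M P) (PiM {..<N} (\<lambda>_. obs_space SX) \<Otimes>\<^sub>M SX)"
  proof (rule measurable_Pair)
    show "fst \<in> measurable (PiM {..<N} (\<lambda>_. P) \<Otimes>\<^sub>M P) (PiM {..<N} (\<lambda>_. obs_space SX))"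
      unfolding measurable_cong_sets[OF refl sets_PiM_obs[symmetric]] by measurable
    show "(\<lambda>p. Xv (snd p)) \<in> measurable (PiM {..<N} (\<lambda>_. P) \<Otimes>\<^sub>M P) SX" by measurable
  qed
  from measurable_compose[OF this assms] show ?thesis by (simp add: case_prod_unfold)
qed

lemma eta_X_meas[measurable]:
  "(\<lambda>(\<omega>, w). nf (etahat N I \<omega>) (Xv w)) \<in> borel_measurable (PiM {..<N} (\<lambda>_. P) \<Otimes>\<^sub>M P)"
  "(\<lambda>(\<omega>, w). nm (etahat N I \<omega>) (Xv w)) \<in> borel_measurable (PiM {..<N} (\<lambda>_. P) \<Otimes>\<^sub>M P)"
  "(\<lambda>(\<omega>, w). nr (etahat N I \<omega>) (Xv w)) \<in> borel_measurable (PiM {..<N} (\<lambda>_. P) \<Otimes>\<^sub>M P)"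
  using learner_meas by (auto intro!: eval_X)

lemma eta_section_meas:
  assumes "\<omega> \<in> space (PiM {..<N} (\<lambda>_. P))"
  shows "nf (etahat N I \<omega>) \<in> borel_measurable SX" "nm (etahat N I \<omega>) \<in> borel_measurable SX" "nr (etahat N I \<omega>) \<in> borel_measurable SX"
proof -
  have sp: "\<omega> \<in> space (PiM {..<N} (\<lambda>_. obs_space SX))" using assms unfolding sets_eq_imp_space_eq[OF sets_PiM_obs] .
  show "nf (etahat N I \<omega>) \<in> borel_measurable SX" "nm (etahat N I \<omega>) \<in> borel_measurable SX" "nr (etahat N I \<omega>) \<in> borel_measurable SX"
    using learner_meas[rule_format, of N I]
    by (auto dest: measurable_compose[OF measurable_Pair1'[OF sp]])
qed

lemma fnorm_eta_meas:
  assumes u: "u \<in> borel_measurable SX"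
  shows "(\<lambda>\<omega>. fnorm P p (\<lambda>x. nf (etahat N I \<omega>) x - u x)) \<in> borel_measurable (PiM {..<N} (\<lambda>_. P))"
    "(\<lambda>\<omega>. fnorm P p (\<lambda>x. nm (etahat N I \<omega>) x - u x)) \<in> borel_measurable (PiM {..<N} (\<lambda>_. P))"
    "(\<lambda>\<omega>. fnorm P p (\<lambda>x. nr (etahat N I \<omega>) x - u x)) \<in> borel_measurable (PiM {..<N} (\<lambda>_. P))"
  unfolding fnorm_def using u by (auto intro!: Lnorm_measurable[OF prob_P])

lemma good_sets: "good P n I \<in> sets (\<Omega>P P n)"
proof -
  note [measurable] = fnorm_eta_meas[OF nuis_meas(1)] fnorm_eta_meas[OF nuis_meas(2)] fnorm_eta_meas[OF nuis_meas(3)] fnorm_eta_meas[OF nuis_meas(4)]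
  show ?thesis
    unfolding good_def nuis_dist_def rate_cond_def eta0_def
    by (cases sc) (simp_all add: nf_def[of "(_, _)"] nm_def[of "(_, _)"] nr_def[of "(_, _)"])
qed

lemma etahat_upd:
  "I \<subseteq> {..<N} \<Longrightarrow> i \<in> I \<Longrightarrow> etahat N I (fun_upd \<omega> i x) = etahat N I \<omega>"
  by (rule learner_local[rule_format]) auto

lemma upd_space: "\<omega> \<in> space (PiM {..<N} (\<lambda>_. P)) \<Longrightarrow> i < N \<Longrightarrow> x \<in> space P \<Longrightarrow> fun_upd \<omega> i x \<in> space (PiM {..<N} (\<lambda>_. P))"
  by (auto simp: space_PiM PiE_def extensional_def)

lemma good_local:
  assumes "\<omega> \<in> space (\<Omega>P P n)" "i \<in> I" "I \<subseteq> {..<K*n}" "x \<in> space P"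
  shows "fun_upd \<omega> i x \<in> good P n I \<longleftrightarrow> \<omega> \<in> good P n I"
  using upd_space[OF assms(1) _ assms(4), of i] assms by (auto simp: good_def etahat_upd)

lemma good_prob:
  assumes "I \<subseteq> {..<K*n}" "card I = n"
  shows "measure (\<Omega>P P n) (space (\<Omega>P P n) - good P n I) \<le> Delta (K*n)"
proof -
  interpret Q: prob_space "\<Omega>P P n" by (rule prob_space_PiM) (rule prob_P)
  have "measure (\<Omega>P P n) (good P n I) \<ge> 1 - Delta (K*n)"
    using learner_rate P assms by (auto simp: good_def)
  then show ?thesis using Q.prob_compl[OF good_sets] by simp
qed

lemma good_D:
  assumes "\<omega> \<in> good P n I"
  shows "nf (etahat (K*n) I \<omega>) \<in> borel_measurable SX" "nm (etahat (K*n) I \<omega>) \<in> borel_measurable SX" "nr (etahat (K*n) I \<omega>) \<in> borel_measurable SX"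
    "nuis_dist sc P q (etahat (K*n) I \<omega>) (\<eta>0 P) \<le> ennreal C"
    "nuis_dist sc P 2 (etahat (K*n) I \<omega>) (\<eta>0 P) \<le> ennreal (delta (K*n))"
    "rate_cond sc P (delta (K*n) / sqrt (real (K*n))) (etahat (K*n) I \<omega>) (\<eta>0 P)"
    "delta (K*n) > 0" "delta (K*n) / sqrt (real (K*n)) \<ge> 0"
proof -
  show "delta (K*n) > 0" using delta(1) by simp
  then show "delta (K*n) / sqrt (real (K*n)) \<ge> 0" by (intro divide_nonneg_nonneg) auto
  have sp: "\<omega> \<in> space (\<Omega>P P n)" using assms unfolding good_def by blast
  show "nf (etahat (K*n) I \<omega>) \<in> borel_measurable SX" "nm (etahat (K*n) I \<omega>) \<in> borel_measurable SX" "nr (etahat (K*n) I \<omega>) \<in> borel_measurable SX"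
    by (rule eta_section_meas[OF sp])+
  show "nuis_dist sc P q (etahat (K*n) I \<omega>) (\<eta>0 P) \<le> ennreal C"
    "nuis_dist sc P 2 (etahat (K*n) I \<omega>) (\<eta>0 P) \<le> ennreal (delta (K*n))"
    "rate_cond sc P (delta (K*n) / sqrt (real (K*n))) (etahat (K*n) I \<omega>) (\<eta>0 P)"
    using assms unfolding good_def by blast+
qed

end

end

section \<open>The model along an arbitrary sequence of distributions\<close>

locale dml_setting_seq = dml_setting SX Pfam theta0 g0 m0 l0 r0 K c C q delta Delta eps sc etahat
  for SX :: "'x measure" and Pfam theta0 g0 m0 l0 r0 K c C q delta Delta eps sc etahat +
  fixes Ps :: "nat \<Rightarrow> 'x obs measure"
  assumes Ps: "Ps n \<in> Pfam"
begin

definition sU where "sU n = scU sc (theta0 (Ps n)) (g0 (Ps n)) (l0 (Ps n)) (r0 (Ps n))"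
definition sV where "sV n = Verr (m0 (Ps n))"
definition sD where "sD n = scD sc (r0 (Ps n))"
definition sh where "sh n I \<omega> w = scH sc (theta0 (Ps n)) (g0 (Ps n)) (l0 (Ps n)) (r0 (Ps n)) (etahat (K*n) I \<omega>) (Xv w)"
definition sm where "sm n I \<omega> w = nm (etahat (K*n) I \<omega>) (Xv w) - m0 (Ps n) (Xv w)"
definition ss where "ss n I \<omega> w = scS sc (r0 (Ps n)) (etahat (K*n) I \<omega>) (Xv w)"

lemmas s_defs = sU_def sV_def sD_def sh_def[abs_def] sm_def[abs_def] ss_def[abs_def]

lemma dml_seq_Ps: "dml_seq Ps"
  using pliv.prob_P[OF pliv_P[OF Ps]] by (rule dml_seq.intro)

lemma d_rate_lim: "(\<lambda>n. d_rate c C q (delta (K*n))) \<longlonglongrightarrow> 0"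
proof -
  have d0: "(\<lambda>n. delta (K*n)) \<longlonglongrightarrow> 0" by (rule filterlim_compose[OF delta(2) filterlim_K])
  have "(\<lambda>n. delta (K*n) powr ((q - 4) / 2)) \<longlonglongrightarrow> 0"
    using tendsto_powr2[OF d0 tendsto_const, of "(q - 4) / 2"] q delta(1) by (simp add: less_imp_le)
  then have "(\<lambda>n. d_rate c C q (delta (K*n))) \<longlonglongrightarrow> C_rate c C q * (0 + 0\<^sup>2 + 0)"
    unfolding d_rate_def by (intro tendsto_intros d0)
  then show ?thesis by simp
qed

lemma cross_s:
  assumes I: "I \<subseteq> {..<K*n}"
  shows "dml_seq.cross Ps K n I (sh n I)" "dml_seq.cross Ps K n I (sm n I)" "dml_seq.cross Ps K n I (ss n I)"
proof -
  interpret dml_seq Ps K by (rule dml_seq_Ps)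
  interpret P: pliv SX "Ps n" "theta0 (Ps n)" "g0 (Ps n)" "m0 (Ps n)" "l0 (Ps n)" "r0 (Ps n)" c C q
    by (rule pliv_P[OF Ps])
  have [measurable]: "(\<lambda>p. nf (etahat (K*n) I (fst p)) (Xv (snd p))) \<in> borel_measurable (\<Omega> n \<Otimes>\<^sub>M Ps n)"
    "(\<lambda>p. nm (etahat (K*n) I (fst p)) (Xv (snd p))) \<in> borel_measurable (\<Omega> n \<Otimes>\<^sub>M Ps n)"
    "(\<lambda>p. nr (etahat (K*n) I (fst p)) (Xv (snd p))) \<in> borel_measurable (\<Omega> n \<Otimes>\<^sub>M Ps n)"
    using eta_X_meas[OF Ps[of n], of "K*n" I] by (simp_all only: case_prod_unfold)
  have [measurable]: "(\<lambda>p. u (Xv (snd p))) \<in> borel_measurable (\<Omega> n \<Otimes>\<^sub>M Ps n)" if "u \<in> borel_measurable SX" for u :: "'x \<Rightarrow> real"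
    by (rule measurable_compose[OF measurable_compose[OF measurable_snd P.coord_meas(4)] that])
  have meas: "(\<lambda>(\<omega>, w). sh n I \<omega> w) \<in> borel_measurable (\<Omega> n \<Otimes>\<^sub>M Ps n)"
    "(\<lambda>(\<omega>, w). sm n I \<omega> w) \<in> borel_measurable (\<Omega> n \<Otimes>\<^sub>M Ps n)"
    "(\<lambda>(\<omega>, w). ss n I \<omega> w) \<in> borel_measurable (\<Omega> n \<Otimes>\<^sub>M Ps n)"
    unfolding sh_def sm_def ss_def scH_def scS_def case_prod_unfold using P.nuis_meas
    by (cases sc; simp)+
  show "cross n I (sh n I)" "cross n I (sm n I)" "cross n I (ss n I)"
    unfolding cross_def using meas
    by (simp_all add: etahat_upd[OF Ps I] sh_def[abs_def] sm_def[abs_def] ss_def[abs_def])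
qed

text \<open>One lower bound has to serve both |E[DV]| \<ge> c and E[(UV)^2] \<ge> c^4, hence the
  minimum. The order q/2 is what q-th moments of the factors leave for the product UV.\<close>

sublocale crossfit Ps K "\<lambda>n. good (Ps n) n" "\<lambda>n. Delta (K*n)" sU sV sD sh sm ss
  "\<lambda>n. d_rate c C q (delta (K*n))" "B_bd c C q" "min c (c ^ 4)" "q / 2"
proof (rule crossfit.intro)
  show "crossfit_event Ps K (\<lambda>n. good (Ps n) n) (\<lambda>n. Delta (K*n))"
  proof (rule crossfit_event.intro[OF dml_seq_Ps], unfold_locales)
    show "(\<lambda>n. Delta (K*n)) \<longlonglongrightarrow> 0" by (rule filterlim_compose[OF Delta(2) filterlim_K])
  qed (use K good_sets[OF Ps] good_local[OF Ps] good_prob[OF Ps] Delta(1) in \<open>auto simp: less_imp_le\<close>)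
  show "crossfit_axioms Ps K (\<lambda>n. good (Ps n) n) sU sV sD sh sm ss (\<lambda>n. d_rate c C q (delta (K*n))) (B_bd c C q) (min c (c ^ 4)) (q / 2)"
  proof (rule crossfit_axioms.intro)
    fix n I \<omega>
    interpret P: pliv SX "Ps n" "theta0 (Ps n)" "g0 (Ps n)" "m0 (Ps n)" "l0 (Ps n)" "r0 (Ps n)" c C q
      by (rule pliv_P[OF Ps])
    show "sU n \<in> borel_measurable (Ps n)" "sV n \<in> borel_measurable (Ps n)" "sD n \<in> borel_measurable (Ps n)"
      unfolding s_defs by measurable
    show "0 \<le> d_rate c C q (delta (K*n))"
      using P.bd_nonneg delta(1)[rule_format, of "K*n"] by (simp add: d_rate_def)
    show "0 \<le> B_bd c C q" by (rule P.bd_nonneg)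
    show "(\<integral>\<^sup>+w. ennreal ((sD n w)\<^sup>2) \<partial>Ps n) \<le> ennreal (B_bd c C q)"
      "(\<integral>\<^sup>+w. ennreal ((sV n w)\<^sup>2) \<partial>Ps n) \<le> ennreal (B_bd c C q)"
      "(\<integral>\<^sup>+w. ennreal ((sD n w * sV n w)\<^sup>2) \<partial>Ps n) \<le> ennreal (B_bd c C q)"
      "integrable (Ps n) (\<lambda>w. \<bar>sU n w * sV n w\<bar> powr (q / 2))"
      "(\<integral>w. \<bar>sU n w * sV n w\<bar> powr (q / 2) \<partial>Ps n) \<le> B_bd c C q"
      "integrable (Ps n) (\<lambda>w. (sU n w * sV n w)\<^sup>2)"
      unfolding s_defs by (rule P.global_bounds)+
    show "(\<integral>w. sU n w * sV n w \<partial>Ps n) = 0" unfolding s_defs by (rule P.scU_V)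
    show "min c (c ^ 4) \<le> (\<integral>w. (sU n w * sV n w)\<^sup>2 \<partial>Ps n)" unfolding s_defs using P.scU_V2[of sc] by simp
    show "min c (c ^ 4) \<le> \<bar>\<integral>w. sD n w * sV n w \<partial>Ps n\<bar>" unfolding s_defs using P.scD_V[of sc] P.ident by simp
    assume g: "\<omega> \<in> good (Ps n) n I"
    note G = good_D[OF Ps g]
    show "(\<integral>w. sU n w * sm n I \<omega> w \<partial>Ps n) = 0" "(\<integral>w. sV n w * sh n I \<omega> w \<partial>Ps n) = 0"
      unfolding s_defs by (rule P.good_orth[OF G])+
    show "(\<integral>\<^sup>+w. ennreal ((sU n w * sm n I \<omega> w)\<^sup>2) \<partial>Ps n) \<le> ennreal (d_rate c C q (delta (K*n)))"
      unfolding s_defs by (rule P.good_Um[OF G])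
    show "(\<integral>\<^sup>+w. ennreal ((sV n w * sh n I \<omega> w)\<^sup>2) \<partial>Ps n) \<le> ennreal (d_rate c C q (delta (K*n)))"
      unfolding s_defs by (rule P.good_Vh[OF G])
    show "(\<integral>\<^sup>+w. ennreal \<bar>sh n I \<omega> w * sm n I \<omega> w\<bar> \<partial>Ps n) \<le> ennreal (d_rate c C q (delta (K*n)) / sqrt (real (K*n)))"
    proof -
      have "2 * (1 + Theta_bd c C q) * delta (K*n) \<le> d_rate c C q (delta (K*n))"
        using P.d_rate_ge[OF G, of "2 * (1 + Theta_bd c C q)" 0 0] P.coef_le[OF G] P.M_nonneg by simp
      then have "2 * (1 + Theta_bd c C q) * delta (K*n) / sqrt (real (K*n)) \<le> d_rate c C q (delta (K*n)) / sqrt (real (K*n))"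
        by (rule divide_right_mono) simp
      then have "ennreal (2 * (1 + Theta_bd c C q) * (delta (K*n) / sqrt (real (K*n)))) \<le> ennreal (d_rate c C q (delta (K*n)) / sqrt (real (K*n)))"
        by (intro ennreal_leI) simp
      with P.good_hm1[OF G] show ?thesis unfolding s_defs by (rule order_trans)
    qed
    show "(\<integral>\<^sup>+w. ennreal ((sh n I \<omega> w * sm n I \<omega> w)\<^sup>2) \<partial>Ps n) \<le> ennreal (d_rate c C q (delta (K*n)))"
      unfolding s_defs by (rule P.good_hm2[OF G])
    show "(\<integral>\<^sup>+w. ennreal ((sm n I \<omega> w)\<^sup>2) \<partial>Ps n) \<le> ennreal (d_rate c C q (delta (K*n)))"
      unfolding s_defs by (rule P.good_mm[OF G])
    show "(\<integral>\<^sup>+w. ennreal ((ss n I \<omega> w)\<^sup>2) \<partial>Ps n) \<le> ennreal (d_rate c C q (delta (K*n)))"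
      unfolding s_defs by (rule P.good_ss[OF G])
    show "(\<integral>\<^sup>+w. ennreal (((sD n w - ss n I \<omega> w) * (sV n w - sm n I \<omega> w))\<^sup>2) \<partial>Ps n) \<le> ennreal (B_bd c C q)"
      unfolding s_defs by (rule P.good_aa[OF G])
  qed (use d_rate_lim cC q cross_s in auto)
qed

end

section \<open>Limits of the estimators\<close>

text \<open>With nonzero slope the score has an exact root, so an estimator within eps of the
  infimum is a root up to eps. This matches the proviso on the slope in
  \<open>estimator_expansion\<close>.\<close>

lemma INF_abs_affine:
  fixes J S t :: real
  assumes "J \<noteq> 0"
  shows "(INF \<theta>. \<bar>J * (\<theta> - t) + S\<bar>) \<le> 0"
proof -
  have "(INF \<theta>. \<bar>J * (\<theta> - t) + S\<bar>) \<le> \<bar>J * ((t - S / J) - t) + S\<bar>"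
    by (rule cINF_lower) (auto intro!: bdd_belowI[of _ 0])
  then show ?thesis using assms by simp
qed

context dml_setting_seq
begin

lemma PA_eq: "PA n I \<omega> w = psi_a sc (etahat (K*n) I \<omega>) w"
  unfolding PA_def unfolding s_defs by (rule psi_a_decomp[symmetric])

lemma PB_eq: "PB n I \<omega> w = psi sc (theta0 (Ps n)) (etahat (K*n) I \<omega>) w"
  unfolding PB_def unfolding s_defs by (rule psi_decomp[symmetric])

lemma psi_eq: "psi sc \<theta> (etahat (K*n) I \<omega>) w = PA n I \<omega> w * (\<theta> - theta0 (Ps n)) + PB n I \<omega> w"
  unfolding PA_eq PB_eq psi_def by (simp add: algebra_simps)

lemma fold_score_eq:
  "fold_score sc etahat K n \<theta> \<omega> f k = AV k PA (n, \<omega>, f) * (\<theta> - theta0 (Ps n)) + AV k PB (n, \<omega>, f)"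
  by (simp add: fold_score_def eta_hat_k_def psi_eq AV_def En_def sum.distrib sum_distrib_right add_divide_distrib)

definition err :: "(nat \<Rightarrow> (nat \<Rightarrow> 'x obs) \<times> (nat \<Rightarrow> nat) \<Rightarrow> real) \<Rightarrow> nat \<times> (nat \<Rightarrow> 'x obs) \<times> (nat \<Rightarrow> nat) \<Rightarrow> real" where
  "err th x = th (fst x) (snd x) - theta0 (Ps (fst x))"

lemma sigma2_hat_eq: "sigma2_hat sc etahat K n (th n z) (fst z) (snd z) = s2h (err th) (n, z)"
proof -
  have "psi_a sc (etahat (K*n) I \<omega>) = PA n I \<omega>" for I \<omega> by (intro ext) (simp add: PA_eq)
  then show ?thesis
    by (simp add: sigma2_hat_def Let_def s2h_def avg_def score_sq_def AV_def eta_hat_k_def psi_eq err_def case_prod_unfold)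
qed

lemma sigma2_eq_seq: "sigma2 (Ps n) (theta0 (Ps n)) (g0 (Ps n)) (m0 (Ps n)) = e n / (a n)\<^sup>2"
  unfolding e_def a_def s_defs by (rule pliv.sigma2_eq[OF pliv_P[OF Ps]])

lemma eps_lim: "(\<lambda>n. sqrt (real (K*n)) * eps (K*n)) \<longlonglongrightarrow> 0"
proof -
  have "(\<lambda>N. eps N / (delta N / sqrt (real N)) * delta N) \<longlonglongrightarrow> 0 * 0"
    by (intro tendsto_mult eps delta)
  \<comment> \<open>At N = 0 both sides are 0, since division by 0 gives 0.\<close>
  moreover have "eps N / (delta N / sqrt (real N)) * delta N = sqrt (real N) * eps N" for N
    using delta(1)[rule_format, of N] by simp
  ultimately have "(\<lambda>N. sqrt (real N) * eps N) \<longlonglongrightarrow> 0" by simp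
  from filterlim_compose[OF this filterlim_K] show ?thesis .
qed

lemma dml1_expansion:
  assumes "is_DML1 sc etahat eps K thk"
  shows "((\<lambda>x. rN x * err (dml1_est K thk) x - rN x * Am x / a (fst x)) \<longlongrightarrow> 0) W"
proof -
  let ?\<tau> = "\<lambda>k x. thk (fst x) k (snd x) - theta0 (Ps (fst x))"
  have "((\<lambda>x. rN x * avg ?\<tau> x - rN x * Am x / a (fst x)) \<longlongrightarrow> 0) W"
  proof (rule DML1_expansion[OF _ eps_lim])
    fix k n \<omega> f assume *: "k < K" "f \<in> partitions K n" and J: "AV k PA (n, \<omega>, f) \<noteq> 0"
    have "\<bar>fold_score sc etahat K n (thk n k (\<omega>, f)) \<omega> f k\<bar> \<le> (INF \<theta>. \<bar>fold_score sc etahat K n \<theta> \<omega> f k\<bar>) + eps (K*n)"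
      using assms * unfolding is_DML1_def by blast
    then show "\<bar>AV k PA (n, \<omega>, f) * ?\<tau> k (n, \<omega>, f) + AV k PB (n, \<omega>, f)\<bar> \<le> eps (K*n)"
      unfolding fold_score_eq using INF_abs_affine[OF J, of "theta0 (Ps n)" "AV k PB (n, \<omega>, f)"] by simp
  qed
  moreover have "avg ?\<tau> = err (dml1_est K thk)"
    using K by (intro ext) (simp add: avg_def err_def dml1_est_def sum_subtractf diff_divide_distrib)
  ultimately show ?thesis by simp
qed

lemma dml2_expansion:
  assumes "is_DML2 sc etahat eps K th2"
  shows "((\<lambda>x. rN x * err th2 x - rN x * Am x / a (fst x)) \<longlongrightarrow> 0) W"
proof (rule DML2_expansion[OF _ eps_lim])
  fix n \<omega> f assume f: "f \<in> partitions K n" and J: "avg (\<lambda>k. AV k PA) (n, \<omega>, f) \<noteq> 0"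
  have eq: "(\<Sum>k<K. fold_score sc etahat K n \<theta> \<omega> f k) / real K =
    avg (\<lambda>k. AV k PA) (n, \<omega>, f) * (\<theta> - theta0 (Ps n)) + avg (\<lambda>k. AV k PB) (n, \<omega>, f)" for \<theta>
    by (simp add: fold_score_eq avg_def sum.distrib sum_distrib_right add_divide_distrib)
  have "\<bar>(\<Sum>k<K. fold_score sc etahat K n (th2 n (\<omega>, f)) \<omega> f k) / real K\<bar>
      \<le> (INF \<theta>. \<bar>(\<Sum>k<K. fold_score sc etahat K n \<theta> \<omega> f k) / real K\<bar>) + eps (K*n)"
    using assms f unfolding is_DML2_def by blast
  then show "\<bar>avg (\<lambda>k. AV k PA) (n, \<omega>, f) * err th2 (n, \<omega>, f) + avg (\<lambda>k. AV k PB) (n, \<omega>, f)\<bar> \<le> eps (K*n)"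
    unfolding eq using INF_abs_affine[OF J, of "theta0 (Ps n)" "avg (\<lambda>k. AV k PB) (n, \<omega>, f)"] by (simp add: err_def)
qed

lemma estimator_measurable:
  assumes "X \<in> borel_measurable (PiM {..<K*n} (\<lambda>_. obs_space SX) \<Otimes>\<^sub>M uniform_count_measure (partitions K n))"
  shows "X \<in> borel_measurable (\<D> n)"
proof -
  have "sets (\<D> n) = sets (PiM {..<K*n} (\<lambda>_. obs_space SX) \<Otimes>\<^sub>M uniform_count_measure (partitions K n))"
    unfolding dml_space_def by (intro sets_pair_measure_cong sets_PiM_obs[OF Ps] refl)
  then show ?thesis using assms measurable_cong_sets by blast
qed

lemma AV_dml_measurable:
  assumes "\<And>I. I \<subseteq> {..<K*n} \<Longrightarrow> cross n I (F n I)"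
  shows "(\<lambda>z. AV k F (n, z)) \<in> borel_measurable (\<D> n)"
proof (rule borel_measurable_dml_space)
  fix f
  show "(\<lambda>\<omega>. AV k F (n, \<omega>, f)) \<in> borel_measurable (PiM {..<K*n} (\<lambda>_. Ps n))"
    by (rule AV_measurable) (rule assms[OF fold_subset])
qed

text \<open>Inside the fold averages the estimator is a function of sample and partition, so they
  are not of cross-fitted form. The expansion \<open>AV_quadratic\<close> moves it outside.\<close>

lemma s2h_measurable:
  assumes [measurable]: "th n \<in> borel_measurable (\<D> n)"
  shows "(\<lambda>z. s2h (err th) (n, z)) \<in> borel_measurable (\<D> n)"
proof -
  have [measurable]: "(\<lambda>z. AV k PA (n, z)) \<in> borel_measurable (\<D> n)"
    "(\<lambda>z. AV k (\<lambda>n I \<omega> w. (PA n I \<omega> w)\<^sup>2) (n, z)) \<in> borel_measurable (\<D> n)"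
    "(\<lambda>z. AV k (\<lambda>n I \<omega> w. PA n I \<omega> w * PB n I \<omega> w) (n, z)) \<in> borel_measurable (\<D> n)"
    "(\<lambda>z. AV k (\<lambda>n I \<omega> w. (PB n I \<omega> w)\<^sup>2) (n, z)) \<in> borel_measurable (\<D> n)" for k
    by (intro AV_dml_measurable cross_power cross_mult cross_PA cross_PB; assumption)+
  show ?thesis unfolding s2h_def avg_def score_sq_def AV_quadratic err_def by simp
qed

section \<open>Limit distribution and coverage for one estimator\<close>

context
  fixes th :: "nat \<Rightarrow> (nat \<Rightarrow> 'x obs) \<times> (nat \<Rightarrow> nat) \<Rightarrow> real"
  assumes th_meas[measurable]: "\<And>n. th n \<in> borel_measurable (\<D> n)"
    and expansion: "((\<lambda>x. rN x * err th x - rN x * Am x / a (fst x)) \<longlongrightarrow> 0) W"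
begin

lemma weak_conv_sigma2: "weak_conv_m (\<lambda>n. distr (\<D> n) borel (T_sigma th (Ps n) n)) N01"
proof (rule weak_conv_studentized)
  show "((\<lambda>(n, z). T_sigma th (Ps n) n z - Tst (n, z)) \<longlongrightarrow> 0) W"
    using studentization(1)[OF expansion] by (simp add: sigma2_eq_seq err_def rN_def case_prod_unfold)
qed measurable

lemma studentized_measurable: "T_shat th (Ps n) n \<in> borel_measurable (\<D> n)"
proof -
  note [measurable] = s2h_measurable[of th n, OF th_meas]
  show ?thesis unfolding sigma2_hat_eq by measurable
qed

lemma weak_conv_sigma2_hat: "weak_conv_m (\<lambda>n. distr (\<D> n) borel (T_shat th (Ps n) n)) N01"
proof (rule weak_conv_studentized[OF studentized_measurable])
  show "((\<lambda>(n, z). T_shat th (Ps n) n z - Tst (n, z)) \<longlongrightarrow> 0) W"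
    using studentization(2)[OF expansion] by (simp add: sigma2_hat_eq err_def[abs_def] rN_def case_prod_unfold)
qed

text \<open>Where the variance estimate is positive, coverage is equivalent to the studentized
  statistic lying between the two quantiles. The limit of that probability follows from weak
  convergence, the end points having zero normal mass.\<close>

lemma coverage:
  assumes \<alpha>: "0 < \<alpha>" "\<alpha> < 1"
  shows "(\<lambda>n. measure (\<D> n) (covered th \<alpha> (Ps n) n)) \<longlonglongrightarrow> 1 - \<alpha>"
proof -
  let ?z = "Phi_inv (1 - \<alpha> / 2)"
  let ?M = "\<lambda>n. \<D> n"
  let ?s = "\<lambda>n z. shat th n z"
  define X where "X n z = T_shat th (Ps n) n z" for n z
  define S where "S n = covered th \<alpha> (Ps n) n" for n
  define E where "E n = {z \<in> space (?M n). X n z \<in> {- ?z .. ?z}}" for n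
  \<comment> \<open>Samples with a non-positive variance estimate, for which the interval cannot be
    inverted; the two events differ only here.\<close>
  define R where "R n = {z \<in> space (?M n). \<not> s2h (err th) (n, z) > 0}" for n
  note [measurable] = s2h_measurable[of th, OF th_meas]
  have sm[measurable]: "(\<lambda>z. ?s n z) \<in> borel_measurable (?M n)" for n unfolding sigma2_hat_eq by measurable
  have Xm[measurable]: "X n \<in> borel_measurable (?M n)" for n unfolding X_def[abs_def] by measurable
  have [measurable]: "S n \<in> sets (?M n)" "E n \<in> sets (?M n)" "R n \<in> sets (?M n)" for n
    unfolding S_def E_def R_def atLeastAtMost_iff by measurable
  have SE: "S n \<subseteq> space (?M n)" "E n \<subseteq> space (?M n)" for n unfolding S_def E_def by blast+
  interpret M: prob_space "?M n" for n by (rule prob_space_M)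
  have R0: "(\<lambda>n. measure (?M n) (R n)) \<longlonglongrightarrow> 0"
    unfolding R_def by (rule whp_imp_prob_tendsto_0[OF studentization(3)[OF expansion]]) measurable
  have "(\<lambda>n. measure (distr (?M n) borel (X n)) {- ?z .. ?z}) \<longlonglongrightarrow> measure N01 {- ?z .. ?z}"
  proof (rule weak_conv_imp_continuity_set_conv)
    show "real_distribution (distr (?M n) borel (X n))" for n by (rule M.real_distribution_distr) simp
    show "real_distribution N01" by (rule N01.real_distribution_axioms)
    show "weak_conv_m (\<lambda>n. distr (?M n) borel (X n)) N01"
      unfolding X_def[abs_def] by (rule weak_conv_sigma2_hat)
    have "frontier {- ?z .. ?z} \<subseteq> {- ?z, ?z}" by (auto simp: frontier_def)
    then have "countable (frontier {- ?z .. ?z})" by (rule countable_subset) simp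
    then show "emeasure N01 (frontier {- ?z .. ?z}) = 0"
      by (intro N01_null emeasure_lborel_countable) simp_all
  qed simp
  also have "(\<lambda>n. measure (distr (?M n) borel (X n)) {- ?z .. ?z}) = (\<lambda>n. measure (?M n) (E n))"
  proof
    fix n
    have "X n -` {- ?z .. ?z} \<inter> space (?M n) = E n" unfolding E_def by blast
    then show "measure (distr (?M n) borel (X n)) {- ?z .. ?z} = measure (?M n) (E n)"
      by (subst measure_distr[OF Xm]) simp_all
  qed
  also have "measure N01 {- ?z .. ?z} = 1 - \<alpha>" by (rule N01_symmetric_interval[OF \<alpha>])
  finally have E: "(\<lambda>n. measure (?M n) (E n)) \<longlonglongrightarrow> 1 - \<alpha>" .
  have "(\<lambda>n. measure (?M n) (S n)) \<longlonglongrightarrow> 1 - \<alpha>"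
  proof (rule Lim_transform[OF E], rule Lim_null_comparison[OF _ R0])
    show "\<forall>\<^sub>F n in sequentially. norm (measure (?M n) (S n) - measure (?M n) (E n)) \<le> measure (?M n) (R n)"
      using eventually_gt_at_top[of 0]
    proof eventually_elim
      case (elim n)
      have r: "sqrt (real (K*n)) > 0" using elim K by simp
      have iff: "z \<in> S n \<longleftrightarrow> z \<in> E n" if z: "z \<in> space (?M n)" "z \<notin> R n" for z
      proof -
        have s: "sqrt (?s n z) > 0" using z by (simp add: R_def sigma2_hat_eq)
        let ?q = "sqrt (?s n z) / sqrt (real (K*n))"
        have q: "?q > 0" using s r by simp
        have "X n z = (th n z - theta0 (Ps n)) / ?q" by (simp add: X_def divide_inverse mult_ac)
        then have "z \<in> E n \<longleftrightarrow> - ?z * ?q \<le> th n z - theta0 (Ps n) \<and> th n z - theta0 (Ps n) \<le> ?z * ?q"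
          using z q by (simp only: E_def mem_Collect_eq atLeastAtMost_iff pos_le_divide_eq pos_divide_le_eq simp_thms)
        also have "\<dots> \<longleftrightarrow> z \<in> S n"
          unfolding S_def mem_Collect_eq atLeastAtMost_iff times_divide_eq_right using z(1) by linarith
        finally show ?thesis ..
      qed
      have "measure (?M n) (S n) \<le> measure (?M n) (E n \<union> R n)"
      proof (rule M.finite_measure_mono)
        show "S n \<subseteq> E n \<union> R n" using iff SE(1)[of n] by blast
      qed simp
      also have "\<dots> \<le> measure (?M n) (E n) + measure (?M n) (R n)" by (rule measure_subadditive) auto
      finally have 1: "measure (?M n) (S n) \<le> measure (?M n) (E n) + measure (?M n) (R n)" .
      have "measure (?M n) (E n) \<le> measure (?M n) (S n \<union> R n)"
      proof (rule M.finite_measure_mono)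
        show "E n \<subseteq> S n \<union> R n" using iff SE(2)[of n] by blast
      qed simp
      also have "\<dots> \<le> measure (?M n) (S n) + measure (?M n) (R n)" by (rule measure_subadditive) auto
      finally show ?case using 1 by simp
    qed
  qed
  then show ?thesis unfolding S_def .
qed

end

lemma DML_limits:
  assumes d1: "is_DML1 sc etahat eps K thk" and d2: "is_DML2 sc etahat eps K th2"
    and m1: "\<forall>n k. thk n k \<in> borel_measurable
                      (PiM {..<K*n} (\<lambda>_. obs_space SX) \<Otimes>\<^sub>M uniform_count_measure (partitions K n))"
    and m2: "\<forall>n. th2 n \<in> borel_measurable
                      (PiM {..<K*n} (\<lambda>_. obs_space SX) \<Otimes>\<^sub>M uniform_count_measure (partitions K n))"
  shows "r > 0 \<Longrightarrow> (\<lambda>n. measure (\<D> n)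
               {z \<in> space (\<D> n).
                  sqrt (real (K*n)) * \<bar>dml1_est K thk n z - th2 n z\<bar> > r}) \<longlonglongrightarrow> 0"
    and "th \<in> {dml1_est K thk, th2} \<Longrightarrow> weak_conv_m (\<lambda>n. distr (\<D> n) borel (T_sigma th (Ps n) n)) N01"
    and "th \<in> {dml1_est K thk, th2} \<Longrightarrow> weak_conv_m (\<lambda>n. distr (\<D> n) borel (T_shat th (Ps n) n)) N01"
    and "th \<in> {dml1_est K thk, th2} \<Longrightarrow> 0 < \<alpha> \<Longrightarrow> \<alpha> < 1 \<Longrightarrow>
      (\<lambda>n. measure (\<D> n) (covered th \<alpha> (Ps n) n)) \<longlonglongrightarrow> 1 - \<alpha>"
proof -
  have "dml1_est K thk n \<in> borel_measurable (PiM {..<K*n} (\<lambda>_. obs_space SX) \<Otimes>\<^sub>M uniform_count_measure (partitions K n))" for n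
    unfolding dml1_est_def[abs_def]
    by (intro borel_measurable_divide borel_measurable_sum borel_measurable_const m1[rule_format])
  then have meas[measurable]: "dml1_est K thk n \<in> borel_measurable (\<D> n)" "th2 n \<in> borel_measurable (\<D> n)" for n
    by (auto intro!: estimator_measurable m2[rule_format])
  note exps = dml1_expansion[OF d1] dml2_expansion[OF d2]
  have "((\<lambda>(n, z). sqrt (real (K*n)) * (dml1_est K thk n z - th2 n z)) \<longlongrightarrow> 0) W"
    using tendsto_diff[OF exps] by (simp add: err_def rN_def case_prod_unfold algebra_simps)
  from tendsto_0_whp_prob[OF this, of r]
  show "r > 0 \<Longrightarrow> (\<lambda>n. measure (\<D> n)
               {z \<in> space (\<D> n).
                  sqrt (real (K*n)) * \<bar>dml1_est K thk n z - th2 n z\<bar> > r}) \<longlonglongrightarrow> 0"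
    by (simp add: abs_mult)
  assume "th \<in> {dml1_est K thk, th2}"
  then have th: "\<And>n. th n \<in> borel_measurable (\<D> n)"
    "((\<lambda>x. rN x * err th x - rN x * Am x / a (fst x)) \<longlongrightarrow> 0) W"
    using meas exps by auto
  from weak_conv_sigma2[OF th] weak_conv_sigma2_hat[OF th] coverage[OF th]
  show "weak_conv_m (\<lambda>n. distr (\<D> n) borel (T_sigma th (Ps n) n)) N01"
    "weak_conv_m (\<lambda>n. distr (\<D> n) borel (T_shat th (Ps n) n)) N01"
    "0 < \<alpha> \<Longrightarrow> \<alpha> < 1 \<Longrightarrow> (\<lambda>n. measure (\<D> n) (covered th \<alpha> (Ps n) n)) \<longlonglongrightarrow> 1 - \<alpha>" .
qed

end

text \<open>If uniformity failed, distributions violating the bound for arbitrarily large n could be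
  strung together into one sequence, against the hypothesis.\<close>

lemma uniform_from_sequences:
  assumes "\<And>Ps. (\<And>n. Ps n \<in> Pfam) \<Longrightarrow> (\<lambda>n. F n (Ps n) :: real) \<longlonglongrightarrow> l" and "r > 0"
  shows "\<exists>n0. \<forall>n\<ge>n0. \<forall>P\<in>Pfam. \<bar>F n P - l\<bar> \<le> r"
proof (rule ccontr)
  assume neg: "\<not> ?thesis"
  define bad where "bad n P \<longleftrightarrow> P \<in> Pfam \<and> \<not> \<bar>F n P - l\<bar> \<le> r" for n P
  from neg have freq: "\<forall>n0. \<exists>n\<ge>n0. \<exists>P. bad n P" unfolding bad_def by blast
  then obtain P0 where P0: "P0 \<in> Pfam" by (auto simp: bad_def)
  \<comment> \<open>Where no violating distribution exists, a fixed member fills the gap so that the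
    sequence stays in the family.\<close>
  define Ps where "Ps n = (if \<exists>P. bad n P then SOME P. bad n P else P0)" for n
  have bad: "bad n (Ps n)" if "\<exists>P. bad n P" for n
    using that someI_ex[OF that] by (simp add: Ps_def)
  have "Ps n \<in> Pfam" for n
    using bad[of n] P0 by (cases "\<exists>P. bad n P") (auto simp: bad_def Ps_def)
  then have "(\<lambda>n. F n (Ps n)) \<longlonglongrightarrow> l" by (rule assms(1))
  from tendstoD[OF this \<open>r > 0\<close>]
  obtain n0 where "\<And>n. n \<ge> n0 \<Longrightarrow> \<bar>F n (Ps n) - l\<bar> < r"
    by (auto simp: eventually_sequentially dist_real_def)
  moreover obtain n where "n \<ge> n0" "\<exists>P. bad n P" using freq by blast
  ultimately show False using bad[of n] by (force simp: bad_def)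
qed

text \<open>The index n is the fold size, so N = K n throughout. Arbitrary sequences in the family
  express uniform convergence, while the limit of the supremum is written as a bound uniform in P,
  which is meaningful for an empty family as well.\<close>

theorem theorem4p2:
  fixes SX :: "'x measure"
    and Pfam :: "'x obs measure set"
    and theta0 :: "'x obs measure \<Rightarrow> real"
    and g0 m0 l0 r0 :: "'x obs measure \<Rightarrow> 'x \<Rightarrow> real"
    and K :: nat and c C q :: real
    and delta Delta eps :: "nat \<Rightarrow> real"
    and sc :: score
    and etahat :: "nat \<Rightarrow> nat set \<Rightarrow> (nat \<Rightarrow> 'x obs) \<Rightarrow> 'x nuis"
    and thk :: "nat \<Rightarrow> nat \<Rightarrow> (nat \<Rightarrow> 'x obs) \<times> (nat \<Rightarrow> nat) \<Rightarrow> real"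
    and th2 :: "nat \<Rightarrow> (nat \<Rightarrow> 'x obs) \<times> (nat \<Rightarrow> nat) \<Rightarrow> real"
  assumes K: "K \<ge> 2"
    and cC: "c > 0" "C > 0" and q: "q > 4"
    and delta: "\<forall>N. delta N > 0" "delta \<longlonglongrightarrow> 0"
    and Delta: "\<forall>N. Delta N > 0" "Delta \<longlonglongrightarrow> 0"
    and eps: "\<forall>N. eps N \<ge> 0" "(\<lambda>N. eps N / (delta N / sqrt (real N))) \<longlonglongrightarrow> 0"
    (* (a) *)
    and model: "\<forall>P\<in>Pfam. pliv_model SX P (theta0 P) (g0 P) (m0 P) (l0 P) (r0 P)"
    (* (b) *)
    and moments: "\<forall>P\<in>Pfam. Lnorm P q Yv + Lnorm P q Dv + Lnorm P q Zv \<le> ennreal C"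
    (* (c) *)
    and ident: "\<forall>P\<in>Pfam. Lnorm P 2 (\<lambda>w. Uerr (theta0 P) (g0 P) w * Verr (m0 P) w) \<ge> ennreal (c\<^sup>2)
                   \<and> \<bar>\<integral>w. Dv w * Verr (m0 P) w \<partial>P\<bar> \<ge> c"
    (* (d) *)
    and condvar: "\<forall>P\<in>Pfam.
         (AE w in P. real_cond_exp P (sigma_X SX P) (\<lambda>w. (Uerr (theta0 P) (g0 P) w)\<^sup>2) w \<le> C)
       \<and> (AE w in P. real_cond_exp P (sigma_X SX P) (\<lambda>w. (Verr (m0 P) w)\<^sup>2) w \<le> C)"
    (* the nuisance learner only uses the observations outside the held-out fold I,
       and is (jointly) measurable *)
    and learner_local: "\<forall>N I \<omega> \<omega>'. (\<forall>i\<in>{..<N} - I. \<omega> i = \<omega>' i) \<longrightarrow> etahat N I \<omega> = etahat N I \<omega>'"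
    and learner_meas: "\<forall>N I. (\<lambda>(\<omega>, x). nf (etahat N I \<omega>) x) \<in> borel_measurable (PiM {..<N} (\<lambda>_. obs_space SX) \<Otimes>\<^sub>M SX)
                       \<and> (\<lambda>(\<omega>, x). nm (etahat N I \<omega>) x) \<in> borel_measurable (PiM {..<N} (\<lambda>_. obs_space SX) \<Otimes>\<^sub>M SX)
                       \<and> (\<lambda>(\<omega>, x). nr (etahat N I \<omega>) x) \<in> borel_measurable (PiM {..<N} (\<lambda>_. obs_space SX) \<Otimes>\<^sub>M SX)"
    (* (e) *)
    and learner_rate: "\<forall>P\<in>Pfam. \<forall>n I. I \<subseteq> {..<K*n} \<and> card I = n \<longrightarrow>
         measure (PiM {..<K*n} (\<lambda>_. P))
           {\<omega> \<in> space (PiM {..<K*n} (\<lambda>_. P)).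
              nuis_dist sc P q (etahat (K*n) I \<omega>) (eta0 sc (g0 P) (m0 P) (l0 P) (r0 P)) \<le> ennreal C
            \<and> nuis_dist sc P 2 (etahat (K*n) I \<omega>) (eta0 sc (g0 P) (m0 P) (l0 P) (r0 P)) \<le> ennreal (delta (K*n))
            \<and> rate_cond sc P (delta (K*n) / sqrt (real (K*n))) (etahat (K*n) I \<omega>) (eta0 sc (g0 P) (m0 P) (l0 P) (r0 P))}
         \<ge> 1 - Delta (K*n)"
    (* DML1 and DML2 estimators *)
    and dml1: "is_DML1 sc etahat eps K thk"
    and dml1_meas: "\<forall>n k. thk n k \<in> borel_measurable
                      (PiM {..<K*n} (\<lambda>_. obs_space SX) \<Otimes>\<^sub>M uniform_count_measure (partitions K n))"
    and dml2: "is_DML2 sc etahat eps K th2"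
    and dml2_meas: "\<forall>n. th2 n \<in> borel_measurable
                      (PiM {..<K*n} (\<lambda>_. obs_space SX) \<Otimes>\<^sub>M uniform_count_measure (partitions K n))"
  shows
    (* first-order equivalence of DML1 and DML2, uniformly over P *)
    "(\<forall>Ps. (\<forall>n. Ps n \<in> Pfam) \<longrightarrow> (\<forall>e>0.
        (\<lambda>n. measure (dml_space (Ps n) K n)
               {z \<in> space (dml_space (Ps n) K n).
                  sqrt (real (K*n)) * \<bar>dml1_est K thk n z - th2 n z\<bar> > e}) \<longlonglongrightarrow> 0))
   \<and> (\<forall>th \<in> {dml1_est K thk, th2}.
       (\<forall>Ps. (\<forall>n. Ps n \<in> Pfam) \<longrightarrow>
          weak_conv_m
            (\<lambda>n. distr (dml_space (Ps n) K n) borel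
               (\<lambda>z. inverse (sqrt (sigma2 (Ps n) (theta0 (Ps n)) (g0 (Ps n)) (m0 (Ps n))))
                    * sqrt (real (K*n)) * (th n z - theta0 (Ps n))))
            N01
        \<and> weak_conv_m
            (\<lambda>n. distr (dml_space (Ps n) K n) borel
               (\<lambda>z. inverse (sqrt (sigma2_hat sc etahat K n (th n z) (fst z) (snd z)))
                    * sqrt (real (K*n)) * (th n z - theta0 (Ps n))))
            N01)
     \<and> (\<forall>\<alpha>. 0 < \<alpha> \<and> \<alpha> < 1 \<longrightarrow> (\<forall>e>0. \<exists>n0. \<forall>n\<ge>n0. \<forall>P\<in>Pfam.
          \<bar>measure (dml_space P K n)
              {z \<in> space (dml_space P K n).
                 theta0 P \<in> {th n z - Phi_inv (1 - \<alpha> / 2) * sqrt (sigma2_hat sc etahat K n (th n z) (fst z) (snd z)) / sqrt (real (K*n))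
                            .. th n z + Phi_inv (1 - \<alpha> / 2) * sqrt (sigma2_hat sc etahat K n (th n z) (fst z) (snd z)) / sqrt (real (K*n))}}
           - (1 - \<alpha>)\<bar> \<le> e)))"
proof -
  interpret S: dml_setting SX Pfam theta0 g0 m0 l0 r0 K c C q delta Delta eps sc etahat
    using assms by unfold_locales (auto intro!: pliv.intro)
  have "dml_setting_seq SX Pfam theta0 g0 m0 l0 r0 K c C q delta Delta eps sc etahat Ps" if "\<And>n. Ps n \<in> Pfam" for Ps
    by (rule dml_setting_seq.intro[OF S.dml_setting_axioms dml_setting_seq_axioms.intro[OF that]])
  note limits = dml_setting_seq.DML_limits[OF this dml1 dml2 dml1_meas dml2_meas]
  note coverage = uniform_from_sequences[OF limits(4)]
  show ?thesis
    by (intro conjI allI ballI impI limits(1) limits(2) limits(3) coverage) auto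
qed

end
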